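(* Suppose the process $\hat w=(\hat x(t),\hat u(t))$, $t\in[\hat t_0,\hat t_1]$, is admissible and provides the strong minimum in Problem A (defined in the context). Then it satisfies the Pontryagin maximum principle. That is, writing $(t_0,t_1,x,u)$ for $(\hat t_0,\hat t_1,\hat x,\hat u)$, there exist a number $\alpha_0\in\mathbb{R}$, row vectors $\alpha\in\mathbb{R}^{d(F)}$, $\beta\in\mathbb{R}^{d(K)}$, and absolutely continuous functions $\psi_x:[t_0,t_1]\to\mathbb{R}^n$ (row vector valued) and $\psi_t:[t_0,t_1]\to\mathbb{R}$ such that: (i) $\alpha_0\ge 0$ and $\alpha\ge 0$ (componentwise); (ii) $\alpha_0+|\alpha|+|\beta|>0$; (iii) $\alpha F(t_0,x(t_0),t_1,x(t_1))=0$; (iv) for a.a. $t\in[t_0,t_1]$: $-\dot\psi_x(t)=H_x(\psi_x(t),t,x(t),u(t))$ and $-\dot\psi_t(t)=H_t(\psi_x(t),t,x(t),u(t))$; (v) with all derivatives of $l$ evaluated at $(t_0,x(t_0),t_1,x(t_1))$: $\psi_x(t_0)=l_{x_0}$, $\psi_x(t_1)=-l_{x_1}$, $\psi_t(t_0)=l_{t_0}$, $\psi_t(t_1)=-l_{t_1}$; (vi) $H(\psi_x(t),t,x(t),u(t))+\psi_t(t)=0$ for a.a. $t\in[t_0,t_1]$; (vii) $H(\psi_x(t),t,x(t),u')+\psi_t(t)\le 0$ for all $t\in[t_0,t_1]$ and all $u'\in U$.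
   Context: Problem A (general Pontryagin type problem). On a time interval $[t_0,t_1]$ that is not fixed a priori, consider $$\dot x(t)=f(t,x(t),u(t)),\quad u(t)\in U,$$ $$K(t_0,x(t_0),t_1,x(t_1))=0,\qquad F(t_0,x(t_0),t_1,x(t_1))\le 0,$$ $$J=F_0(t_0,x(t_0),t_1,x(t_1))\to\min .$$ Here $x\in\mathbb{R}^n$ is the state and $u\in\mathbb{R}^r$ is the control; $F_0$ is real valued, and $F$, $K$ are vector valued functions on $\mathbb{R}^{2n+2}$ with values in $\mathbb{R}^{d(F)}$, $\mathbb{R}^{d(K)}$; the inequality $F\le 0$ is componentwise. The functions $F_0,F,K$ are of class $C^1$. The function $f(t,x,u)$ with values in $\mathbb{R}^n$ is continuous together with its partial derivatives $f_t$ and $f_x$ in all variables $(t,x,u)$. The set $U\subset\mathbb{R}^r$ is arbitrary. A process is a pair $w(t)=(x(t),u(t))$ together with its interval of definition $[t_0,t_1]$, where $x$ is absolutely continuous and $u$ is measurable and bounded. A process is admissible if it satisfies all the constraints of the problem, the relations $\dot x=f(t,x,u)$, $u\in U$ being required almost everywhere. An admissible process $\hat w=(\hat x,\hat u)$ on $[\hat t_0,\hat t_1]$ provides the strong minimum if there is $\varepsilon>0$ such that $J(w)\ge J(\hat w)$ for all admissible processes $w=(x,u)$ on $[t_0,t_1]$ satisfying $|t_0-\hat t_0|<\varepsilon$, $|t_1-\hat t_1|<\varepsilon$ and $|x(t)-\hat x(t)|<\varepsilon$ for all $t\in[t_0,t_1]\cap[\hat t_0,\hat t_1]$. The Pontryagin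 function is $H(\psi_x,t,x,u)=\psi_x f(t,x,u)$, where $\psi_x$ is a row vector of dimension $n$; $H_x,H_t$ are its partial derivatives in $x$ and $t$. The endpoint Lagrange function is $l(t_0,x_0,t_1,x_1)=(\alpha_0F_0+\alpha F+\beta K)(t_0,x_0,t_1,x_1)$, with partial derivatives $l_{t_0},l_{x_0},l_{t_1},l_{x_1}$. In $\psi_x$ and $\psi_t$ the letters $x,t$ are labels, not derivatives. *)

theory Defs
  imports "HOL-Analysis.Analysis"
begin

text \<open>The argument \<open>(t\<^sub>0, x\<^sub>0, t\<^sub>1, x\<^sub>1)\<close> of the endpoint functions.\<close>

type_synonym 'n endpt = "real \<times> (real ^ 'n) \<times> real \<times> (real ^ 'n)"

text \<open>The library's \<open>absolutely_continuous\<close> concerns measures; this is the usual notion for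
  functions on a compact interval.\<close>

definition absolutely_continuous_fun :: "real \<Rightarrow> real \<Rightarrow> (real \<Rightarrow> 'a::real_normed_vector) \<Rightarrow> bool" where
  "absolutely_continuous_fun a b g \<longleftrightarrow>
     (\<forall>\<epsilon>>0. \<exists>\<delta>>0. \<forall>(m::nat) (l::nat \<Rightarrow> real) (r::nat \<Rightarrow> real).
        (\<forall>i<m. a \<le> l i \<and> l i \<le> r i \<and> r i \<le> b) \<longrightarrow>
        disjoint_family_on (\<lambda>i. {l i<..<r i}) {..<m} \<longrightarrow>
        (\<Sum>i<m. r i - l i) < \<delta> \<longrightarrow>
        (\<Sum>i<m. norm (g (r i) - g (l i))) < \<epsilon>)"

definition C1_function :: "('a::real_normed_vector \<Rightarrow> 'b::real_normed_vector) \<Rightarrow> bool" where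
  "C1_function g \<longleftrightarrow>
     (\<exists>g' :: 'a \<Rightarrow> 'a \<Rightarrow>\<^sub>L 'b.
        (\<forall>z. (g has_derivative blinfun_apply (g' z)) (at z)) \<and> continuous_on UNIV g')"

definition gradient :: "('a::real_inner \<Rightarrow> real) \<Rightarrow> 'a \<Rightarrow> 'a" where
  "gradient g x = (THE D. GDERIV g x :> D)"

lemma gradient_eq:
  assumes "GDERIV g x :> D"
  shows "gradient g x = D"
proof -
  have "E = D" if "GDERIV g x :> E" for E
  proof -
    have "(\<lambda>h. inner h E) = (\<lambda>h. inner h D)"
      using has_derivative_unique that assms unfolding gderiv_def by blast
    then have "inner (E - D) E = inner (E - D) D"
      by (rule fun_cong)
    then show "E = D"
      by (metis inner_eq_zero_iff inner_diff_right right_minus_eq)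
  qed
  with assms show ?thesis
    unfolding gradient_def by blast
qed

definition regular_rhs :: "(real \<Rightarrow> real ^ 'n \<Rightarrow> real ^ 'r \<Rightarrow> real ^ 'n) \<Rightarrow> bool" where
  "regular_rhs f \<longleftrightarrow>
     continuous_on UNIV (\<lambda>(t, x, u). f t x u) \<and>
     (\<exists>f\<^sub>t :: real \<times> (real ^ 'n) \<times> (real ^ 'r) \<Rightarrow> real ^ 'n.
        (\<forall>t x u. ((\<lambda>s. f s x u) has_vector_derivative f\<^sub>t (t, x, u)) (at t)) \<and>
        continuous_on UNIV f\<^sub>t) \<and>
     (\<exists>f\<^sub>x :: real \<times> (real ^ 'n) \<times> (real ^ 'r) \<Rightarrow> (real ^ 'n) \<Rightarrow>\<^sub>L (real ^ 'n).
        (\<forall>t x u. ((\<lambda>y. f t y u) has_derivative blinfun_apply (f\<^sub>x (t, x, u))) (at x)) \<and>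
        continuous_on UNIV f\<^sub>x)"

text \<open>State and control are total functions on the reals of which only the values on
  \<open>{t\<^sub>0..t\<^sub>1}\<close> matter.\<close>

definition is_process :: "real \<Rightarrow> real \<Rightarrow> (real \<Rightarrow> real ^ 'n) \<Rightarrow> (real \<Rightarrow> real ^ 'r) \<Rightarrow> bool" where
  "is_process t\<^sub>0 t\<^sub>1 x u \<longleftrightarrow>
     t\<^sub>0 < t\<^sub>1 \<and> absolutely_continuous_fun t\<^sub>0 t\<^sub>1 x \<and>
     u \<in> borel_measurable (lebesgue_on {t\<^sub>0..t\<^sub>1}) \<and> bounded (u ` {t\<^sub>0..t\<^sub>1})"

text \<open>The vector valued functions \<open>F\<close> and \<open>K\<close> are given by their components \<open>F i\<close>, \<open>i < dF\<close>,
  and \<open>K j\<close>, \<open>j < dK\<close>, so that either kind of endpoint constraint may be absent.\<close>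

definition admissible ::
  "(real \<Rightarrow> real ^ 'n \<Rightarrow> real ^ 'r \<Rightarrow> real ^ 'n) \<Rightarrow> (real ^ 'r) set \<Rightarrow>
   nat \<Rightarrow> (nat \<Rightarrow> 'n endpt \<Rightarrow> real) \<Rightarrow> nat \<Rightarrow> (nat \<Rightarrow> 'n endpt \<Rightarrow> real) \<Rightarrow>
   real \<Rightarrow> real \<Rightarrow> (real \<Rightarrow> real ^ 'n) \<Rightarrow> (real \<Rightarrow> real ^ 'r) \<Rightarrow> bool" where
  "admissible f U dF F dK K t\<^sub>0 t\<^sub>1 x u \<longleftrightarrow>
     is_process t\<^sub>0 t\<^sub>1 x u \<and>
     (AE t in lebesgue_on {t\<^sub>0..t\<^sub>1}.
        (x has_vector_derivative f t (x t) (u t)) (at t within {t\<^sub>0..t\<^sub>1})) \<and>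
     (AE t in lebesgue_on {t\<^sub>0..t\<^sub>1}. u t \<in> U) \<and>
     (\<forall>j<dK. K j (t\<^sub>0, x t\<^sub>0, t\<^sub>1, x t\<^sub>1) = 0) \<and>
     (\<forall>i<dF. F i (t\<^sub>0, x t\<^sub>0, t\<^sub>1, x t\<^sub>1) \<le> 0)"

definition strong_minimum ::
  "('n endpt \<Rightarrow> real) \<Rightarrow> (real \<Rightarrow> real ^ 'n \<Rightarrow> real ^ 'r \<Rightarrow> real ^ 'n) \<Rightarrow> (real ^ 'r) set \<Rightarrow>
   nat \<Rightarrow> (nat \<Rightarrow> 'n endpt \<Rightarrow> real) \<Rightarrow> nat \<Rightarrow> (nat \<Rightarrow> 'n endpt \<Rightarrow> real) \<Rightarrow>
   real \<Rightarrow> real \<Rightarrow> (real \<Rightarrow> real ^ 'n) \<Rightarrow> (real \<Rightarrow> real ^ 'r) \<Rightarrow> bool" where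
  "strong_minimum F\<^sub>0 f U dF F dK K t\<^sub>0 t\<^sub>1 x u \<longleftrightarrow>
     admissible f U dF F dK K t\<^sub>0 t\<^sub>1 x u \<and>
     (\<exists>\<epsilon>>0. \<forall>s\<^sub>0 s\<^sub>1 y v.
        admissible f U dF F dK K s\<^sub>0 s\<^sub>1 y v \<longrightarrow>
        \<bar>s\<^sub>0 - t\<^sub>0\<bar> < \<epsilon> \<longrightarrow> \<bar>s\<^sub>1 - t\<^sub>1\<bar> < \<epsilon> \<longrightarrow>
        (\<forall>t\<in>{s\<^sub>0..s\<^sub>1} \<inter> {t\<^sub>0..t\<^sub>1}. norm (y t - x t) < \<epsilon>) \<longrightarrow>
        F\<^sub>0 (s\<^sub>0, y s\<^sub>0, s\<^sub>1, y s\<^sub>1) \<ge> F\<^sub>0 (t\<^sub>0, x t\<^sub>0, t\<^sub>1, x t\<^sub>1))"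

text \<open>Row vectors are represented as elements of \<open>real ^ 'n\<close>, their product with a column as
  the inner product.\<close>

definition pontryagin_fun ::
  "(real \<Rightarrow> real ^ 'n \<Rightarrow> real ^ 'r \<Rightarrow> real ^ 'n) \<Rightarrow> real ^ 'n \<Rightarrow> real \<Rightarrow> real ^ 'n \<Rightarrow> real ^ 'r \<Rightarrow> real" where
  "pontryagin_fun f \<psi> t x u = \<psi> \<bullet> f t x u"

definition endpoint_lagrange ::
  "real \<Rightarrow> ('n endpt \<Rightarrow> real) \<Rightarrow> nat \<Rightarrow> (nat \<Rightarrow> real) \<Rightarrow> (nat \<Rightarrow> 'n endpt \<Rightarrow> real) \<Rightarrow>
   nat \<Rightarrow> (nat \<Rightarrow> real) \<Rightarrow> (nat \<Rightarrow> 'n endpt \<Rightarrow> real) \<Rightarrow> 'n endpt \<Rightarrow> real" where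
  "endpoint_lagrange \<alpha>\<^sub>0 F\<^sub>0 dF \<alpha> F dK \<beta> K z =
     \<alpha>\<^sub>0 * F\<^sub>0 z + (\<Sum>i<dF. \<alpha> i * F i z) + (\<Sum>j<dK. \<beta> j * K j z)"

end

theory Submission
  imports Defs
begin

text \<open>
  The proof uses the change of time of Dubovitskii and Milyutin. Finitely many intervals of unit length are
  inserted into the time axis at points \<open>\<theta> i\<close>. On them the clock stands still, and the control has the value
  \<open>v i \<in> U\<close>. Now vary the initial time, the initial state, the speed of the clock on the original part of the axis
  (all freely), and the speeds \<open>\<rho> i \<ge> 0\<close> on the inserted intervals. By Gronwall's inequality the end point is
  strictly differentiable in these finitely many parameters, and the adjoint functions \<open>\<psi>\<^sub>x\<close>, \<open>\<psi>\<^sub>t\<close> give its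
  derivative: the derivative in the speed of the clock is \<open>\<integral> (H + \<psi>\<^sub>t) dt\<close>, and that in \<open>\<rho> i\<close> is \<open>H + \<psi>\<^sub>t\<close> at
  \<open>(\<theta> i, v i)\<close>. Every small choice of the parameters is realized by an admissible process, so the Fritz John
  theorem gives normalized multipliers with \<open>\<integral> (H + \<psi>\<^sub>t) dt = 0\<close> and \<open>H + \<psi>\<^sub>t \<le> 0\<close> at the chosen pairs. By compactness
  of the set of normalized multipliers the inequality holds at all pairs \<open>(t, u')\<close> simultaneously; together with
  the vanishing integral it yields \<open>H + \<psi>\<^sub>t = 0\<close> almost everywhere along the process.
\<close>

section \<open>Absolutely continuous functions and differentiation of integrals\<close>

text \<open>Needle variations replace the reference control near a time and need Lebesgue points of
  it there. An inserted interval displaces no value of the reference control, so it works at every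
  time, for every value in \<open>U\<close>, and for several values at one time. The price: speeds
  cannot be negative, so differentiability in \<open>\<rho>\<close> is one-sided, and a varied clock
  may stand still, so it has no inverse. The adjoint functions belong to the single endpoint
  functions and are fixed before any multipliers are known. They do not depend on the chosen pairs,
  so the multipliers for all finite sets of pairs lie in one compact cube; by linearity the adjoint
  functions are combined only at the end. The normalization is a closed condition, which keeps the
  limit nontrivial. As \<open>U\<close> is arbitrary and a time change may destroy Lebesgue
  measurability, the control is first made Borel with values in \<open>U\<close> everywhere by a
  change on a null set. Absolute continuity enters once, for the given state, which turns out to be
  Lipschitz because the control is bounded.\<close>

lemma sum_tagged_le_measure:
  fixes p :: "(real \<times> real set) set"
  assumes p: "p tagged_partial_division_of S" and G: "G \<in> lmeasurable" and sub: "\<And>x K. (x, K) \<in> p \<Longrightarrow> K \<subseteq> G"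
  shows "(\<Sum>(x, K)\<in>p. measure lborel K) \<le> measure lebesgue G"
proof -
  note D = tagged_partial_division_ofD[OF p]
  \<comment> \<open>Disjoint interiors leave only an interval with empty interior as the overlap, so
    lengths add up like measures of disjoint sets.\<close>
  have neg: "negligible (K \<inter> L)" if xy: "(x, K) \<in> p" "(y, L) \<in> p" "(x, K) \<noteq> (y, L)" for x K y L
  proof -
    obtain a b c d where KL: "K = cbox a b" "L = cbox c d"
      using D(4)[OF xy(1)] D(4)[OF xy(2)] by blast
    obtain u v where uv: "cbox a b \<inter> cbox c d = cbox u v" by (simp only: Int_interval)
    have "interior K \<inter> interior L = {}" using D(5)[OF xy] .
    then have "box u v = {}" using uv KL by (metis interior_Int interior_cbox)
    then show ?thesis unfolding KL uv by (simp only: negligible_interval)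
  qed
  have "(\<Sum>(x, K)\<in>p. measure lborel K) = (\<Sum>xK\<in>p. measure lebesgue (snd xK))"
  proof (intro sum.cong)
    show "(case xK of (x, K) \<Rightarrow> measure lborel K) = measure lebesgue (snd xK)" if "xK \<in> p" for xK
      using D(4)[of "fst xK" "snd xK"] that by (auto simp: measure_completion case_prod_unfold)
  qed simp
  also have "\<dots> = measure lebesgue (\<Union>(snd ` p))"
  proof (rule measure_negligible_finite_Union_image [symmetric, OF D(1)])
    show "snd xK \<in> lmeasurable" if "xK \<in> p" for xK
      using D(4)[of "fst xK" "snd xK"] that by auto
    show "pairwise (\<lambda>xK yL. negligible (snd xK \<inter> snd yL)) p"
      unfolding pairwise_def using neg by (metis prod.collapse)
  qed
  also have "\<dots> \<le> measure lebesgue G"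
  proof (rule measure_mono_fmeasurable)
    show "\<Union>(snd ` p) \<subseteq> G" using sub by fastforce
    show "\<Union>(snd ` p) \<in> sets lebesgue" 
    proof (intro sets.finite_UN D(1))
      show "snd xK \<in> sets lebesgue" if "xK \<in> p" for xK
        using D(4)[of "fst xK" "snd xK"] that by auto
    qed
  qed (use G in auto)
  finally show ?thesis .
qed

text \<open>Bridge from numbered families of open intervals to the tagged divisions of the gauge
  integral: the elements with tags in a null set will form such a partial division of small total
  length.\<close>

lemma absolutely_continuous_fun_tagged:
  assumes ac: "absolutely_continuous_fun a b g" and "e > 0"
  obtains d where "d > 0" "\<And>p. p tagged_partial_division_of {a..b} \<Longrightarrow> (\<Sum>(x, K)\<in>p. measure lborel K) < d \<Longrightarrow>
    (\<Sum>(x, K)\<in>p. norm (g (Sup K) - g (Inf K))) < e"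
proof -
  obtain d where "d > 0" and d: "\<And>m l r. (\<forall>i<m::nat. a \<le> l i \<and> l i \<le> r i \<and> r i \<le> b) \<Longrightarrow>
        disjoint_family_on (\<lambda>i. {l i<..<r i}) {..<m} \<Longrightarrow>
        (\<Sum>i<m. r i - l i) < d \<Longrightarrow> (\<Sum>i<m. norm (g (r i) - g (l i))) < e"
    using ac \<open>e > 0\<close> unfolding absolutely_continuous_fun_def by meson
  show thesis
  proof (rule that [OF \<open>d > 0\<close>])
    fix p assume p: "p tagged_partial_division_of {a..b}" and less: "(\<Sum>(x, K)\<in>p. measure lborel K) < d"
    note D = tagged_partial_division_ofD[OF p]
    obtain h where h: "bij_betw h {..<card p} p"
      using ex_bij_betw_nat_finite[OF D(1)] by (auto simp: atLeast0LessThan)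
    have K: "\<exists>x u v. h i = (x, {u..v}) \<and> a \<le> u \<and> u \<le> v \<and> v \<le> b" if "i < card p" for i
    proof -
      have "h i \<in> p" using h that by (auto simp: bij_betw_def)
      then obtain x u v where 1: "h i = (x, {u..v})" "(x, {u..v}) \<in> p"
        using D(4) by (metis box_real(2) prod.exhaust_sel)
      then have "u \<le> v" "{u..v} \<subseteq> {a..b}" using D(2,3) by fastforce+
      with 1 show ?thesis by auto
    qed
    \<comment> \<open>An element contains its tag, so it is nonempty, and \<open>Inf\<close> and
      \<open>Sup\<close> recover its end points.\<close>
    define l where "l = (\<lambda>i. Inf (snd (h i)))"
    define r where "r = (\<lambda>i. Sup (snd (h i)))"
    have lr: "a \<le> l i \<and> l i \<le> r i \<and> r i \<le> b \<and> snd (h i) = {l i..r i}" if "i < card p" for i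
      using K[OF that] by (auto simp: l_def r_def)
    have "(\<Sum>i<card p. norm (g (r i) - g (l i))) < e"
    proof (rule d)
      show "disjoint_family_on (\<lambda>i. {l i<..<r i}) {..<card p}"
        unfolding disjoint_family_on_def
      proof (intro ballI impI)
        fix i j assume ij: "i \<in> {..<card p}" "j \<in> {..<card p}" "i \<noteq> j"
        then have "h i \<noteq> h j" "h i \<in> p" "h j \<in> p"
          using h by (auto simp: bij_betw_def inj_on_def)
        then have "interior (snd (h i)) \<inter> interior (snd (h j)) = {}"
          by (metis D(5) prod.collapse)
        then show "{l i<..<r i} \<inter> {l j<..<r j} = {}" using lr ij by auto
      qed
      have "(\<Sum>i<card p. r i - l i) = (\<Sum>i<card p. measure lborel (snd (h i)))"
        using lr by (intro sum.cong) auto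
      also have "\<dots> = (\<Sum>(x, K)\<in>p. measure lborel K)"
        using sum.reindex_bij_betw[OF h, of "\<lambda>(x, K). measure lborel K"] by (simp add: case_prod_beta)
      finally show "(\<Sum>i<card p. r i - l i) < d" using less by simp
    qed (use lr in auto)
    also have "(\<Sum>i<card p. norm (g (r i) - g (l i))) = (\<Sum>(x, K)\<in>p. norm (g (Sup K) - g (Inf K)))"
      using sum.reindex_bij_betw[OF h, of "\<lambda>(x, K). norm (g (Sup K) - g (Inf K))"]
      by (simp add: case_prod_beta l_def r_def)
    finally show "(\<Sum>(x, K)\<in>p. norm (g (Sup K) - g (Inf K))) < e" .
  qed
qed

text \<open>The elements of a fine division fall into two kinds. Tags in \<open>N\<close> own
  elements of small total length, where absolute continuity bounds the increments of
  \<open>g\<close>; at all other tags differentiability compares the increment with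
  \<open>g'\<close> times the length.\<close>

theorem fundamental_theorem_of_calculus_absolutely_continuous:
  fixes g :: "real \<Rightarrow> 'a::banach"
  assumes "a \<le> b" and ac: "absolutely_continuous_fun a b g" and N: "negligible N"
    and deriv: "\<And>t. t \<in> {a..b} - N \<Longrightarrow> (g has_vector_derivative g' t) (at t within {a..b})"
  shows "(g' has_integral (g b - g a)) {a..b}"
proof -
  \<comment> \<open>With value zero on \<open>N\<close>, the elements tagged there contribute
    nothing but their increments of \<open>g\<close>; the integral does not see the change.\<close>
  define h where "h = (\<lambda>t. if t \<in> N then 0 else g' t)"
  have "(h has_integral (g b - g a)) (cbox a b)"
    unfolding has_integral
  proof (intro allI impI)
    fix e :: real assume "e > 0"
    \<comment> \<open>Half of \<open>e\<close> is left for the tags in \<open>N\<close>; the summand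
      \<open>1\<close> covers the case \<open>a = b\<close>.\<close>
    define e' where "e' = e / (2 * (b - a + 1))"
    have e': "e' > 0" "e' * (b - a) < e / 2" using \<open>e > 0\<close> \<open>a \<le> b\<close>
      by (auto simp: e'_def field_simps)
    obtain \<eta> where "\<eta> > 0" and \<eta>: "\<And>p. p tagged_partial_division_of {a..b} \<Longrightarrow> (\<Sum>(x, K)\<in>p. measure lborel K) < \<eta> \<Longrightarrow>
      (\<Sum>(x, K)\<in>p. norm (g (Sup K) - g (Inf K))) < e / 2"
      using absolutely_continuous_fun_tagged[OF ac, of "e / 2"] \<open>e > 0\<close> by auto
    obtain T where T: "open T" "N \<subseteq> T" "T - N \<in> lmeasurable" "emeasure lebesgue (T - N) < ennreal \<eta>"
      using sets_lebesgue_outer_open[OF _ \<open>\<eta> > 0\<close>] N by (metis negligible_imp_sets)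
    have T_meas: "T \<in> lmeasurable" "measure lebesgue T < \<eta>"
    proof -
      have T_eq: "T = (T - N) \<union> N" using T(2) by auto
      have Nl: "N \<in> lmeasurable" "measure lebesgue N = 0"
        using N by (auto simp: negligible_iff_measure)
      show 1: "T \<in> lmeasurable" using T_eq T(3) Nl(1) by (metis fmeasurable.Un)
      have "measure lebesgue T \<le> measure lebesgue (T - N) + measure lebesgue N"
        using T_eq T(3) Nl(1) by (metis measure_Un_le fmeasurableD)
      moreover have "measure lebesgue (T - N) < \<eta>"
        using T(3,4) \<open>\<eta> > 0\<close> by (simp add: emeasure_eq_measure2 ennreal_less_iff)
      ultimately show "measure lebesgue T < \<eta>" using Nl(2) by simp
    qed
    \<comment> \<open>The gauge: the radius comes from differentiability off \<open>N\<close>, and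
      on \<open>N\<close> it keeps the ball inside the small open set \<open>T\<close>.\<close>
    have "\<forall>x. \<exists>d>0. (x \<in> {a..b} - N \<longrightarrow>
         (\<forall>y\<in>{a..b}. norm (y-x) < d \<longrightarrow> norm (g y - g x - (y-x) *\<^sub>R g' x) \<le> e' * norm (y-x))) \<and>
         (x \<in> N \<longrightarrow> ball x d \<subseteq> T)"
    proof
      fix x
      consider "x \<in> N" | "x \<in> {a..b} - N" | "x \<notin> N" "x \<notin> {a..b}" by auto
      then show "\<exists>d>0. (x \<in> {a..b} - N \<longrightarrow>
         (\<forall>y\<in>{a..b}. norm (y-x) < d \<longrightarrow> norm (g y - g x - (y-x) *\<^sub>R g' x) \<le> e' * norm (y-x))) \<and>
         (x \<in> N \<longrightarrow> ball x d \<subseteq> T)"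
      proof cases
        case 1
        then obtain d where "d > 0" "ball x d \<subseteq> T" using T(1,2) by (meson open_contains_ball subsetD)
        with 1 show ?thesis by auto
      next
        case 2
        with deriv[OF 2, unfolded has_vector_derivative_def has_derivative_within_alt] e'(1)
        show ?thesis by auto
      next
        case 3
        then show ?thesis by (auto intro: exI[of _ 1])
      qed
    qed
    then obtain d where d: "\<And>x. 0 < d x"
      "\<And>x y. \<lbrakk>x \<in> {a..b} - N; y \<in> {a..b}; norm (y-x) < d x\<rbrakk>
                        \<Longrightarrow> norm (g y - g x - (y-x) *\<^sub>R g' x) \<le> e' * norm (y-x)"
      "\<And>x. x \<in> N \<Longrightarrow> ball x (d x) \<subseteq> T"
      by metis
    show "\<exists>\<gamma>. gauge \<gamma> \<and> (\<forall>p. p tagged_division_of cbox a b \<and> \<gamma> fine p \<longrightarrow>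
            norm ((\<Sum>(x, K)\<in>p. measure lborel K *\<^sub>R h x) - (g b - g a)) < e)"
    proof (rule exI, safe)
      show "gauge (\<lambda>x. ball x (d x))" using d(1) gauge_ball_dependent by blast
      fix p assume ptag: "p tagged_division_of cbox a b" and fine: "(\<lambda>x. ball x (d x)) fine p"
      then have part: "p tagged_partial_division_of {a..b}" by (simp add: tagged_division_of_def)
      note D = tagged_partial_division_ofD[OF part]
      have ba: "b - a = (\<Sum>(x,K)\<in>p. Sup K - Inf K)" "g b - g a = (\<Sum>(x,K)\<in>p. g (Sup K) - g (Inf K))"
        using additive_tagged_division_1[where f= "\<lambda>x. x"] additive_tagged_division_1[where f= g]
            \<open>a \<le> b\<close> ptag by auto
      define q where "q = {xK \<in> p. fst xK \<in> N}"
      have q: "q tagged_partial_division_of {a..b}"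
        using part by (rule tagged_partial_division_subset) (auto simp: q_def)
      have "(\<Sum>(x, K)\<in>q. measure lborel K) \<le> measure lebesgue T"
        by (rule sum_tagged_le_measure[OF q T_meas(1)])
          (use fine d(3) in \<open>fastforce simp: q_def fine_def\<close>)
      then have sum_q: "(\<Sum>(x, K)\<in>q. norm (g (Sup K) - g (Inf K))) < e / 2"
        using \<eta>[OF q] T_meas(2) by linarith
      have K: "\<exists>u v. K = {u..v} \<and> a \<le> u \<and> u \<le> x \<and> x \<le> v \<and> v \<le> b" if xK: "(x, K) \<in> p" for x K
      proof -
        obtain u v where "K = {u..v}" using D(4)[OF xK] by auto
        with D(2)[OF xK] D(3)[OF xK] show ?thesis by auto
      qed
      have main: "norm (measure lborel K *\<^sub>R h x - (g (Sup K) - g (Inf K))) \<le>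
          e' * (Sup K - Inf K) + (if x \<in> N then norm (g (Sup K) - g (Inf K)) else 0)" if xK: "(x, K) \<in> p" for x K
      proof -
        obtain u v where uv: "K = {u..v}" "a \<le> u" "u \<le> x" "x \<le> v" "v \<le> b" using K[OF xK] by auto
        show ?thesis
        proof (cases "x \<in> N")
          case True
          then show ?thesis using uv e' norm_minus_commute[of "g u" "g v"] by (simp add: h_def)
        next
          case False
          have "K \<subseteq> ball x (d x)" using fine xK by (auto simp: fine_def)
          moreover have "u \<in> K" "v \<in> K" using uv by auto
          ultimately have "u \<in> ball x (d x)" "v \<in> ball x (d x)" by blast+
          then have dd: "norm (u - x) < d x" "norm (v - x) < d x"
            by (auto simp: dist_real_def)
          \<comment> \<open>Straddle argument: the tag lies between \<open>u\<close> and
            \<open>v\<close>, so the two errors are \<open>e'\<close> times lengths that sum to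
            \<open>v - u\<close>.\<close>
          have "norm ((v - u) *\<^sub>R g' x - (g v - g u)) = norm (g u - g x - (u - x) *\<^sub>R g' x - (g v - g x - (v - x) *\<^sub>R g' x))"
            by (auto simp: algebra_simps)
          also have "\<dots> \<le> norm (g u - g x - (u - x) *\<^sub>R g' x) + norm (g v - g x - (v - x) *\<^sub>R g' x)"
            by (rule norm_triangle_ineq4)
          also have "\<dots> \<le> e' * norm (u - x) + e' * norm (v - x)"
            using uv dd False by (intro add_mono d(2)) auto
          also have "\<dots> = e' * (v - u)" using uv by (simp add: algebra_simps)
          finally show ?thesis using uv False by (simp add: h_def)
        qed
      qed
      have "norm ((\<Sum>(x, K)\<in>p. measure lborel K *\<^sub>R h x) - (g b - g a))
          = norm (\<Sum>(x, K)\<in>p. measure lborel K *\<^sub>R h x - (g (Sup K) - g (Inf K)))"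
        by (simp add: ba(2) sum_subtractf case_prod_unfold)
      also have "\<dots> \<le> (\<Sum>(x, K)\<in>p. e' * (Sup K - Inf K) + (if x \<in> N then norm (g (Sup K) - g (Inf K)) else 0))"
        using main by (intro sum_norm_le) auto
      also have "\<dots> = e' * (b - a) + (\<Sum>(x, K)\<in>q. norm (g (Sup K) - g (Inf K)))"
        using D(1) by (simp add: ba(1) sum.distrib case_prod_unfold sum_distrib_left q_def sum.inter_filter)
      also have "\<dots> < e" using sum_q e' by simp
      finally show "norm ((\<Sum>(x, K)\<in>p. measure lborel K *\<^sub>R h x) - (g b - g a)) < e" .
    qed
  qed
  then have "(h has_integral (g b - g a)) {a..b}" by simp
  then show ?thesis
    by (rule has_integral_spike[OF N, rotated]) (auto simp: h_def)
qed

text \<open>Lebesgue's differentiation theorem for the gauge integral. Where differentiation fails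
  by more than \<open>e\<close>, arbitrarily short intervals show a large deviation between the
  integral and value times length. A disjoint Vitali family of them is a fine partial division, and
  Henstock's lemma makes the sum of all its deviations small.\<close>

theorem has_vector_derivative_indefinite_integral:
  fixes f :: "real \<Rightarrow> 'a::euclidean_space"
  assumes f: "f integrable_on {a..b}"
  shows "\<exists>N. negligible N \<and>
    (\<forall>t\<in>{a..b} - N. ((\<lambda>s. integral {a..s} f) has_vector_derivative f t) (at t within {a..b}))"
proof -
  \<comment> \<open>The point need not be the centre: the choices \<open>u = t\<close> and
    \<open>v = t\<close> later give the two one-sided quotients.\<close>
  define good where "good = (\<lambda>e t. \<exists>d>0. \<forall>u v. a \<le> u \<longrightarrow> u \<le> t \<longrightarrow> t \<le> v \<longrightarrow> v \<le> b \<longrightarrow> v - u < d \<longrightarrow>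
     norm ((v - u) *\<^sub>R f t - integral {u..v} f) \<le> e * (v - u))"
  have bad: "negligible {t \<in> {a..b}. \<not> good e t}" if "e > 0" for e
  proof -
    define B where "B = {t \<in> {a..b}. \<not> good e t}"
    have "\<exists>T. B \<subseteq> T \<and> T \<in> lmeasurable \<and> measure lebesgue T \<le> \<eta>" if "\<eta> > 0" for \<eta>
    proof -
      have "f integrable_on cbox a b" "e * \<eta> > 0" using f \<open>e > 0\<close> \<open>\<eta> > 0\<close> by auto
      then obtain \<gamma> where "gauge \<gamma>"
        and \<gamma>: "\<And>p. \<lbrakk>p tagged_partial_division_of (cbox a b); \<gamma> fine p\<rbrakk> \<Longrightarrow>
             sum (\<lambda>(x,k). norm(measure lborel k *\<^sub>R f x - integral k f)) p < e * \<eta>"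
        by (rule Henstock_lemma) blast
      \<comment> \<open>The Vitali family: fine intervals around points of \<open>B\<close> whose
        deviation exceeds \<open>e\<close> times their length. With the bound
        \<open>e * \<eta>\<close> from Henstock's lemma, finitely many disjoint ones have total
        length below \<open>\<eta>\<close>.\<close>
      define K where "K = {(t, u, v). t \<in> B \<and> a \<le> u \<and> u \<le> t \<and> t \<le> v \<and> v \<le> b \<and> u < v \<and> {u..v} \<subseteq> \<gamma> t \<and>
        e * (v - u) < norm ((v - u) *\<^sub>R f t - integral {u..v} f)}"
      \<comment> \<open>Centre and radius, because the covering theorem is about balls.\<close>
      define mid where "mid = (\<lambda>(t::real, u, v). (u + v) / 2 :: real)"
      define rad where "rad = (\<lambda>(t::real, u, v). (v - u) / 2 :: real)"
      have cb: "cball (mid (t, u, v)) (rad (t, u, v)) = {u..v}" for t u v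
        by (auto simp: mid_def rad_def dist_real_def abs_le_iff field_simps)
      obtain C where C: "countable C" "C \<subseteq> K"
        "pairwise (\<lambda>i j. disjnt (cball (mid i) (rad i)) (cball (mid j) (rad j))) C"
        "negligible (B - (\<Union>i \<in> C. cball (mid i) (rad i)))"
      proof (rule Vitali_covering_theorem_cballs [of K rad B mid])
        show "0 < rad i" if "i \<in> K" for i using that by (auto simp: K_def rad_def)
        fix t d :: real assume "t \<in> B" "0 < d"
        then have "\<not> good e t" by (simp add: B_def)
        obtain \<delta> where "\<delta> > 0" "ball t \<delta> \<subseteq> \<gamma> t"
          using \<open>gauge \<gamma>\<close> by (meson gauge_def open_contains_ball)
        have "min \<delta> d > 0" using \<open>\<delta> > 0\<close> \<open>d > 0\<close> by simp
        then obtain u v where uv: "a \<le> u" "u \<le> t" "t \<le> v" "v \<le> b" "v - u < min \<delta> d"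
          "\<not> norm ((v - u) *\<^sub>R f t - integral {u..v} f) \<le> e * (v - u)"
          using \<open>\<not> good e t\<close> unfolding good_def by meson
        have "u < v" using uv by (cases "u = v") auto
        have "{u..v} \<subseteq> ball t \<delta>" using uv by (auto simp: dist_real_def)
        then have "(t, u, v) \<in> K" using uv \<open>u < v\<close> \<open>t \<in> B\<close> \<open>ball t \<delta> \<subseteq> \<gamma> t\<close> by (auto simp: K_def)
        moreover have "t \<in> cball (mid (t, u, v)) (rad (t, u, v))" using uv cb by auto
        moreover have "rad (t, u, v) < d" using uv \<open>u < v\<close> by (auto simp: rad_def)
        ultimately show "\<exists>i. i \<in> K \<and> t \<in> cball (mid i) (rad i) \<and> rad i < d" by blast
      qed
      have fin: "measure lebesgue (\<Union>i\<in>D. cball (mid i) (rad i)) \<le> \<eta>" if D: "D \<subseteq> C" "finite D" for D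
      proof -
        define p where "p = (\<lambda>(t, u, v). (t, {u..v})) ` D"
        have inj: "inj_on (\<lambda>(t, u, v). (t, {u..v})) D"
        proof (rule inj_onI)
          fix i j assume i: "i \<in> D" "j \<in> D"
            "(\<lambda>(t, u, v). (t, {u..v})) i = (\<lambda>(t, u, v). (t, {u..v})) j"
          obtain t u v t' u' v' where ij: "i = (t, u, v)" "j = (t', u', v')" by (cases i, cases j)
          then have "(t, u, v) \<in> K" using i D C(2) by auto
          then show "i = j" using i(3) by (auto simp: ij K_def Icc_eq_Icc)
        qed
        have part: "p tagged_partial_division_of (cbox a b)"
          unfolding tagged_partial_division_of_def
        proof (intro conjI allI impI)
          show "finite p" using D by (simp add: p_def)
          fix x L assume "(x, L) \<in> p"
          then obtain u v where uv: "L = {u..v}" "(x, u, v) \<in> D" by (auto simp: p_def)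
          then have "(x, u, v) \<in> K" using C D by blast
          then show "x \<in> L" "L \<subseteq> cbox a b" "\<exists>a b. L = cbox a b" using uv by (auto simp: K_def)
        next
          fix x L y M assume "(x, L) \<in> p \<and> (y, M) \<in> p \<and> (x, L) \<noteq> (y, M)"
          then obtain u v u' v' where uv: "L = {u..v}" "(x, u, v) \<in> D" "M = {u'..v'}" "(y, u', v') \<in> D" "(x, u, v) \<noteq> (y, u', v')"
            by (auto simp: p_def)
          then have "disjnt L M" using C(3) D cb unfolding pairwise_def by (metis subsetD)
          then show "interior L \<inter> interior M = {}"
            using interior_subset[of L] interior_subset[of M] unfolding disjnt_def by blast
        qed
        have "\<gamma> fine p"
        proof (rule fineI)
          fix x L assume "(x, L) \<in> p"
          then obtain u v where uv: "L = {u..v}" "(x, u, v) \<in> D" by (auto simp: p_def)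
          then have "(x, u, v) \<in> K" using C D by blast
          then show "L \<subseteq> \<gamma> x" using uv by (auto simp: K_def)
        qed
        have "e * (\<Sum>i\<in>D. measure lebesgue (cball (mid i) (rad i))) = (\<Sum>(t, u, v)\<in>D. e * (v - u))"
          unfolding sum_distrib_left
        proof (intro sum.cong)
          fix i assume "i \<in> D"
          obtain t u v where i: "i = (t, u, v)" by (cases i)
          then have "u < v" using \<open>i \<in> D\<close> D C(2) by (auto simp: K_def)
          then show "e * measure lebesgue (cball (mid i) (rad i)) = (case i of (t, u, v) \<Rightarrow> e * (v - u))"
            by (simp add: i cb)
        qed simp
        also have "\<dots> \<le> (\<Sum>(t, u, v)\<in>D. norm (measure lborel {u..v} *\<^sub>R f t - integral {u..v} f))"
        proof (rule sum_mono)
          fix i assume "i \<in> D"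
          obtain t u v where i: "i = (t, u, v)" by (cases i)
          then have "(t, u, v) \<in> K" using \<open>i \<in> D\<close> D C(2) by auto
          then show "(case i of (t, u, v) \<Rightarrow> e * (v - u)) \<le>
              (case i of (t, u, v) \<Rightarrow> norm (measure lborel {u..v} *\<^sub>R f t - integral {u..v} f))"
            by (simp add: i K_def)
        qed
        also have "\<dots> = sum (\<lambda>(x,k). norm(measure lborel k *\<^sub>R f x - integral k f)) p"
          unfolding p_def sum.reindex[OF inj] by (simp add: case_prod_unfold)
        also have "\<dots> < e * \<eta>" by (rule \<gamma>[OF part \<open>\<gamma> fine p\<close>])
        finally have "(\<Sum>i\<in>D. measure lebesgue (cball (mid i) (rad i))) < \<eta>" using \<open>e > 0\<close> by simp
        moreover have "measure lebesgue (\<Union>i\<in>D. cball (mid i) (rad i)) \<le> (\<Sum>i\<in>D. measure lebesgue (cball (mid i) (rad i)))"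
          using D by (intro measure_UNION_le) auto
        ultimately show ?thesis by linarith
      qed
      let ?U = "\<Union>i\<in>C. cball (mid i) (rad i)"
      have U: "?U \<in> lmeasurable \<and> measure lebesgue ?U \<le> \<eta>"
        by (rule conjI; rule fmeasurable_UN_bound measure_UN_bound) (use C(1) fin in auto)
      define T where "T = ?U \<union> (B - ?U)"
      have N: "B - ?U \<in> lmeasurable" "measure lebesgue (B - ?U) = 0"
        using C(4) by (auto simp: negligible_iff_measure)
      have "measure lebesgue T \<le> measure lebesgue ?U + measure lebesgue (B - ?U)"
        unfolding T_def using U N by (intro measure_Un_le) auto
      then have "measure lebesgue T \<le> \<eta>" using U N by simp
      moreover have "T \<in> lmeasurable" unfolding T_def using U N by (intro fmeasurable.Un) auto
      ultimately show ?thesis by (intro exI[of _ T]) (auto simp: T_def)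
    qed
    then show ?thesis by (simp add: negligible_outer_le B_def)
  qed
  \<comment> \<open>Countably many tolerances suffice, since \<open>good\<close> is monotone in
    \<open>e\<close>.\<close>
  define N where "N = (\<Union>n::nat. {t \<in> {a..b}. \<not> good (inverse (Suc n)) t})"
  show ?thesis
  proof (intro exI conjI ballI)
    show "negligible N" unfolding N_def by (rule negligible_Union_nat, rule bad) simp
    fix t assume t: "t \<in> {a..b} - N"
    have good: "good e t" if e: "e > 0" for e
    proof -
      obtain n where "inverse (Suc n) < e" using reals_Archimedean[OF e] by auto
      moreover have "good (inverse (Suc n)) t" using t by (auto simp: N_def)
      then obtain d where "d > 0" and d: "\<And>u v. a \<le> u \<Longrightarrow> u \<le> t \<Longrightarrow> t \<le> v \<Longrightarrow> v \<le> b \<Longrightarrow> v - u < d \<Longrightarrow>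
        norm ((v - u) *\<^sub>R f t - integral {u..v} f) \<le> inverse (Suc n) * (v - u)"
        unfolding good_def by meson
      ultimately show ?thesis unfolding good_def
        by (intro exI[of _ d]) (auto intro!: order_trans[OF d] mult_right_mono)
    qed
    show "((\<lambda>s. integral {a..s} f) has_vector_derivative f t) (at t within {a..b})"
      unfolding has_vector_derivative_def has_derivative_within_alt
    proof (intro conjI allI impI bounded_linear_scaleR_left)
      fix e :: real assume "e > 0"
      then obtain d where "d > 0" and d: "\<And>u v. a \<le> u \<Longrightarrow> u \<le> t \<Longrightarrow> t \<le> v \<Longrightarrow> v \<le> b \<Longrightarrow> v - u < d \<Longrightarrow>
        norm ((v - u) *\<^sub>R f t - integral {u..v} f) \<le> e * (v - u)"
        using good unfolding good_def by meson
      show "\<exists>d>0. \<forall>y\<in>{a..b}. norm (y - t) < d \<longrightarrow>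
        norm (integral {a..y} f - integral {a..t} f - (y - t) *\<^sub>R f t) \<le> e * norm (y - t)"
      proof (intro exI conjI ballI impI)
        fix y assume y: "y \<in> {a..b}" "norm (y - t) < d"
        show "norm (integral {a..y} f - integral {a..t} f - (y - t) *\<^sub>R f t) \<le> e * norm (y - t)"
        proof (cases "t \<le> y")
          case True
          have "integral {a..t} f + integral {t..y} f = integral {a..y} f"
            using True y t by (intro Henstock_Kurzweil_Integration.integral_combine integrable_on_subinterval[OF f]) auto
          then have "integral {a..y} f - integral {a..t} f - (y - t) *\<^sub>R f t = - ((y - t) *\<^sub>R f t - integral {t..y} f)"
            by (simp add: algebra_simps)
          then have "norm (integral {a..y} f - integral {a..t} f - (y - t) *\<^sub>R f t) = norm ((y - t) *\<^sub>R f t - integral {t..y} f)"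
            by (simp only: norm_minus_cancel)
          also have "\<dots> \<le> e * (y - t)" using True y t by (intro d) auto
          finally show ?thesis using True by simp
        next
          case False
          have "integral {a..y} f + integral {y..t} f = integral {a..t} f"
            using False y t by (intro Henstock_Kurzweil_Integration.integral_combine integrable_on_subinterval[OF f]) auto
          then have "integral {a..y} f - integral {a..t} f - (y - t) *\<^sub>R f t = (t - y) *\<^sub>R f t - integral {y..t} f"
            by (simp add: algebra_simps)
          then have "norm (integral {a..y} f - integral {a..t} f - (y - t) *\<^sub>R f t) = norm ((t - y) *\<^sub>R f t - integral {y..t} f)"
            by simp
          also have "\<dots> \<le> e * (t - y)" using False y t by (intro d) auto
          finally show ?thesis using False by simp
        qed
      qed (use \<open>d > 0\<close> in auto)
    qed
  qed
qed

section \<open>Lipschitz functions as absolutely continuous functions\<close>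

lemma lipschitz_on_imp_absolutely_continuous_fun:
  assumes "L-lipschitz_on {a..b} g"
  shows "absolutely_continuous_fun a b g"
  unfolding absolutely_continuous_fun_def
proof (intro allI impI)
  fix e :: real assume "e > 0"
  have L: "L \<ge> 0" using assms lipschitz_on_nonneg by blast
  show "\<exists>\<delta>>0. \<forall>(m::nat) l r. (\<forall>i<m. a \<le> l i \<and> l i \<le> r i \<and> r i \<le> b) \<longrightarrow>
       disjoint_family_on (\<lambda>i. {l i<..<r i}) {..<m} \<longrightarrow>
       (\<Sum>i<m. r i - l i) < \<delta> \<longrightarrow> (\<Sum>i<m. norm (g (r i) - g (l i))) < e"
  proof (intro exI conjI allI impI)
    \<comment> \<open>\<open>L + 1\<close> instead of \<open>L\<close> avoids division by zero when
      \<open>L = 0\<close>.\<close>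
    show "e / (L + 1) > 0" using \<open>e > 0\<close> L by simp
    fix m :: nat and l r :: "nat \<Rightarrow> real"
    assume lr: "\<forall>i<m. a \<le> l i \<and> l i \<le> r i \<and> r i \<le> b" and s: "(\<Sum>i<m. r i - l i) < e / (L + 1)"
    have "(\<Sum>i<m. norm (g (r i) - g (l i))) \<le> (\<Sum>i<m. (L + 1) * (r i - l i))"
    proof (rule sum_mono)
      fix i assume "i \<in> {..<m}"
      then have i: "a \<le> l i" "l i \<le> r i" "r i \<le> b" using lr by auto
      then have "norm (g (r i) - g (l i)) \<le> L * (r i - l i)"
        using lipschitz_onD[OF assms, of "r i" "l i"] by (simp add: dist_norm)
      also have "\<dots> \<le> (L + 1) * (r i - l i)" using i by (simp add: algebra_simps)
      finally show "norm (g (r i) - g (l i)) \<le> (L + 1) * (r i - l i)" .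
    qed
    also have "\<dots> = (L + 1) * (\<Sum>i<m. r i - l i)" by (simp add: sum_distrib_left)
    also have "\<dots> < e" using s L by (simp add: field_simps)
    finally show "(\<Sum>i<m. norm (g (r i) - g (l i))) < e" .
  qed
qed

lemma fundamental_theorem_of_calculus_lipschitz:
  fixes g :: "real \<Rightarrow> 'a::banach"
  assumes "a \<le> b" "L-lipschitz_on {a..b} g" "negligible N"
    and "\<And>t. t \<in> {a..b} - N \<Longrightarrow> (g has_vector_derivative g' t) (at t within {a..b})"
  shows "(g' has_integral (g b - g a)) {a..b}"
  using assms lipschitz_on_imp_absolutely_continuous_fun fundamental_theorem_of_calculus_absolutely_continuous
  by blast

section \<open>Gronwall's inequality and integral equations\<close>

lemma gronwall:
  fixes \<phi> :: "real \<Rightarrow> real"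
  assumes cont: "continuous_on {a..b} \<phi>" and "L \<ge> 0"
    and le: "\<And>t. t \<in> {a..b} \<Longrightarrow> \<phi> t \<le> A + L * integral {a..t} \<phi>" and t: "t \<in> {a..b}"
  shows "\<phi> t \<le> A * exp (L * (t - a))"
proof -
  define \<Phi> where "\<Phi> = (\<lambda>t. integral {a..t} \<phi>)"
  \<comment> \<open>The right-hand side of the hypothesis times the integrating factor; the
    hypothesis makes its derivative nonpositive.\<close>
  define g where "g = (\<lambda>t. exp (- (L * (t - a))) * (A + L * \<Phi> t))"
  have d: "(\<Phi> has_real_derivative \<phi> s) (at s within {a..b})" if "s \<in> {a..b}" for s
    unfolding \<Phi>_def using integral_has_real_derivative[OF cont that] .
  have "g t \<le> g a"
  proof (cases "a < t")
    case True
    show ?thesis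
    proof (rule DERIV_nonpos_imp_decreasing_open[OF less_imp_le[OF True]])
      fix s assume s: "a < s" "s < t"
      then have "at s within {a..b} = at s" using t by (intro at_within_Icc_at) auto
      then have [derivative_intros]: "(\<Phi> has_real_derivative \<phi> s) (at s)" using d[of s] s t by auto
      have "(g has_real_derivative (exp (- (L * (s - a))) * (L * (\<phi> s - (A + L * \<Phi> s))))) (at s)"
        unfolding g_def by (auto intro!: derivative_eq_intros simp: algebra_simps)
      moreover have "exp (- (L * (s - a))) * (L * (\<phi> s - (A + L * \<Phi> s))) \<le> 0"
        using le[of s] s t \<open>L \<ge> 0\<close> unfolding \<Phi>_def by (intro mult_nonneg_nonpos) auto
      ultimately show "\<exists>y. (g has_real_derivative y) (at s) \<and> y \<le> 0" by blast
    next
      have "continuous_on {a..b} \<Phi>"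
        using d by (meson DERIV_continuous continuous_on_eq_continuous_within)
      then have "continuous_on {a..t} \<Phi>" using t by (auto elim: continuous_on_subset)
      then show "continuous_on {a..t} g"
        unfolding g_def by (intro continuous_intros)
    qed
  next
    case False
    then show ?thesis using t by simp
  qed
  then have "exp (- (L * (t - a))) * (A + L * \<Phi> t) \<le> A" by (simp add: g_def \<Phi>_def)
  then have "exp (L * (t - a)) * (exp (- (L * (t - a))) * (A + L * \<Phi> t)) \<le> exp (L * (t - a)) * A"
    by (rule mult_left_mono) simp
  moreover have "exp (L * (t - a)) * (exp (- (L * (t - a))) * (A + L * \<Phi> t)) = A + L * \<Phi> t"
    by (simp only: mult.assoc [symmetric] exp_minus_inverse mult_1_left)
  ultimately have "A + L * \<Phi> t \<le> A * exp (L * (t - a))"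
    by (simp only: mult.commute)
  then show ?thesis using le[OF t] by (simp add: \<Phi>_def)
qed

text \<open>Fixed point argument on the whole interval at once. Writing the unknown as
  \<open>exp (2 * M * s)\<close> times \<open>v s\<close> turns the supremum norm of
  \<open>v\<close> into an exponentially weighted norm, in which the integral operator contracts by
  \<open>1/2\<close> whatever the length of the interval.\<close>

lemma integral_equation_exists:
  fixes h :: "real \<Rightarrow> 'a::euclidean_space \<Rightarrow> 'a"
  assumes "a \<le> b" and lip: "\<And>s y z. s \<in> {a..b} \<Longrightarrow> norm (h s y - h s z) \<le> L * norm (y - z)"
    and int: "\<And>y. continuous_on {a..b} y \<Longrightarrow> (\<lambda>s. h s (y s)) integrable_on {a..b}"
  obtains y where "continuous_on {a..b} y" "\<And>t. t \<in> {a..b} \<Longrightarrow> y t = y0 + integral {a..t} (\<lambda>s. h s (y s))"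
proof -
  define M where "M = \<bar>L\<bar> + 1"
  have M: "M > 0" by (simp add: M_def)
  have lipM: "norm (h s y - h s z) \<le> M * norm (y - z)" if "s \<in> {a..b}" for s y z
    using lip[OF that, of y z] by (rule order_trans) (intro mult_right_mono, auto simp: M_def)
  define w where "w = (\<lambda>(v :: real \<Rightarrow>\<^sub>C 'a) s. exp (2 * M * s) *\<^sub>R v s)"
  have contw: "continuous_on S (w v)" for v :: "real \<Rightarrow>\<^sub>C 'a" and S unfolding w_def by (intro continuous_intros) auto
  define T where "T = (\<lambda>v t. exp (- (2 * M * t)) *\<^sub>R (y0 + integral {a..t} (\<lambda>s. h s (w v s))))"
  have contT: "continuous_on (cbox a b) (T v)" for v
    unfolding T_def box_real using int[OF contw] by (intro continuous_intros indefinite_integral_continuous_1)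
  \<comment> \<open>Bounded continuous functions live on the whole line, hence the constant
    extension by \<open>clamp\<close>.\<close>
  then have "\<exists>g :: real \<Rightarrow>\<^sub>C 'a. \<forall>t. (t \<in> {a..b} \<longrightarrow> g t = T v t) \<and> g t = T v (clamp a b t)" for v
    using continuous_on_cbox_bcontfunE[OF contT[of v]] by (metis box_real(2))
  then obtain G :: "(real \<Rightarrow>\<^sub>C 'a) \<Rightarrow> real \<Rightarrow>\<^sub>C 'a"
    where G: "\<And>v t. t \<in> {a..b} \<Longrightarrow> G v t = T v t" "\<And>v t. G v t = T v (clamp a b t)" by metis
  have cl: "clamp a b t \<in> {a..b}" for t using clamp_in_interval[of a b t] \<open>a \<le> b\<close> by simp
  have "\<exists>!v. G v = v"
  proof (rule banach_fix_type)
    show "0 \<le> (1/2 :: real)" "(1/2 :: real) < 1" by auto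
    show "\<forall>v v'. dist (G v) (G v') \<le> 1/2 * dist v v'"
    proof (intro allI dist_bound)
      fix v v' :: "real \<Rightarrow>\<^sub>C 'a" and t0 :: real
      define t where "t = clamp a b t0"
      have t: "t \<in> {a..b}" unfolding t_def by (rule cl)
      let ?d = "dist v v'"
      have i: "(\<lambda>s. h s (w v s)) integrable_on {a..t}" for v :: "real \<Rightarrow>\<^sub>C 'a"
        using int[OF contw] by (rule integrable_on_subinterval) (use t in auto)
      \<comment> \<open>A primitive of the weight is the weight divided by \<open>2 * M\<close>;
        against the Lipschitz constant \<open>M\<close> this leaves the factor
        \<open>1/2\<close>.\<close>
      have e: "((\<lambda>s. M * ?d * exp (2 * M * s)) has_integral (?d/2 * exp (2 * M * t) - ?d/2 * exp (2 * M * a))) {a..t}"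
        using t M by (intro fundamental_theorem_of_calculus)
          (auto intro!: derivative_eq_intros simp: has_real_derivative_iff_has_vector_derivative[symmetric])
      have "norm (integral {a..t} (\<lambda>s. h s (w v s) - h s (w v' s))) \<le> integral {a..t} (\<lambda>s. M * ?d * exp (2 * M * s))"
      proof (rule integral_norm_bound_integral)
        show "(\<lambda>s. h s (w v s) - h s (w v' s)) integrable_on {a..t}" using i by (intro integrable_diff)
        show "(\<lambda>s. M * ?d * exp (2 * M * s)) integrable_on {a..t}" using e by blast
        fix s assume "s \<in> {a..t}"
        then have s: "s \<in> {a..b}" using t by auto
        have "norm (h s (w v s) - h s (w v' s)) \<le> M * norm (w v s - w v' s)" by (rule lipM[OF s])
        also have "norm (w v s - w v' s) = exp (2 * M * s) * dist (v s) (v' s)"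
          by (simp add: w_def dist_norm flip: scaleR_diff_right)
        also have "M * \<dots> \<le> M * (exp (2 * M * s) * ?d)"
          using M by (intro mult_left_mono dist_bounded) auto
        finally show "norm (h s (w v s) - h s (w v' s)) \<le> M * ?d * exp (2 * M * s)" by (simp add: mult_ac)
      qed
      also have "\<dots> = ?d/2 * exp (2 * M * t) - ?d/2 * exp (2 * M * a)" using e by (rule integral_unique)
      also have "\<dots> \<le> ?d/2 * exp (2 * M * t)" by simp
      finally have *: "norm (integral {a..t} (\<lambda>s. h s (w v s)) - integral {a..t} (\<lambda>s. h s (w v' s))) \<le> ?d/2 * exp (2 * M * t)"
        using i by (simp add: Henstock_Kurzweil_Integration.integral_diff)
      have "dist (G v t0) (G v' t0) = dist (T v t) (T v' t)" by (simp add: G(2) t_def)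
      also have "\<dots> = exp (- (2 * M * t)) * norm (integral {a..t} (\<lambda>s. h s (w v s)) - integral {a..t} (\<lambda>s. h s (w v' s)))"
        by (simp add: T_def dist_norm flip: scaleR_diff_right)
      also have "\<dots> \<le> exp (- (2 * M * t)) * (?d/2 * exp (2 * M * t))" using * by (intro mult_left_mono) auto
      also have "\<dots> = 1/2 * ?d" by (simp add: exp_minus)
      finally show "dist (G v t0) (G v' t0) \<le> 1/2 * ?d" .
    qed
  qed
  then obtain v where v: "G v = v" by auto
  show thesis
  proof
    show "continuous_on {a..b} (w v)" by (rule contw)
    fix t assume "t \<in> {a..b}"
    then have "v t = T v t" using G(1) v by metis
    then have "w v t = exp (2 * M * t) *\<^sub>R T v t" by (simp add: w_def)
    also have "\<dots> = y0 + integral {a..t} (\<lambda>s. h s (w v s))" by (simp add: T_def exp_minus)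
    finally show "w v t = y0 + integral {a..t} (\<lambda>s. h s (w v s))" .
  qed
qed

text \<open>Reflection of time reduces the terminal value problem, which the adjoint equation poses,
  to the initial value problem.\<close>

lemma integral_equation_exists_backward:
  fixes h :: "real \<Rightarrow> 'a::euclidean_space \<Rightarrow> 'a"
  assumes "a \<le> b" and lip: "\<And>s y z. s \<in> {a..b} \<Longrightarrow> norm (h s y - h s z) \<le> L * norm (y - z)"
    and int: "\<And>y. continuous_on {a..b} y \<Longrightarrow> (\<lambda>s. h s (y s)) integrable_on {a..b}"
  obtains y where "continuous_on {a..b} y" "\<And>t. t \<in> {a..b} \<Longrightarrow> y t = y1 - integral {t..b} (\<lambda>s. h s (y s))"
proof -
  obtain z where z: "continuous_on {-b..-a} z"
     "\<And>t. t \<in> {-b..-a} \<Longrightarrow> z t = y1 + integral {-b..t} (\<lambda>s. - h (-s) (z s))"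
  proof (rule integral_equation_exists[of "-b" "-a" "\<lambda>s y. - h (-s) y" L y1])
    show "norm (- h (- s) y - - h (- s) z) \<le> L * norm (y - z)" if "s \<in> {- b..- a}" for s y z
      using lip[of "-s" z y] that by (simp add: norm_minus_commute)
    fix y assume y: "continuous_on {-b..-a} (y :: real \<Rightarrow> 'a)"
    have "continuous_on {a..b} (\<lambda>s. y (-s))"
      by (rule continuous_on_compose2[OF y]) (auto intro: continuous_intros)
    from int[OF this] have "(\<lambda>s. h (-s) (y (-(-s)))) integrable_on {-b..-a}"
      using Henstock_Kurzweil_Integration.integrable_reflect_real[where f = "\<lambda>s. h s (y (- s))" and a = a and b = b] by simp
    then show "(\<lambda>s. - h (- s) (y s)) integrable_on {- b..- a}" by (simp add: integrable_neg)
  qed (use \<open>a \<le> b\<close> in auto)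
  show thesis
  proof
    show "continuous_on {a..b} (\<lambda>t. z (-t))"
      by (rule continuous_on_compose2[OF z(1)]) (auto intro: continuous_intros)
    fix t assume "t \<in> {a..b}"
    then have "z (-t) = y1 + integral {-b..-t} (\<lambda>s. - h (-s) (z s))" using z(2) by auto
    also have "integral {-b..-t} (\<lambda>s. - h (-s) (z s)) = - integral {-b..-t} (\<lambda>s. h (-s) (z (-(-s))))" by simp
    also have "\<dots> = - integral {t..b} (\<lambda>s. h s (z (-s)))" 
      using Henstock_Kurzweil_Integration.integral_reflect_real[where f = "\<lambda>s. h s (z (- s))" and a = t and b = b] by simp
    finally show "z (-t) = y1 - integral {t..b} (\<lambda>s. h s (z (-s)))" by simp
  qed
qed

section \<open>A Fritz John theorem\<close>

lemma compact_PiE_UNIV: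
  fixes S :: "'i \<Rightarrow> 'a::topological_space set"
  assumes "\<And>i. compact (S i)"
  shows "compact (PiE UNIV S)"
  using assms compactin_PiE[of "\<lambda>_. euclidean" UNIV S] by (simp add: euclidean_product_topology)

text \<open>First-order condition: division by \<open>s\<close> and the limit from the right at
  \<open>0\<close> remove the quadratic term.\<close>

lemma nonneg_if_quadratic_nonneg:
  fixes A B :: real
  assumes "s0 > 0" and "\<And>s. 0 < s \<Longrightarrow> s < s0 \<Longrightarrow> 0 \<le> s * A + s\<^sup>2 * B"
  shows "A \<ge> 0"
proof -
  have "((\<lambda>s. A + s * B) \<longlongrightarrow> A + 0 * B) (at_right 0)" by (intro tendsto_intros)
  moreover have "eventually (\<lambda>s. 0 \<le> A + s * B) (at_right 0)"
    using eventually_at_right_less[of 0] eventually_at_right_real[OF \<open>s0 > 0\<close>]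
  proof eventually_elim
    case (elim s)
    then have "0 \<le> s * (A + s * B)" using assms(2)[of s] by (simp add: algebra_simps power2_eq_square)
    then show ?case using elim by (simp add: zero_le_mult_iff)
  qed
  ultimately show ?thesis using tendsto_lowerbound[of "\<lambda>s. A + s * B"] by fastforce
qed

text \<open>First-order expansion of the penalty of an inequality constraint:
  \<open>2 * max 0 r\<close> is the derivative of the squared positive part at \<open>r\<close>, and
  the remainder is at most the squared increment.\<close>

lemma max0_square_le:
  fixes r r' :: real
  shows "(max 0 r')\<^sup>2 \<le> (max 0 r)\<^sup>2 + 2 * max 0 r * (r' - r) + (r' - r)\<^sup>2"
proof -
  have "max 0 r' \<le> \<bar>max 0 r + (r' - r)\<bar>" by (simp add: max_def abs_if)
  then have "(max 0 r')\<^sup>2 \<le> (max 0 r + (r' - r))\<^sup>2" by (metis abs_le_square_iff abs_of_nonneg max.cobounded1)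
  then show ?thesis unfolding power2_sum by linarith
qed

section \<open>Finite-dimensional parameters and strict derivatives on a cone\<close>

type_synonym 'e param = "'e \<times> (nat \<Rightarrow> real)"

text \<open>Coordinates from \<open>N\<close> on are ignored, so this is a metric only within
  \<open>param_cone N\<close>, where they vanish.\<close>

definition param_dist :: "nat \<Rightarrow> 'e::euclidean_space param \<Rightarrow> 'e param \<Rightarrow> real" where
  "param_dist N p q = norm (fst p - fst q) + (\<Sum>i<N. \<bar>snd p i - snd q i\<bar>)"

definition param_cone :: "nat \<Rightarrow> 'e::euclidean_space param set" where
  "param_cone N = {p. (\<forall>i<N. 0 \<le> snd p i) \<and> (\<forall>i\<ge>N. snd p i = 0)}"

abbreviation param_zero :: "'e::euclidean_space param" where
  "param_zero \<equiv> (0, \<lambda>_. 0)"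

definition param_deriv :: "nat \<Rightarrow> 'e::euclidean_space \<Rightarrow> (nat \<Rightarrow> real) \<Rightarrow> 'e param \<Rightarrow> 'e param \<Rightarrow> real" where
  "param_deriv N D c p q = D \<bullet> (fst p - fst q) + (\<Sum>i<N. c i * (snd p i - snd q i))"

text \<open>Both points vary near zero, so one linear form controls the increments between any two
  nearby points. Only points of the cone occur, because negative speeds have no realization.\<close>

definition strict_param_deriv :: "nat \<Rightarrow> ('e::euclidean_space param \<Rightarrow> real) \<Rightarrow> 'e \<Rightarrow> (nat \<Rightarrow> real) \<Rightarrow> bool" where
  "strict_param_deriv N g D c \<longleftrightarrow> (\<forall>\<epsilon>>0. \<exists>\<delta>>0. \<forall>p\<in>param_cone N. \<forall>q\<in>param_cone N.
     param_dist N p param_zero < \<delta> \<longrightarrow> param_dist N q param_zero < \<delta> \<longrightarrow>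
     \<bar>g p - g q - param_deriv N D c p q\<bar> \<le> \<epsilon> * param_dist N p q)"

lemma param_dist_nonneg [simp]: "0 \<le> param_dist N p q"
  by (auto simp: param_dist_def intro!: sum_nonneg add_nonneg_nonneg)

lemma continuous_on_coordinate:
  fixes f :: "'a::topological_space \<Rightarrow> 'i \<Rightarrow> 'b::topological_space"
  shows "continuous_on S f \<Longrightarrow> continuous_on S (\<lambda>x. f x i)"
  by (rule continuous_on_product_then_coordinatewise)

lemma continuous_on_snd_coordinate [continuous_intros]:
  "continuous_on S f \<Longrightarrow> continuous_on S (\<lambda>x. snd (f x) i)"
  by (rule continuous_on_coordinate[OF continuous_on_snd])

lemma param_deriv_bound:
  "\<bar>param_deriv N D c p q\<bar> \<le> (norm D + (\<Sum>i<N. \<bar>c i\<bar>)) * param_dist N p q"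
proof -
  have "\<bar>\<Sum>i<N. c i * (snd p i - snd q i)\<bar> \<le> (\<Sum>i<N. \<bar>c i\<bar> * \<bar>snd p i - snd q i\<bar>)"
    by (rule order_trans[OF sum_abs]) (simp add: abs_mult)
  also have "\<dots> \<le> (\<Sum>i<N. \<bar>c i\<bar> * param_dist N p q)"
  proof (intro sum_mono mult_left_mono)
    fix i assume "i \<in> {..<N}"
    then have "\<bar>snd p i - snd q i\<bar> \<le> (\<Sum>i<N. \<bar>snd p i - snd q i\<bar>)"
      by (intro member_le_sum) auto
    then show "\<bar>snd p i - snd q i\<bar> \<le> param_dist N p q"
      unfolding param_dist_def using norm_ge_zero[of "fst p - fst q"] by linarith
  qed auto
  finally have 1: "\<bar>\<Sum>i<N. c i * (snd p i - snd q i)\<bar> \<le> (\<Sum>i<N. \<bar>c i\<bar>) * param_dist N p q"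
    by (simp add: sum_distrib_right)
  have "\<bar>D \<bullet> (fst p - fst q)\<bar> \<le> norm D * norm (fst p - fst q)" by (rule Cauchy_Schwarz_ineq2)
  also have "\<dots> \<le> norm D * param_dist N p q"
    by (intro mult_left_mono) (auto simp: param_dist_def intro!: sum_nonneg)
  finally show ?thesis using 1 unfolding param_deriv_def by (simp add: algebra_simps)
qed

lemma strict_param_deriv_lipschitz:
  assumes "strict_param_deriv N g D c"
  obtains \<delta> L where "\<delta> > 0" "L \<ge> 0" "\<And>p q. p \<in> param_cone N \<Longrightarrow> q \<in> param_cone N \<Longrightarrow>
    param_dist N p param_zero < \<delta> \<Longrightarrow> param_dist N q param_zero < \<delta> \<Longrightarrow> \<bar>g p - g q\<bar> \<le> L * param_dist N p q"
proof -
  obtain \<delta> where \<delta>: "\<delta> > 0" "\<And>p q. p \<in> param_cone N \<Longrightarrow> q \<in> param_cone N \<Longrightarrow>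
    param_dist N p param_zero < \<delta> \<Longrightarrow> param_dist N q param_zero < \<delta> \<Longrightarrow>
    \<bar>g p - g q - param_deriv N D c p q\<bar> \<le> 1 * param_dist N p q"
    using assms unfolding strict_param_deriv_def by (metis zero_less_one)
  show thesis
  proof (rule that[OF \<delta>(1)])
    show "0 \<le> norm D + (\<Sum>i<N. \<bar>c i\<bar>) + 1" by (auto intro!: add_nonneg_nonneg sum_nonneg)
    fix p q :: "'a param" assume "p \<in> param_cone N" "q \<in> param_cone N"
      "param_dist N p param_zero < \<delta>" "param_dist N q param_zero < \<delta>"
    from \<delta>(2)[OF this] param_deriv_bound[of N D c p q]
    show "\<bar>g p - g q\<bar> \<le> (norm D + (\<Sum>i<N. \<bar>c i\<bar>) + 1) * param_dist N p q"
      by (simp add: algebra_simps)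
  qed
qed

text \<open>Penalty method: the multipliers are limits of the normalized derivatives of the penalties at minimizers of
  \<open>G 0 p + \<bar>p\<bar>\<^sup>2 + n * pen p\<close>, which converge to \<open>0\<close>. Strict differentiability replaces continuous
  differentiability at these minimizers. The number of parameters \<open>\<rho> i\<close> varies, so they are functions on the naturals
  that vanish from \<open>N\<close> on.\<close>

lemma fritz_john:
  fixes G :: "nat \<Rightarrow> 'e::euclidean_space param \<Rightarrow> real" and D :: "nat \<Rightarrow> 'e" and c :: "nat \<Rightarrow> nat \<Rightarrow> real"
  assumes m: "1 \<le> m" "m \<le> M"
    and strict: "\<And>k. k < M \<Longrightarrow> strict_param_deriv N (G k) (D k) (c k)"
    and feas: "\<And>k. 1 \<le> k \<Longrightarrow> k < m \<Longrightarrow> G k param_zero \<le> 0" "\<And>k. m \<le> k \<Longrightarrow> k < M \<Longrightarrow> G k param_zero = 0"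
    and "\<delta>0 > 0"
    and optimal: "\<And>p. p \<in> param_cone N \<Longrightarrow> param_dist N p param_zero < \<delta>0 \<Longrightarrow>
       (\<And>k. 1 \<le> k \<Longrightarrow> k < m \<Longrightarrow> G k p \<le> 0) \<Longrightarrow> (\<And>k. m \<le> k \<Longrightarrow> k < M \<Longrightarrow> G k p = 0) \<Longrightarrow>
       G 0 param_zero \<le> G 0 p"
  obtains l :: "nat \<Rightarrow> real" where "\<And>k. k < m \<Longrightarrow> l k \<ge> 0" "(\<Sum>k<M. \<bar>l k\<bar>) = 1" "\<And>k. k \<ge> M \<Longrightarrow> l k = 0"
    "\<And>k. 1 \<le> k \<Longrightarrow> k < m \<Longrightarrow> l k * G k param_zero = 0"
    "(\<Sum>k<M. l k *\<^sub>R D k) = 0" "\<And>i. i < N \<Longrightarrow> (\<Sum>k<M. l k * c k i) \<ge> 0"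
proof -
  let ?O = "param_zero :: 'e param"
  have "\<forall>k. \<exists>\<delta> L. k < M \<longrightarrow> \<delta> > 0 \<and> L \<ge> 0 \<and> (\<forall>p q. p \<in> param_cone N \<longrightarrow> q \<in> param_cone N \<longrightarrow>
    param_dist N p ?O < \<delta> \<longrightarrow> param_dist N q ?O < \<delta> \<longrightarrow> \<bar>G k p - G k q\<bar> \<le> L * param_dist N p q)"
    using strict_param_deriv_lipschitz[OF strict] by metis
  then obtain \<delta> L where \<delta>L: "\<And>k. k < M \<Longrightarrow> \<delta> k > 0 \<and> L k \<ge> 0"
    "\<And>k p q. k < M \<Longrightarrow> p \<in> param_cone N \<Longrightarrow> q \<in> param_cone N \<Longrightarrow>
    param_dist N p ?O < \<delta> k \<Longrightarrow> param_dist N q ?O < \<delta> k \<Longrightarrow> \<bar>G k p - G k q\<bar> \<le> L k * param_dist N p q"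
    by metis
  define s1 where "s1 = Min (insert \<delta>0 (\<delta> ` {..<M}))"
  have s1: "s1 > 0" "s1 \<le> \<delta>0" "\<And>k. k < M \<Longrightarrow> s1 \<le> \<delta> k"
    using \<delta>L(1) \<open>\<delta>0 > 0\<close> by (auto simp: s1_def Min_le_iff)
  define LL where "LL = (\<Sum>k<M. L k)"
  have LL: "LL \<ge> 0" "\<And>k. k < M \<Longrightarrow> L k \<le> LL"
    using \<delta>L(1) unfolding LL_def by (auto intro!: sum_nonneg member_le_sum)
  \<comment> \<open>The first component and each of the \<open>N\<close> coordinates get at most
    \<open>r\<close>, so the box built next stays within \<open>(N + 1) * r < s1\<close> of
    zero.\<close>
  define r where "r = s1 / (real N + 2)"
  have r: "r > 0" "r + real N * r < s1"
  proof -
    show "r > 0" using s1 by (simp add: r_def)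
    moreover have "r * (real N + 2) = s1" by (simp add: r_def)
    ultimately show "r + real N * r < s1" by (simp add: algebra_simps)
  qed
  \<comment> \<open>Compact neighbourhood of zero relative to the cone. The coordinates from
    \<open>N\<close> on are confined to \<open>{0}\<close>, so the infinite product adds no
    freedom.\<close>
  define C where "C = cball (0::'e) r \<times> PiE UNIV (\<lambda>i. if i < N then {0..r} else {0::real})"
  have "compact C" unfolding C_def by (intro compact_Times compact_PiE_UNIV) auto
  have OC: "?O \<in> C" using r by (auto simp: C_def)
  have C_iff: "p \<in> C \<longleftrightarrow> norm (fst p) \<le> r \<and> p \<in> param_cone N \<and> (\<forall>i<N. snd p i \<le> r)" for p
  proof -
    have "(\<forall>i. snd p i \<in> (if i < N then {0..r} else {0})) \<longleftrightarrow>
        (\<forall>i. (i < N \<longrightarrow> 0 \<le> snd p i \<and> snd p i \<le> r) \<and> (i \<ge> N \<longrightarrow> snd p i = 0))"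
      by (intro all_cong1) auto
    then show ?thesis
      unfolding C_def param_cone_def mem_Times_iff PiE_UNIV_domain Pi_iff by auto
  qed
  have C_cone: "p \<in> param_cone N" "param_dist N p ?O < s1" if "p \<in> C" for p
  proof -
    show "p \<in> param_cone N" using that C_iff by blast
    have "(\<Sum>i<N. \<bar>snd p i\<bar>) \<le> (\<Sum>i<N. r)" using that by (intro sum_mono) (auto simp: C_iff param_cone_def)
    then show "param_dist N p ?O < s1" using that r by (simp add: C_iff param_dist_def)
  qed
  have lip: "\<bar>G k p - G k q\<bar> \<le> LL * param_dist N p q" if "k < M" "p \<in> C" "q \<in> C" for k p q
  proof -
    have "\<bar>G k p - G k q\<bar> \<le> L k * param_dist N p q"
      using C_cone that s1(3)[OF that(1)] by (intro \<delta>L(2)) (blast intro: less_le_trans)+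
    also have "\<dots> \<le> LL * param_dist N p q" using LL that by (intro mult_right_mono) auto
    finally show ?thesis .
  qed
  have contG: "continuous_on C (G k)" if "k < M" for k
    unfolding continuous_on_def
  proof
    fix q assume "q \<in> C"
    have "continuous_on UNIV (\<lambda>p. LL * param_dist N p q)"
      unfolding param_dist_def by (intro continuous_intros)
    then have "((\<lambda>p. LL * param_dist N p q) \<longlongrightarrow> LL * param_dist N q q) (at q within C)"
      unfolding continuous_on_def by (blast intro: Lim_at_imp_Lim_at_within)
    then have "((\<lambda>p. LL * param_dist N p q) \<longlongrightarrow> 0) (at q within C)" by (simp add: param_dist_def)
    then have "((\<lambda>p. G k p - G k q) \<longlongrightarrow> 0) (at q within C)"
    proof (rule Lim_null_comparison[rotated])
      show "\<forall>\<^sub>F p in at q within C. norm (G k p - G k q) \<le> LL * param_dist N p q"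
        using lip[OF that _ \<open>q \<in> C\<close>] by (auto simp: eventually_at_filter)
    qed
    then show "(G k \<longlongrightarrow> G k q) (at q within C)" by (simp add: LIM_zero_iff)
  qed
  \<comment> \<open>Zero need not be a strict minimum; the added square makes every limit of the
    penalized minimizers equal to it.\<close>
  define sq where "sq = (\<lambda>p::'e param. (norm (fst p))\<^sup>2 + (\<Sum>i<N. (snd p i)\<^sup>2))"
  define pen where "pen = (\<lambda>p. (\<Sum>k\<in>{1..<m}. (max 0 (G k p))\<^sup>2) + (\<Sum>k\<in>{m..<M}. (G k p)\<^sup>2))"
  define \<Phi> where "\<Phi> = (\<lambda>n p. G 0 p + sq p + real n * pen p)"
  have cont_sq: "continuous_on C sq" unfolding sq_def by (intro continuous_intros)
  have cont_pen: "continuous_on C pen" unfolding pen_def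
    using m by (intro continuous_intros contG) auto
  have pen_nonneg: "pen p \<ge> 0" for p unfolding pen_def by (intro add_nonneg_nonneg sum_nonneg) auto
  have sq_nonneg: "sq p \<ge> 0" for p unfolding sq_def by (intro add_nonneg_nonneg sum_nonneg) auto
  have pen_O: "pen ?O = 0"
  proof -
    have "(\<Sum>k\<in>{1..<m}. (max 0 (G k ?O))\<^sup>2) = 0" using feas(1) by (intro sum.neutral) auto
    moreover have "(\<Sum>k\<in>{m..<M}. (G k ?O)\<^sup>2) = 0" using feas(2) by (intro sum.neutral) auto
    ultimately show ?thesis by (simp add: pen_def)
  qed
  have "0 < M" using m by simp
  have "\<exists>p\<in>C. \<forall>q\<in>C. \<Phi> n p \<le> \<Phi> n q" for n
    unfolding \<Phi>_def using OC \<open>compact C\<close> contG[OF \<open>0 < M\<close>] cont_sq cont_pen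
    by (intro continuous_attains_inf continuous_intros) auto
  then obtain P where P: "\<And>n. P n \<in> C" "\<And>n q. q \<in> C \<Longrightarrow> \<Phi> n (P n) \<le> \<Phi> n q" by metis
  \<comment> \<open>Derivatives of cost and penalty with respect to the values \<open>G k\<close> at
    the minimizer. The cost has weight \<open>1\<close>, so the sum \<open>S n\<close> is at least
    \<open>1\<close> and can be divided by.\<close>
  define \<mu> where "\<mu> = (\<lambda>n k. if k = 0 then 1 else if k < m then 2 * real n * max 0 (G k (P n))
     else if k < M then 2 * real n * G k (P n) else 0)"
  define S where "S = (\<lambda>n. \<Sum>k<M. \<bar>\<mu> n k\<bar>)"
  have S1: "S n \<ge> 1" for n
  proof -
    have "\<bar>\<mu> n 0\<bar> \<le> S n" unfolding S_def using \<open>0 < M\<close> by (intro member_le_sum) auto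
    then show ?thesis by (simp add: \<mu>_def)
  qed
  define \<Lambda> where "\<Lambda> = (\<lambda>n k. \<mu> n k / S n)"
  have \<Lambda>_le: "\<Lambda> n \<in> PiE UNIV (\<lambda>_. {-1..1})" for n
  proof -
    have "\<bar>\<mu> n k\<bar> \<le> S n" for k
    proof (cases "k < M")
      case True then show ?thesis unfolding S_def by (intro member_le_sum) auto
    next
      case False then show ?thesis using S1[of n] m by (auto simp: \<mu>_def)
    qed
    then have "\<bar>\<Lambda> n k\<bar> \<le> 1" for k using S1[of n] by (simp add: \<Lambda>_def)
    then show ?thesis by (auto simp: abs_le_iff minus_le_iff)
  qed
  have "compact (C \<times> PiE UNIV (\<lambda>_::nat. {-1..1::real}))"
    by (intro compact_Times compact_PiE_UNIV \<open>compact C\<close>) auto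
  then have "seq_compact (C \<times> PiE UNIV (\<lambda>_::nat. {-1..1::real}))" by (simp add: compact_eq_seq_compact_metric)
  moreover have "\<forall>n. (P n, \<Lambda> n) \<in> C \<times> PiE UNIV (\<lambda>_. {-1..1})" using P \<Lambda>_le by auto
  ultimately obtain z f where z: "z \<in> C \<times> PiE UNIV (\<lambda>_. {-1..1})" and f: "strict_mono f"
    and lim: "((\<lambda>n. (P n, \<Lambda> n)) \<circ> f) \<longlonglongrightarrow> z" unfolding seq_compact_def by meson
  obtain p l where pl: "z = (p, l)" by (cases z)
  then have "p \<in> C" using z by auto
  have limP: "(\<lambda>n. P (f n)) \<longlonglongrightarrow> p" using tendsto_fst[OF lim] by (simp add: pl o_def)
  have limL: "(\<lambda>n. \<Lambda> (f n) k) \<longlonglongrightarrow> l k" for k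
    using tendsto_snd[OF lim] continuous_on_tendsto_compose[OF continuous_on_coordinate[OF continuous_on_id, of UNIV k]]
    by (simp add: pl o_def)
  have limC: "(\<lambda>n. g (P (f n))) \<longlonglongrightarrow> g p" if "continuous_on C g" for g :: "'e param \<Rightarrow> real"
    using continuous_on_tendsto_compose[OF that limP \<open>p \<in> C\<close>] P(1) by simp
  have \<Phi>O: "G 0 (P n) + sq (P n) + real n * pen (P n) \<le> G 0 ?O" for n
    using P(2)[OF OC, of n] by (simp add: \<Phi>_def pen_O) (simp add: sq_def)
  \<comment> \<open>The penalty at the minimizers is of order \<open>1 / n\<close>, so the limit
    \<open>p\<close> is feasible and costs at least as much as zero. Cost plus \<open>sq\<close> at
    the minimizers is at most the cost of zero, and so \<open>sq p = 0\<close>.\<close>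
  have "p = ?O"
  proof -
    obtain q where q: "q \<in> C" "\<And>p. p \<in> C \<Longrightarrow> G 0 q \<le> G 0 p"
      using continuous_attains_inf[OF \<open>compact C\<close> _ contG[OF \<open>0 < M\<close>]] OC by blast
    have pen_le: "pen (P (f n)) \<le> (G 0 ?O - G 0 q) * inverse (real n)" if "n > 0" for n
    proof -
      have "real n \<le> real (f n)" using seq_suble[OF f, of n] by simp
      then have "real n * pen (P (f n)) \<le> real (f n) * pen (P (f n))"
        by (rule mult_right_mono[OF _ pen_nonneg])
      also have "\<dots> \<le> G 0 ?O - G 0 q" using \<Phi>O[of "f n"] q(2)[OF P(1)[of "f n"]] sq_nonneg[of "P (f n)"] by linarith
      finally show ?thesis using that by (simp add: field_simps)
    qed
    have "(\<lambda>n. (G 0 ?O - G 0 q) * inverse (real n)) \<longlonglongrightarrow> 0"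
      by (rule tendsto_mult_right_zero[OF lim_inverse_n])
    then have "pen p \<le> 0"
    proof (rule LIMSEQ_le[OF limC[OF cont_pen]])
      show "\<exists>N. \<forall>n\<ge>N. pen (P (f n)) \<le> (G 0 ?O - G 0 q) * inverse (real n)"
        using pen_le by (meson less_le_trans zero_less_one)
    qed
    then have "pen p = 0" using pen_nonneg[of p] by simp
    then have "(\<Sum>k\<in>{1..<m}. (max 0 (G k p))\<^sup>2) = 0" "(\<Sum>k\<in>{m..<M}. (G k p)\<^sup>2) = 0"
      unfolding pen_def by (auto simp: add_nonneg_eq_0_iff sum_nonneg)
    then have "\<forall>k\<in>{1..<m}. max 0 (G k p) = 0" "\<forall>k\<in>{m..<M}. G k p = 0"
      by (auto simp: sum_nonneg_eq_0_iff)
    then have "\<And>k. 1 \<le> k \<Longrightarrow> k < m \<Longrightarrow> G k p \<le> 0" "\<And>k. m \<le> k \<Longrightarrow> k < M \<Longrightarrow> G k p = 0"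
      by (metis atLeastLessThan_iff max.absorb_iff1 max_def, metis atLeastLessThan_iff)
    moreover have "param_dist N p ?O < \<delta>0" using C_cone(2)[OF \<open>p \<in> C\<close>] s1(2) by linarith
    ultimately have 1: "G 0 ?O \<le> G 0 p" using C_cone(1)[OF \<open>p \<in> C\<close>] by (intro optimal)
    have "G 0 (P n) + sq (P n) \<le> G 0 ?O" for n
      using \<Phi>O[of n] mult_nonneg_nonneg[OF of_nat_0_le_iff pen_nonneg, of n "P n"] by linarith
    moreover have "(\<lambda>n. G 0 (P (f n)) + sq (P (f n))) \<longlonglongrightarrow> G 0 p + sq p"
      by (intro tendsto_add limC contG[OF \<open>0 < M\<close>] cont_sq)
    ultimately have "G 0 p + sq p \<le> G 0 ?O"
      by (intro LIMSEQ_le_const2) auto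
    then have "sq p \<le> 0" using 1 by simp
    then have "(norm (fst p))\<^sup>2 = 0" "(\<Sum>i<N. (snd p i)\<^sup>2) = 0"
      using sum_nonneg[of "{..<N}" "\<lambda>i. (snd p i)\<^sup>2"] zero_le_power2[of "norm (fst p)"]
      unfolding sq_def by (smt (verit) zero_le_power2)+
    then have "fst p = 0" "\<And>i. i < N \<Longrightarrow> snd p i = 0" by (auto simp: sum_nonneg_eq_0_iff)
    moreover have "snd p i = 0" if "i \<ge> N" for i using C_cone(1)[OF \<open>p \<in> C\<close>] that by (auto simp: param_cone_def)
    ultimately have "snd p i = 0" for i by (cases "i < N") auto
    then show "p = ?O" using \<open>fst p = 0\<close> by (intro prod_eqI) auto
  qed
  \<comment> \<open>A step from the minimizer \<open>P n\<close> in a direction of the cone does not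
    decrease the penalized cost. Division by the step length and by \<open>S n\<close>, then the
    limits in \<open>n\<close> and in \<open>\<epsilon>\<close>, leave a linear inequality at
    zero.\<close>
  have variational: "(\<Sum>k<M. l k * param_deriv N (D k) (c k) (e, w) ?O) \<ge> 0"
    if w: "(e, w) \<in> param_cone N" for e :: 'e and w
  proof -
    define A where "A = (\<lambda>k. param_deriv N (D k) (c k) (e, w) ?O)"
    define d where "d = param_dist N (e, w) ?O"
    \<comment> \<open>Linear part of \<open>sq\<close> at \<open>p\<close> in the direction
      \<open>(e, w)\<close>; it is zero at \<open>param_zero\<close> and so disappears in the
      limit.\<close>
    define b where "b = (\<lambda>p::'e param. 2 * (fst p \<bullet> e) + 2 * (\<Sum>i<N. snd p i * w i))"
    define mv where "mv = (\<lambda>(p::'e param) s. (fst p + s *\<^sub>R e, \<lambda>i. snd p i + s * w i))"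
    have d0: "d \<ge> 0" by (simp add: d_def)
    have w0: "\<And>i. i < N \<Longrightarrow> w i \<ge> 0" "\<And>i. i \<ge> N \<Longrightarrow> w i = 0" using w by (auto simp: param_cone_def)
    have mv_deriv: "param_deriv N (D k) (c k) (mv p s) p = s * A k" for k p s
      by (simp add: mv_def A_def param_deriv_def algebra_simps sum_distrib_left)
    have mv_dist: "param_dist N (mv p s) p = s * d" if "s \<ge> 0" for p s
      using that by (simp add: mv_def d_def param_dist_def algebra_simps sum_distrib_left abs_mult)
    have mv_sq: "sq (mv p s) = sq p + s * b p + s\<^sup>2 * sq (e, w)" for p s
      unfolding sq_def b_def mv_def power2_norm_eq_inner
      by (simp add: inner_add_left inner_add_right inner_commute power2_sum sum.distrib sum_distrib_left power_mult_distrib algebra_simps power2_eq_square)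
    have main: "0 \<le> (\<Sum>k<M. l k * A k) + \<epsilon> * d" if "\<epsilon> > 0" for \<epsilon>
    proof -
      have "\<forall>k. \<exists>\<eta>. k < M \<longrightarrow> \<eta> > 0 \<and> (\<forall>p\<in>param_cone N. \<forall>q\<in>param_cone N.
        param_dist N p ?O < \<eta> \<longrightarrow> param_dist N q ?O < \<eta> \<longrightarrow>
        \<bar>G k p - G k q - param_deriv N (D k) (c k) p q\<bar> \<le> \<epsilon> * param_dist N p q)"
        using strict \<open>\<epsilon> > 0\<close> unfolding strict_param_deriv_def by meson
      then obtain \<eta> where \<eta>: "\<And>k. k < M \<Longrightarrow> \<eta> k > 0" "\<And>k p q. k < M \<Longrightarrow> p \<in> param_cone N \<Longrightarrow> q \<in> param_cone N \<Longrightarrow>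
        param_dist N p ?O < \<eta> k \<Longrightarrow> param_dist N q ?O < \<eta> k \<Longrightarrow>
        \<bar>G k p - G k q - param_deriv N (D k) (c k) p q\<bar> \<le> \<epsilon> * param_dist N p q"
        by metis
      define \<eta>0 where "\<eta>0 = Min (insert r (\<eta> ` {..<M}))"
      have \<eta>0: "\<eta>0 > 0" "\<eta>0 \<le> r" "\<And>k. k < M \<Longrightarrow> \<eta>0 \<le> \<eta> k"
        using \<eta>(1) \<open>r > 0\<close> by (auto simp: \<eta>0_def Min_le_iff)
      have step: "0 \<le> (\<Sum>k<M. \<Lambda> n k * A k) + \<epsilon> * d + \<bar>b (P n)\<bar>" if near: "param_dist N (P n) ?O < \<eta>0" for n
      proof -
        define q where "q = P n"
        have q: "q \<in> C" "param_dist N q ?O < \<eta>0" using P near by (auto simp: q_def)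
        \<comment> \<open>Steps shorter than \<open>s0\<close> keep the point within
          \<open>\<eta>0\<close> of zero, hence in \<open>C\<close>, since
          \<open>\<eta>0 \<le> r\<close>.\<close>
        define s0 where "s0 = (\<eta>0 - param_dist N q ?O) / (d + 1)"
        have "s0 > 0" using q d0 by (simp add: s0_def)
        have "0 \<le> s * ((\<Sum>k<M. \<mu> n k * A k) + \<epsilon> * d * S n + b q) + s\<^sup>2 * (sq (e, w) + real n * (real M * (LL * d)\<^sup>2))"
          if s: "0 < s" "s < s0" for s
        proof -
          let ?q = "mv q s"
          have "s * (d + 1) < \<eta>0 - param_dist N q ?O" using s d0 by (simp add: s0_def pos_less_divide_eq)
          then have "s * d < \<eta>0 - param_dist N q ?O" using s by (simp add: algebra_simps)
          moreover have "param_dist N ?q ?O \<le> param_dist N q ?O + s * d"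
          proof -
            have "norm (fst q + s *\<^sub>R e) \<le> norm (fst q) + s * norm e"
              using norm_triangle_ineq[of "fst q" "s *\<^sub>R e"] s by simp
            moreover have "(\<Sum>i<N. \<bar>snd q i + s * w i\<bar>) \<le> (\<Sum>i<N. \<bar>snd q i\<bar> + s * \<bar>w i\<bar>)"
              using s by (intro sum_mono) (metis abs_mult abs_of_pos abs_triangle_ineq)
            ultimately show ?thesis
              by (simp add: param_dist_def mv_def d_def sum.distrib sum_distrib_left algebra_simps)
          qed
          ultimately have qd: "param_dist N ?q ?O < \<eta>0" by linarith
          have qc: "?q \<in> param_cone N" using C_cone(1)[OF q(1)] w0 s by (auto simp: param_cone_def mv_def)
          have "?q \<in> C"
          proof -
            have "norm (fst ?q) \<le> param_dist N ?q ?O" by (simp add: param_dist_def sum_nonneg)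
            moreover have "snd ?q i \<le> param_dist N ?q ?O" if "i < N" for i
            proof -
              have "\<bar>snd ?q i\<bar> \<le> (\<Sum>i<N. \<bar>snd ?q i\<bar>)" using that by (intro member_le_sum) auto
              then show ?thesis by (simp add: param_dist_def) (smt (verit) norm_ge_zero)
            qed
            ultimately show ?thesis using qd \<eta>0 qc unfolding C_iff by fastforce
          qed
          have G1: "\<bar>G k ?q - G k q - s * A k\<bar> \<le> \<epsilon> * (s * d)" if "k < M" for k
            using \<eta>(2)[OF that qc C_cone(1)[OF q(1)]] qd q(2) \<eta>0(3)[OF that] s mv_deriv[of k q s] mv_dist[of s q] by simp
          have G2: "(G k ?q - G k q)\<^sup>2 \<le> s\<^sup>2 * (LL * d)\<^sup>2" if "k < M" for k
          proof -
            have "\<bar>G k ?q - G k q\<bar> \<le> s * (LL * d)" using lip[OF that \<open>?q \<in> C\<close> q(1)] s by (simp add: mv_dist mult_ac)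
            then have "\<bar>G k ?q - G k q\<bar>\<^sup>2 \<le> (s * (LL * d))\<^sup>2" by (intro power_mono) auto
            then show ?thesis by (simp add: power_mult_distrib)
          qed
          have G3: "x * (G k ?q - G k q) \<le> s * (x * A k) + \<epsilon> * (s * d) * \<bar>x\<bar>" if "k < M" for k x
          proof -
            have "x * (G k ?q - G k q - s * A k) \<le> \<bar>x\<bar> * (\<epsilon> * (s * d))"
              using G1[OF that] by (metis abs_ge_self abs_mult mult_left_mono abs_ge_zero order_trans)
            then show ?thesis by (simp add: algebra_simps)
          qed
          \<comment> \<open>Bounds all squared increments of the constraint functions; being
            quadratic in \<open>s\<close>, it affects only the second-order term.\<close>
          define B where "B = s\<^sup>2 * (LL * d)\<^sup>2"
          have "B \<ge> 0" by (simp add: B_def)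
          define t where "t = (\<lambda>k. s * (\<mu> n k * A k) + \<epsilon> * (s * d) * \<bar>\<mu> n k\<bar>)"
          have t0: "G 0 ?q - G 0 q \<le> t 0"
            using G3[OF \<open>0 < M\<close>, of 1] by (simp add: t_def \<mu>_def)
          have t1: "real n * ((max 0 (G k ?q))\<^sup>2 - (max 0 (G k q))\<^sup>2) \<le> t k + real n * B" if "k \<in> {1..<m}" for k
          proof -
            have "(max 0 (G k ?q))\<^sup>2 - (max 0 (G k q))\<^sup>2 \<le> 2 * max 0 (G k q) * (G k ?q - G k q) + B"
              using max0_square_le[of "G k ?q" "G k q"] G2[of k] that m unfolding B_def by auto
            then have "real n * ((max 0 (G k ?q))\<^sup>2 - (max 0 (G k q))\<^sup>2) \<le> real n * (2 * max 0 (G k q) * (G k ?q - G k q) + B)"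
              by (intro mult_left_mono) auto
            also have "\<dots> = \<mu> n k * (G k ?q - G k q) + real n * B"
              using that by (simp add: \<mu>_def q_def algebra_simps)
            also have "\<dots> \<le> t k + real n * B" using G3[of k "\<mu> n k"] that m by (simp add: t_def)
            finally show ?thesis .
          qed
          have t2: "real n * ((G k ?q)\<^sup>2 - (G k q)\<^sup>2) \<le> t k + real n * B" if "k \<in> {m..<M}" for k
          proof -
            have "(G k ?q)\<^sup>2 - (G k q)\<^sup>2 = 2 * G k q * (G k ?q - G k q) + (G k ?q - G k q)\<^sup>2"
              by (simp add: power2_eq_square algebra_simps)
            also have "\<dots> \<le> 2 * G k q * (G k ?q - G k q) + B" using G2[of k] that unfolding B_def by auto
            finally have "real n * ((G k ?q)\<^sup>2 - (G k q)\<^sup>2) \<le> real n * (2 * G k q * (G k ?q - G k q) + B)"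
              by (intro mult_left_mono) auto
            also have "\<dots> = \<mu> n k * (G k ?q - G k q) + real n * B"
              using that m by (simp add: \<mu>_def q_def algebra_simps)
            also have "\<dots> \<le> t k + real n * B" using G3[of k "\<mu> n k"] that m by (simp add: t_def)
            finally show ?thesis .
          qed
          have split: "{..<M} = insert 0 ({1..<m} \<union> {m..<M})" using m by auto
          have sumt: "(\<Sum>k<M. h k) = h 0 + ((\<Sum>k\<in>{1..<m}. h k) + (\<Sum>k\<in>{m..<M}. h k))" for h :: "nat \<Rightarrow> real"
            unfolding split using m by (subst sum.insert) (auto simp: sum.union_disjoint)
          have "real n * (pen ?q - pen q) = (\<Sum>k\<in>{1..<m}. real n * ((max 0 (G k ?q))\<^sup>2 - (max 0 (G k q))\<^sup>2))
              + (\<Sum>k\<in>{m..<M}. real n * ((G k ?q)\<^sup>2 - (G k q)\<^sup>2))"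
            by (simp add: pen_def sum_subtractf sum_distrib_left right_diff_distrib distrib_left)
          also have "\<dots> \<le> (\<Sum>k\<in>{1..<m}. t k + real n * B) + (\<Sum>k\<in>{m..<M}. t k + real n * B)"
            using t1 t2 by (intro add_mono sum_mono) auto
          finally have 1: "G 0 ?q - G 0 q + real n * (pen ?q - pen q) \<le> (\<Sum>k<M. t k + real n * B)"
            using t0 \<open>B \<ge> 0\<close> sumt[of "\<lambda>k. t k + real n * B"] mult_nonneg_nonneg[of "real n" B] by linarith
          have "0 \<le> \<Phi> n ?q - \<Phi> n q" using P(2)[OF \<open>?q \<in> C\<close>, of n] by (simp add: q_def)
          also have "\<dots> = (G 0 ?q - G 0 q + real n * (pen ?q - pen q)) + (s * b q + s\<^sup>2 * sq (e, w))"
            by (simp add: \<Phi>_def mv_sq algebra_simps)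
          also have "\<dots> \<le> (\<Sum>k<M. t k + real n * B) + (s * b q + s\<^sup>2 * sq (e, w))" using 1 by simp
          also have "(\<Sum>k<M. t k + real n * B) = s * (\<Sum>k<M. \<mu> n k * A k) + \<epsilon> * (s * d) * S n + real n * real M * B"
            by (simp add: t_def sum.distrib sum_distrib_left S_def mult_ac)
          finally show ?thesis by (simp add: B_def algebra_simps)
        qed
        then have "0 \<le> (\<Sum>k<M. \<mu> n k * A k) + \<epsilon> * d * S n + b q"
          by (rule nonneg_if_quadratic_nonneg[OF \<open>s0 > 0\<close>])
        also have "\<dots> \<le> (\<Sum>k<M. \<mu> n k * A k) + \<epsilon> * d * S n + \<bar>b q\<bar> * S n"
          using S1[of n] mult_left_mono[of 1 "S n" "\<bar>b q\<bar>"] by simp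
        also have "\<dots> = S n * ((\<Sum>k<M. \<Lambda> n k * A k) + \<epsilon> * d + \<bar>b q\<bar>)"
          using S1[of n] by (simp add: \<Lambda>_def algebra_simps sum_distrib_left)
        finally show ?thesis using S1[of n] by (simp add: zero_le_mult_iff q_def)
      qed
      have "continuous_on C (\<lambda>p. param_dist N p ?O)" unfolding param_dist_def by (intro continuous_intros)
      from limC[OF this] have "(\<lambda>n. param_dist N (P (f n)) ?O) \<longlonglongrightarrow> 0" by (simp add: \<open>p = ?O\<close> param_dist_def)
      then have "eventually (\<lambda>n. param_dist N (P (f n)) ?O < \<eta>0) sequentially"
        using \<eta>0(1) by (rule order_tendstoD)
      then have ev: "eventually (\<lambda>n. 0 \<le> (\<Sum>k<M. \<Lambda> (f n) k * A k) + \<epsilon> * d + \<bar>b (P (f n))\<bar>) sequentially"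
        by eventually_elim (rule step)
      have "continuous_on C (\<lambda>p. \<bar>b p\<bar>)" unfolding b_def by (intro continuous_intros)
      from limC[OF this] have "(\<lambda>n. \<bar>b (P (f n))\<bar>) \<longlonglongrightarrow> 0" by (simp add: \<open>p = ?O\<close> b_def)
      then have "(\<lambda>n. (\<Sum>k<M. \<Lambda> (f n) k * A k) + \<epsilon> * d + \<bar>b (P (f n))\<bar>) \<longlonglongrightarrow> (\<Sum>k<M. l k * A k) + \<epsilon> * d + 0"
        by (intro tendsto_intros limL)
      then have "0 \<le> (\<Sum>k<M. l k * A k) + \<epsilon> * d + 0"
        by (rule tendsto_lowerbound[OF _ ev]) simp
      then show ?thesis by simp
    qed
    show "0 \<le> (\<Sum>k<M. l k * param_deriv N (D k) (c k) (e, w) ?O)"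
    proof (rule field_le_epsilon)
      fix \<epsilon> :: real assume "\<epsilon> > 0"
      then have "0 \<le> (\<Sum>k<M. l k * A k) + \<epsilon> / (d + 1) * d" using d0 by (intro main) simp
      moreover have "\<epsilon> / (d + 1) * d \<le> \<epsilon>" using d0 \<open>\<epsilon> > 0\<close> by (simp add: field_simps)
      ultimately show "0 \<le> (\<Sum>k<M. l k * param_deriv N (D k) (c k) (e, w) ?O) + \<epsilon>" by (simp add: A_def)
    qed
  qed
  show thesis
  proof
    show "l k \<ge> 0" if "k < m" for k
    proof (rule LIMSEQ_le_const[OF limL])
      show "\<exists>n0. \<forall>n\<ge>n0. 0 \<le> \<Lambda> (f n) k" using S1 that by (auto simp: \<Lambda>_def \<mu>_def intro!: divide_nonneg_nonneg order_trans[OF _ S1])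
    qed
    have "(\<lambda>n. \<Sum>k<M. \<bar>\<Lambda> (f n) k\<bar>) \<longlonglongrightarrow> (\<Sum>k<M. \<bar>l k\<bar>)" by (intro tendsto_intros limL)
    moreover have "(\<Sum>k<M. \<bar>\<Lambda> n k\<bar>) = 1" for n
    proof -
      have "(\<Sum>k<M. \<bar>\<Lambda> n k\<bar>) = (\<Sum>k<M. \<bar>\<mu> n k\<bar> / S n)" using S1[of n] by (simp add: \<Lambda>_def)
      also have "\<dots> = S n / S n" by (simp only: sum_divide_distrib[symmetric] S_def)
      finally show ?thesis using S1[of n] by simp
    qed
    ultimately show "(\<Sum>k<M. \<bar>l k\<bar>) = 1" by (simp add: LIMSEQ_const_iff)
    show "l k = 0" if "k \<ge> M" for k
      using limL[of k] that m by (simp add: \<Lambda>_def \<mu>_def LIMSEQ_const_iff)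
    \<comment> \<open>Complementary slackness: a constraint inactive at zero is inactive at late
      minimizers, where its penalty has derivative zero.\<close>
    show "l k * G k ?O = 0" if k: "1 \<le> k" "k < m" for k
    proof (cases "G k ?O = 0")
      case False
      then have "G k ?O < 0" using feas(1)[OF k] by simp
      moreover have "(\<lambda>n. G k (P (f n))) \<longlonglongrightarrow> G k ?O"
        using limC[OF contG] k m by (simp add: \<open>p = ?O\<close>)
      ultimately have "eventually (\<lambda>n. G k (P (f n)) < 0) sequentially" by (intro order_tendstoD)
      then have "eventually (\<lambda>n. \<Lambda> (f n) k = 0) sequentially"
        by eventually_elim (use k in \<open>simp add: \<Lambda>_def \<mu>_def\<close>)
      then have "(\<lambda>n. \<Lambda> (f n) k) \<longlonglongrightarrow> 0" by (rule tendsto_eventually)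
      then show ?thesis using limL[of k] LIMSEQ_unique by fastforce
    qed simp
    \<comment> \<open>The first component is free in sign: the test direction \<open>- ?V\<close>
      turns the inequality into an equality.\<close>
    show "(\<Sum>k<M. l k *\<^sub>R D k) = 0"
    proof -
      let ?V = "\<Sum>k<M. l k *\<^sub>R D k"
      have "0 \<le> (\<Sum>k<M. l k * param_deriv N (D k) (c k) (- ?V, \<lambda>_. 0) ?O)"
        by (rule variational) (simp add: param_cone_def)
      also have "\<dots> = - (?V \<bullet> ?V)"
        by (simp add: param_deriv_def inner_sum_left sum_negf)
      finally have "?V \<bullet> ?V \<le> 0" by simp
      then have "?V \<bullet> ?V = 0" using inner_ge_zero[of ?V] by (rule antisym)
      then show ?thesis by (rule inner_eq_zero_iff[THEN iffD1])
    qed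
    \<comment> \<open>Here the unit direction lies in the cone but its negative does not, so an
      inequality remains.\<close>
    show "(\<Sum>k<M. l k * c k i) \<ge> 0" if "i < N" for i
    proof -
      have "0 \<le> (\<Sum>k<M. l k * param_deriv N (D k) (c k) (0, \<lambda>j. of_bool (j = i)) ?O)"
        by (rule variational) (use that in \<open>auto simp: param_cone_def\<close>)
      then show ?thesis using that by (simp add: param_deriv_def)
    qed
  qed
qed

section \<open>Strict differentiability of the right-hand side\<close>

lemma lipschitz_on_closest_point_cball:
  assumes "r \<ge> 0"
  shows "norm (closest_point (cball (0::'a::euclidean_space) r) y - closest_point (cball 0 r) z) \<le> norm (y - z)"
  using closest_point_lipschitz[of "cball (0::'a) r" y z] assms by (simp add: dist_norm)

lemma has_integral_bound_ae:
  fixes f :: "real \<Rightarrow> 'a::euclidean_space"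
  assumes "(f has_integral i) {a..b}" "a \<le> b" "negligible N" "B \<ge> 0"
    and "\<And>t. t \<in> {a..b} - N \<Longrightarrow> norm (f t) \<le> B"
  shows "norm i \<le> B * (b - a)"
proof -
  have "((\<lambda>t. if t \<in> N then 0 else f t) has_integral i) {a..b}"
    using assms(1) by (rule has_integral_spike[OF assms(3), rotated]) auto
  from has_integral_bound_real[OF assms(4) _ this, of "{}"] assms show ?thesis by auto
qed

lemma lipschitz_increment_bound_ae:
  fixes g :: "real \<Rightarrow> 'a::euclidean_space"
  assumes "a \<le> b" "L-lipschitz_on {a..b} g" "negligible N" "B \<ge> 0"
    and "\<And>t. t \<in> {a..b} - N \<Longrightarrow> (g has_vector_derivative g' t) (at t within {a..b})"
    and "\<And>t. t \<in> {a..b} - N \<Longrightarrow> norm (g' t) \<le> B"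
  shows "norm (g b - g a) \<le> B * (b - a)"
  using has_integral_bound_ae[OF fundamental_theorem_of_calculus_lipschitz[OF assms(1,2,3,5)]] assms by blast

lemma lipschitz_on_inner:
  fixes f g :: "real \<Rightarrow> 'a::euclidean_space"
  assumes f: "L-lipschitz_on {a..b} f" and g: "M-lipschitz_on {a..b} g"
  obtains K where "K-lipschitz_on {a..b} (\<lambda>t. f t \<bullet> g t)"
proof -
  have "bounded (f ` {a..b})" "bounded (g ` {a..b})"
    using f g by (auto intro!: compact_imp_bounded compact_continuous_image lipschitz_on_continuous_on)
  then obtain A B where AB: "\<And>t. t \<in> {a..b} \<Longrightarrow> norm (f t) \<le> A" "\<And>t. t \<in> {a..b} \<Longrightarrow> norm (g t) \<le> B"
    by (meson bounded_iff imageI)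
  have LM: "L \<ge> 0" "M \<ge> 0" using f g lipschitz_on_nonneg by auto
  have "(\<bar>A\<bar> * M + \<bar>B\<bar> * L)-lipschitz_on {a..b} (\<lambda>t. f t \<bullet> g t)"
  proof (rule lipschitz_onI)
    show "0 \<le> \<bar>A\<bar> * M + \<bar>B\<bar> * L" using LM by simp
    fix s t assume st: "s \<in> {a..b}" "t \<in> {a..b}"
    have "f s \<bullet> g s - f t \<bullet> g t = f s \<bullet> (g s - g t) + (f s - f t) \<bullet> g t"
      by (simp add: inner_diff_left inner_diff_right)
    also have "\<bar>\<dots>\<bar> \<le> norm (f s) * norm (g s - g t) + norm (f s - f t) * norm (g t)"
      by (intro order_trans[OF abs_triangle_ineq] add_mono Cauchy_Schwarz_ineq2)
    also have "\<dots> \<le> \<bar>A\<bar> * (M * dist s t) + (L * dist s t) * \<bar>B\<bar>"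
      using AB[OF st(1)] AB[OF st(2)] lipschitz_onD[OF f st] lipschitz_onD[OF g st] LM
      by (intro add_mono mult_mono) (auto simp: dist_norm)
    finally show "dist (f s \<bullet> g s) (f t \<bullet> g t) \<le> (\<bar>A\<bar> * M + \<bar>B\<bar> * L) * dist s t"
      by (simp add: dist_real_def algebra_simps)
  qed
  then show thesis by (rule that)
qed

lemma bounded_borel_integrable_on:
  fixes g :: "real \<Rightarrow> 'a::euclidean_space"
  assumes "g \<in> borel_measurable borel" and "\<And>t. t \<in> {a..b} \<Longrightarrow> norm (g t) \<le> B"
  shows "g integrable_on {a..b}"
proof (rule measurable_bounded_by_integrable_imp_integrable[where g = "\<lambda>_. B"])
  have "g \<in> borel_measurable lebesgue" using assms(1) by (simp add: measurable_completion)
  then show "g \<in> borel_measurable (lebesgue_on {a..b})" by (rule measurable_restrict_space1)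
qed (use assms in auto)

lemma lipschitz_on_integral:
  fixes g :: "real \<Rightarrow> 'a::euclidean_space"
  assumes int: "g integrable_on {a..b}" and B: "\<And>t. t \<in> {a..b} \<Longrightarrow> norm (g t) \<le> B" and "B \<ge> 0"
  shows "B-lipschitz_on {a..b} (\<lambda>t. y0 + integral {a..t} g)"
proof -
  have *: "dist (y0 + integral {a..s} g) (y0 + integral {a..t} g) \<le> B * dist s t"
    if st: "a \<le> s" "s \<le> t" "t \<le> b" for s t
  proof -
    have "integral {a..s} g + integral {s..t} g = integral {a..t} g"
      using st by (intro Henstock_Kurzweil_Integration.integral_combine integrable_on_subinterval[OF int]) auto
    then have "dist (y0 + integral {a..s} g) (y0 + integral {a..t} g) = norm (integral {s..t} g)"
      by (simp add: dist_norm norm_minus_commute flip: \<open>integral {a..s} g + _ = _\<close>)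
    also have "\<dots> \<le> B * (t - s)"
    proof (rule has_integral_bound_ae[of g _ s t "{}"])
      show "(g has_integral integral {s..t} g) {s..t}"
        using st by (intro integrable_integral integrable_on_subinterval[OF int]) auto
    qed (use st B \<open>B \<ge> 0\<close> in auto)
    finally show ?thesis using st by (simp add: dist_real_def)
  qed
  show ?thesis
  proof (rule lipschitz_onI)
    fix s t assume "s \<in> {a..b}" "t \<in> {a..b}"
    then show "dist (y0 + integral {a..s} g) (y0 + integral {a..t} g) \<le> B * dist s t"
      using *[of s t] *[of t s] by (cases "s \<le> t") (auto simp: dist_commute)
  qed fact
qed

text \<open>Passage from integral equations to derivatives almost everywhere. It serves the
  reference state, the adjoint functions and the varied solutions, whose right-hand sides are all
  bounded.\<close>

lemma integral_equation_regular:
  fixes g :: "real \<Rightarrow> 'a::euclidean_space"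
  assumes int: "g integrable_on {a..b}" and B: "\<And>t. t \<in> {a..b} \<Longrightarrow> norm (g t) \<le> B" "B \<ge> 0"
    and y: "\<And>t. t \<in> {a..b} \<Longrightarrow> y t = y0 + integral {a..t} g"
  shows "B-lipschitz_on {a..b} y"
    "\<exists>E. negligible E \<and> (\<forall>t\<in>{a..b} - E. (y has_vector_derivative g t) (at t within {a..b}))"
proof -
  show "B-lipschitz_on {a..b} y"
    by (rule lipschitz_on_transform[OF lipschitz_on_integral[OF int B, of y0]]) (auto intro: y)
  obtain E where E: "negligible E" "\<And>t. t \<in> {a..b} - E \<Longrightarrow>
      ((\<lambda>s. integral {a..s} g) has_vector_derivative g t) (at t within {a..b})"
    using has_vector_derivative_indefinite_integral[OF int] by blast
  have "(y has_vector_derivative g t) (at t within {a..b})" if t: "t \<in> {a..b} - E" for t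
  proof (rule has_vector_derivative_transform[where f = "\<lambda>t. y0 + integral {a..t} g"])
    show "((\<lambda>t. y0 + integral {a..t} g) has_vector_derivative g t) (at t within {a..b})"
      using has_vector_derivative_add[OF has_vector_derivative_const E(2)[OF t]] by simp
  qed (use t y in blast)+
  then show "\<exists>E. negligible E \<and> (\<forall>t\<in>{a..b} - E. (y has_vector_derivative g t) (at t within {a..b}))"
    using E(1) by blast
qed

text \<open>Mean value inequality for \<open>g\<close> minus its linearization at \<open>z0\<close>,
  on a ball where \<open>g'\<close> is within \<open>\<epsilon>\<close> of its value at
  \<open>z0\<close>.\<close>

lemma C1_strictly_differentiable:
  fixes g :: "'a::real_normed_vector \<Rightarrow> 'b::real_normed_vector" and g' :: "'a \<Rightarrow> 'a \<Rightarrow>\<^sub>L 'b"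
  assumes deriv: "\<And>z. (g has_derivative blinfun_apply (g' z)) (at z)" and cont: "continuous_on UNIV g'" and "\<epsilon> > 0"
  obtains \<delta> where "\<delta> > 0" "\<And>y z. norm (y - z0) < \<delta> \<Longrightarrow> norm (z - z0) < \<delta> \<Longrightarrow>
    norm (g y - g z - g' z0 (y - z)) \<le> \<epsilon> * norm (y - z)"
proof -
  have "isCont g' z0" using cont by (simp add: continuous_on_eq_continuous_at)
  then obtain \<delta> where \<delta>: "\<delta> > 0" "\<And>z. dist z z0 < \<delta> \<Longrightarrow> dist (g' z) (g' z0) < \<epsilon>"
    using \<open>\<epsilon> > 0\<close> unfolding continuous_at_eps_delta by metis
  show thesis
  proof (rule that[OF \<delta>(1)])
    fix y z assume "norm (y - z0) < \<delta>" "norm (z - z0) < \<delta>"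
    then have yz: "y \<in> ball z0 \<delta>" "z \<in> ball z0 \<delta>" by (auto simp: dist_norm norm_minus_commute)
    have "norm (g y - g z - blinfun_apply (g' z0) (y - z)) \<le> norm (y - z) * \<epsilon>"
    proof (rule differentiable_bound_linearization[where S = "ball z0 \<delta>" and f' = "\<lambda>z. blinfun_apply (g' z)"])
      show "z + t *\<^sub>R (y - z) \<in> ball z0 \<delta>" if "t \<in> {0..1}" for t
        using convexD_alt[OF convex_ball yz(2,1), of t] that by (simp add: algebra_simps)
      show "(g has_derivative blinfun_apply (g' w)) (at w within ball z0 \<delta>)" for w
        using deriv has_derivative_at_withinI by blast
      show "onorm (blinfun_apply (g' w) - blinfun_apply (g' z0)) \<le> \<epsilon>" if "w \<in> ball z0 \<delta>" for w
        using \<delta>(2)[of w] that by (simp add: dist_norm norm_blinfun.rep_eq norm_minus_commute fun_diff_def minus_blinfun.rep_eq)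
    qed (use \<delta>(1) in auto)
    then show "norm (g y - g z - g' z0 (y - z)) \<le> \<epsilon> * norm (y - z)" by (simp add: mult.commute)
  qed
qed

section \<open>Uniform estimates for the right-hand side on compact boxes\<close>

locale control_system =
  fixes f :: "real \<Rightarrow> 'a::euclidean_space \<Rightarrow> 'b::euclidean_space \<Rightarrow> 'a"
    and ft :: "real \<times> 'a \<times> 'b \<Rightarrow> 'a"
    and fx :: "real \<times> 'a \<times> 'b \<Rightarrow> 'a \<Rightarrow>\<^sub>L 'a"
  assumes cont_f: "continuous_on UNIV (\<lambda>(t, x, u). f t x u)"
    and cont_ft: "continuous_on UNIV ft"
    and cont_fx: "continuous_on UNIV fx"
    and deriv_t: "\<And>t x u. ((\<lambda>s. f s x u) has_vector_derivative ft (t, x, u)) (at t)"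
    and deriv_x: "\<And>t x u. ((\<lambda>y. f t y u) has_derivative blinfun_apply (fx (t, x, u))) (at x)"
begin

definition box3 :: "real \<Rightarrow> real \<Rightarrow> real \<Rightarrow> real \<Rightarrow> (real \<times> 'a \<times> 'b) set" where
  "box3 a b R B = {a..b} \<times> cball 0 R \<times> cball 0 B"

lemma compact_box3: "compact (box3 a b R B)"
  unfolding box3_def by (intro compact_Times) auto

lemma box3_bound:
  obtains M where "M > 0" "\<And>t x u. (t, x, u) \<in> box3 a b R B \<Longrightarrow> norm (f t x u) \<le> M"
    "\<And>z. z \<in> box3 a b R B \<Longrightarrow> norm (ft z) \<le> M" "\<And>z. z \<in> box3 a b R B \<Longrightarrow> norm (fx z) \<le> M"
proof -
  have "bounded ((\<lambda>(t, x, u). f t x u) ` box3 a b R B)" "bounded (ft ` box3 a b R B)" "bounded (fx ` box3 a b R B)"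
    using compact_box3 cont_f cont_ft cont_fx
    by (meson compact_imp_bounded compact_continuous_image continuous_on_subset subset_UNIV)+
  then obtain A1 A2 A3 where A: "\<And>z. z \<in> box3 a b R B \<Longrightarrow> norm ((\<lambda>(t, x, u). f t x u) z) \<le> A1"
    "\<And>z. z \<in> box3 a b R B \<Longrightarrow> norm (ft z) \<le> A2" "\<And>z. z \<in> box3 a b R B \<Longrightarrow> norm (fx z) \<le> A3"
    unfolding bounded_iff by (metis imageI)
  show thesis
    by (rule that[of "1 + \<bar>A1\<bar> + \<bar>A2\<bar> + \<bar>A3\<bar>"]) (use A in fastforce)+
qed

lemma f_lipschitz_x:
  assumes "\<And>z. z \<in> box3 a b R B \<Longrightarrow> norm (fx z) \<le> M" "(t, x, u) \<in> box3 a b R B" "(t, y, u) \<in> box3 a b R B"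
  shows "norm (f t x u - f t y u) \<le> M * norm (x - y)"
proof (rule differentiable_bound[of "cball 0 R"])
  show "((\<lambda>y. f t y u) has_derivative blinfun_apply (fx (t, z, u))) (at z within cball 0 R)" for z
    using deriv_x has_derivative_at_withinI by blast
  show "onorm (blinfun_apply (fx (t, z, u))) \<le> M" if "z \<in> cball 0 R" for z
    using assms that by (auto simp: box3_def norm_blinfun.rep_eq)
qed (use assms in \<open>auto simp: box3_def\<close>)

lemma f_lipschitz_t:
  assumes "\<And>z. z \<in> box3 a b R B \<Longrightarrow> norm (ft z) \<le> M" "(s, x, u) \<in> box3 a b R B" "(t, x, u) \<in> box3 a b R B"
  shows "norm (f s x u - f t x u) \<le> M * \<bar>s - t\<bar>"
  unfolding real_norm_def[symmetric]
proof (rule differentiable_bound[of "{a..b}"])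
  show "((\<lambda>t. f t x u) has_derivative (\<lambda>h. h *\<^sub>R ft (z, x, u))) (at z within {a..b})" for z
    using deriv_t has_vector_derivative_at_within unfolding has_vector_derivative_def by blast
  show "onorm (\<lambda>h. h *\<^sub>R ft (z, x, u)) \<le> M" if "z \<in> {a..b}" for z
    using assms that by (auto simp: box3_def onorm_scaleR_left onorm_id)
qed (use assms in \<open>auto simp: box3_def\<close>)

text \<open>The control value is the same at all three points, as no derivative of \<open>f\<close>
  in it is available. Uniform continuity of \<open>fx\<close> and \<open>ft\<close> on the compact
  box makes \<open>\<delta>\<close> independent of the base point and of \<open>u\<close>; the
  increment is split into a step in the state and a step in time.\<close>

lemma f_strictly_differentiable:
  assumes "\<epsilon> > 0"
  obtains \<delta> where "\<delta> > 0"
    "\<And>s t r x y z u. (s, x, u) \<in> box3 a b R B \<Longrightarrow> (t, y, u) \<in> box3 a b R B \<Longrightarrow> (r, z, u) \<in> box3 a b R B \<Longrightarrow>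
      \<bar>s - r\<bar> < \<delta> \<Longrightarrow> \<bar>t - r\<bar> < \<delta> \<Longrightarrow> norm (x - z) < \<delta> \<Longrightarrow> norm (y - z) < \<delta> \<Longrightarrow>
      norm (f s x u - f t y u - (fx (r, z, u) (x - y) + (s - t) *\<^sub>R ft (r, z, u))) \<le> \<epsilon> * (norm (x - y) + \<bar>s - t\<bar>)"
proof -
  have "uniformly_continuous_on (box3 a b R B) fx" "uniformly_continuous_on (box3 a b R B) ft"
    using compact_box3 cont_fx cont_ft by (meson compact_uniformly_continuous continuous_on_subset subset_UNIV)+
  then obtain d1 d2 where d: "d1 > 0" "\<And>w w'. w \<in> box3 a b R B \<Longrightarrow> w' \<in> box3 a b R B \<Longrightarrow> dist w' w < d1 \<Longrightarrow> dist (fx w') (fx w) < \<epsilon>"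
     "d2 > 0" "\<And>w w'. w \<in> box3 a b R B \<Longrightarrow> w' \<in> box3 a b R B \<Longrightarrow> dist w' w < d2 \<Longrightarrow> dist (ft w') (ft w) < \<epsilon>"
    using \<open>\<epsilon> > 0\<close> unfolding uniformly_continuous_on_def by metis
  \<comment> \<open>Half, because the distance of triples is bounded by the sum of the distances in
    time and state.\<close>
  define \<delta> where "\<delta> = min d1 d2 / 2"
  have dist3: "dist (s, x, u) (r, z, u) < min d1 d2" if "\<bar>s - r\<bar> < \<delta>" "norm (x - z) < \<delta>" for s r :: real and x z :: 'a and u :: 'b
  proof -
    have "dist (s, x, u) (r, z, u) \<le> \<bar>s - r\<bar> + norm (x - z)"
      using sqrt_sum_squares_le_sum_abs[of "s - r" "norm (x - z)"]
      by (simp add: dist_prod_def dist_real_def dist_norm)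
    then show ?thesis using that by (simp add: \<delta>_def)
  qed
  show thesis
  proof (rule that)
    show "\<delta> > 0" using d by (simp add: \<delta>_def)
    fix s t r x y z u
    assume b: "(s, x, u) \<in> box3 a b R B" "(t, y, u) \<in> box3 a b R B" "(r, z, u) \<in> box3 a b R B"
      and near: "\<bar>s - r\<bar> < \<delta>" "\<bar>t - r\<bar> < \<delta>" "norm (x - z) < \<delta>" "norm (y - z) < \<delta>"
    \<comment> \<open>The intersection of two balls is convex, so the mean value inequality applies
      without leaving the box.\<close>
    let ?S = "cball 0 R \<inter> ball z \<delta>"
    have xy: "x \<in> ?S" "y \<in> ?S" "z \<in> ?S" using b near \<open>\<delta> > 0\<close> by (auto simp: box3_def dist_norm norm_minus_commute)
    have conv: "convex ?S" by (intro convex_Int convex_cball convex_ball)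
    have "norm (f s x u - f s y u - fx (r, z, u) (x - y)) \<le> norm (x - y) * \<epsilon>"
    proof -
      have "norm ((f s x u - fx (r, z, u) x) - (f s y u - fx (r, z, u) y)) \<le> \<epsilon> * norm (x - y)"
      proof (rule differentiable_bound[OF conv])
        show "((\<lambda>y. f s y u - fx (r, z, u) y) has_derivative (\<lambda>h. fx (s, w, u) h - fx (r, z, u) h)) (at w within ?S)" for w
          by (intro derivative_intros has_derivative_at_withinI[OF deriv_x]
              bounded_linear_imp_has_derivative blinfun.bounded_linear_right)
        show "onorm (\<lambda>h. fx (s, w, u) h - fx (r, z, u) h) \<le> \<epsilon>" if "w \<in> ?S" for w
        proof -
          have "(s, w, u) \<in> box3 a b R B" using that b by (auto simp: box3_def)
          moreover have "dist (s, w, u) (r, z, u) < d1"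
            using dist3[of s r w z u] near that by (auto simp: dist_norm norm_minus_commute)
          ultimately have "dist (fx (s, w, u)) (fx (r, z, u)) < \<epsilon>" using d(2) b(3) by blast
          then show ?thesis by (simp add: dist_norm norm_blinfun.rep_eq minus_blinfun.rep_eq)
        qed
      qed (use xy in auto)
      then show ?thesis by (simp add: blinfun.diff_right algebra_simps)
    qed
    moreover have "norm (f s y u - f t y u - (s - t) *\<^sub>R ft (r, z, u)) \<le> \<epsilon> * \<bar>s - t\<bar>"
    proof -
      let ?T = "{a..b} \<inter> ball r \<delta>"
      have convT: "convex ?T" by (intro convex_Int convex_ball) auto
      have "norm ((f s y u - s *\<^sub>R ft (r, z, u)) - (f t y u - t *\<^sub>R ft (r, z, u))) \<le> \<epsilon> * norm (s - t)"
      proof (rule differentiable_bound[OF convT])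
        show "((\<lambda>t. f t y u - t *\<^sub>R ft (r, z, u)) has_derivative (\<lambda>h. h *\<^sub>R (ft (w, y, u) - ft (r, z, u)))) (at w within ?T)" for w
        proof -
          have "((\<lambda>t. f t y u) has_derivative (\<lambda>h. h *\<^sub>R ft (w, y, u))) (at w within ?T)"
            using deriv_t has_vector_derivative_at_within unfolding has_vector_derivative_def by blast
          then show ?thesis unfolding scaleR_diff_right by (intro derivative_intros)
        qed
        show "onorm (\<lambda>h. h *\<^sub>R (ft (w, y, u) - ft (r, z, u))) \<le> \<epsilon>" if "w \<in> ?T" for w
        proof -
          have "(w, y, u) \<in> box3 a b R B" using that b by (auto simp: box3_def)
          moreover have "dist (w, y, u) (r, z, u) < d2"
            using dist3[of w r y z u] near that by (auto simp: dist_real_def abs_minus_commute)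
          ultimately have "dist (ft (w, y, u)) (ft (r, z, u)) < \<epsilon>" using d(4) b(3) by blast
          then show ?thesis by (simp add: dist_norm onorm_scaleR_left onorm_id)
        qed
      qed (use b near in \<open>auto simp: box3_def dist_real_def abs_minus_commute\<close>)
      then show ?thesis by (simp add: algebra_simps)
    qed
    moreover have "f s x u - f t y u - (fx (r, z, u) (x - y) + (s - t) *\<^sub>R ft (r, z, u))
      = (f s x u - f s y u - fx (r, z, u) (x - y)) + (f s y u - f t y u - (s - t) *\<^sub>R ft (r, z, u))"
      by simp
    ultimately show "norm (f s x u - f t y u - (fx (r, z, u) (x - y) + (s - t) *\<^sub>R ft (r, z, u))) \<le> \<epsilon> * (norm (x - y) + \<bar>s - t\<bar>)"
      by (smt (verit) norm_triangle_ineq mult.commute distrib_left)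
  qed
qed

end

section \<open>Changes of time\<close>

text \<open>The primitive of \<open>pulse c\<close> that vanishes up to \<open>c\<close>: the
  progress made through an inserted interval.\<close>

definition ramp :: "real \<Rightarrow> real \<Rightarrow> real" where
  "ramp c \<tau> = max 0 (min 1 (\<tau> - c))"

definition pulse :: "real \<Rightarrow> real \<Rightarrow> real" where
  "pulse c \<tau> = of_bool (c < \<tau> \<and> \<tau> < c + 1)"

lemma ramp_bounds: "0 \<le> ramp c \<tau>" "ramp c \<tau> \<le> 1"
  by (auto simp: ramp_def)

lemma ramp_mono: "s \<le> t \<Longrightarrow> ramp c s \<le> ramp c t"
  by (auto simp: ramp_def)

lemma ramp_lipschitz: "\<bar>ramp c s - ramp c t\<bar> \<le> \<bar>s - t\<bar>"
  unfolding ramp_def by linarith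

lemma pulse_measurable [measurable]: "pulse c \<in> borel_measurable borel"
  unfolding pulse_def[abs_def] by measurable

lemma ramp_has_derivative:
  assumes "\<tau> \<noteq> c" "\<tau> \<noteq> c + 1"
  shows "(ramp c has_vector_derivative pulse c \<tau>) (at \<tau> within S)"
proof -
  consider "\<tau> < c" | "c < \<tau>" "\<tau> < c + 1" | "c + 1 < \<tau>" using assms by linarith
  then have "(ramp c has_vector_derivative pulse c \<tau>) (at \<tau>)"
  proof cases
    case 1
    have "((\<lambda>_. 0::real) has_vector_derivative 0) (at \<tau>)" by (rule has_vector_derivative_const)
    then have "(ramp c has_vector_derivative 0) (at \<tau>)"
      by (rule has_vector_derivative_transform_within_open[of _ _ _ "{..<c}"]) (use 1 in \<open>auto simp: ramp_def\<close>)
    then show ?thesis using 1 by (simp add: pulse_def)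
  next
    case 2
    have "((\<lambda>t. t - c) has_vector_derivative 1 - 0) (at \<tau>)" by (intro derivative_intros)
    then have "(ramp c has_vector_derivative 1 - 0) (at \<tau>)"
      by (rule has_vector_derivative_transform_within_open[of _ _ _ "{c<..<c+1}"]) (use 2 in \<open>auto simp: ramp_def\<close>)
    then show ?thesis using 2 by (simp add: pulse_def)
  next
    case 3
    have "((\<lambda>_. 1::real) has_vector_derivative 0) (at \<tau>)" by (rule has_vector_derivative_const)
    then have "(ramp c has_vector_derivative 0) (at \<tau>)"
      by (rule has_vector_derivative_transform_within_open[of _ _ _ "{c+1<..}"]) (use 3 in \<open>auto simp: ramp_def\<close>)
    then show ?thesis using 3 by (simp add: pulse_def)
  qed
  then show ?thesis by (rule has_vector_derivative_at_within)
qed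

locale clock =
  fixes t0 t1 :: real and N :: nat and \<theta> :: "nat \<Rightarrow> real"
  assumes t01: "t0 < t1"
    and \<theta>_mono: "\<And>i j. i < j \<Longrightarrow> j < N \<Longrightarrow> \<theta> i \<le> \<theta> j"
    and \<theta>_range: "\<And>i. i < N \<Longrightarrow> \<theta> i \<in> {t0..t1}"
begin

text \<open>The \<open>i\<close>-th inserted interval is \<open>(ons i, ons i + 1)\<close>. The reference clock \<open>tref\<close> has speed \<open>vref\<close>: it stands
  still there, at time \<open>\<theta> i\<close>, and has speed \<open>1\<close> elsewhere. The \<open>\<theta> i\<close> need not be distinct.\<close>

definition ons :: "nat \<Rightarrow> real" where "ons i = \<theta> i + real i"
definition fin :: real where "fin = t1 + real N"
definition tref :: "real \<Rightarrow> real" where "tref \<tau> = \<tau> - (\<Sum>i<N. ramp (ons i) \<tau>)"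
definition vref :: "real \<Rightarrow> real" where "vref \<tau> = 1 - (\<Sum>i<N. pulse (ons i) \<tau>)"
definition breaks :: "real set" where "breaks = (\<Union>i<N. {ons i, ons i + 1})"

lemma t0_fin: "t0 < fin" using t01 by (simp add: fin_def)

lemma negligible_breaks: "negligible breaks"
  by (rule negligible_finite) (simp add: breaks_def)

lemma ons_less: "i < j \<Longrightarrow> j < N \<Longrightarrow> ons i + 1 \<le> ons j"
  using \<theta>_mono[of i j] by (simp add: ons_def)

text \<open>Inserted intervals do not overlap, so at most one pulse is active. In the second case
  \<open>k\<close> counts the inserted intervals already passed; its bound \<open>N\<close> will
  confine preimages of null sets to finitely many translates.\<close>

lemma pulse_cases:
  obtains i where "i < N" "pulse (ons i) \<tau> = 1" "\<And>j. j < N \<Longrightarrow> j \<noteq> i \<Longrightarrow> pulse (ons j) \<tau> = 0" "vref \<tau> = 0" "tref \<tau> = \<theta> i"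
  | k where "k \<le> N" "\<And>j. j < N \<Longrightarrow> pulse (ons j) \<tau> = 0" "vref \<tau> = 1" "tref \<tau> = \<tau> - real k"
proof (cases "\<exists>i<N. pulse (ons i) \<tau> = 1")
  case True
  then obtain i where i: "i < N" "pulse (ons i) \<tau> = 1" by blast
  then have \<tau>: "ons i < \<tau>" "\<tau> < ons i + 1" by (auto simp: pulse_def)
  have before: "pulse (ons j) \<tau> = 0 \<and> ramp (ons j) \<tau> = 1" if "j < i" for j
    using ons_less[OF that i(1)] \<tau> by (auto simp: pulse_def ramp_def)
  have after: "pulse (ons j) \<tau> = 0 \<and> ramp (ons j) \<tau> = 0" if "i < j" "j < N" for j
    using ons_less[OF that] \<tau> by (auto simp: pulse_def ramp_def)
  have other: "pulse (ons j) \<tau> = 0" if "j < N" "j \<noteq> i" for j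
    using before[of j] after[of j] that by (cases "j < i") auto
  have "(\<Sum>j<N. pulse (ons j) \<tau>) = (\<Sum>j<N. of_bool (j = i))"
    using other i by (intro sum.cong) auto
  also have "\<dots> = (1::real)" using i by simp
  finally have "vref \<tau> = 0" by (simp add: vref_def)
  \<comment> \<open>Earlier ramps are complete and later ones have not begun: the sum is
    \<open>i + (\<tau> - ons i)\<close>, and subtraction from \<open>\<tau>\<close> leaves
    \<open>\<theta> i\<close>.\<close>
  have "(\<Sum>j<N. ramp (ons j) \<tau>) = (\<Sum>j<N. of_bool (j < i) + of_bool (j = i) * (\<tau> - ons i))"
    using before after \<tau> by (intro sum.cong) (auto simp: ramp_def not_less nat_neq_iff)
  also have "\<dots> = (\<Sum>j<N. of_bool (j < i)) + (\<tau> - ons i)"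
    using i by (simp add: sum.distrib flip: sum_distrib_right)
  also have "(\<Sum>j<N. of_bool (j < i)) = real (card ({..<N} \<inter> {j. j < i}))" by (simp add: sum_of_bool_eq)
  also have "{..<N} \<inter> {j. j < i} = {..<i}" using i by auto
  finally have "tref \<tau> = \<theta> i" by (simp add: tref_def ons_def)
  with i other \<open>vref \<tau> = 0\<close> show thesis using that(1) by blast
next
  case False
  then have p0: "pulse (ons j) \<tau> = 0" if "j < N" for j using that by (auto simp: pulse_def)
  then have "vref \<tau> = 1" by (simp add: vref_def)
  have "ramp (ons j) \<tau> = of_bool (ons j + 1 \<le> \<tau>)" if "j < N" for j
    using p0[OF that] by (auto simp: pulse_def ramp_def split: if_splits)
  then have "(\<Sum>j<N. ramp (ons j) \<tau>) = (\<Sum>j<N. of_bool (ons j + 1 \<le> \<tau>))" by (intro sum.cong) auto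
  also have "\<dots> = real (card ({..<N} \<inter> {j. ons j + 1 \<le> \<tau>}))" by (simp add: sum_of_bool_eq)
  finally have "tref \<tau> = \<tau> - real (card ({..<N} \<inter> {j. ons j + 1 \<le> \<tau>}))" by (simp add: tref_def)
  moreover have "card ({..<N} \<inter> {j. ons j + 1 \<le> \<tau>}) \<le> N"
    using card_mono[of "{..<N}" "{..<N} \<inter> {j. ons j + 1 \<le> \<tau>}"] by simp
  ultimately show thesis using that(2) p0 \<open>vref \<tau> = 1\<close> by blast
qed

lemma vref_bounds: "0 \<le> vref \<tau>" "vref \<tau> \<le> 1"
  by (cases \<tau> rule: pulse_cases; simp)+

lemma tref_has_derivative:
  assumes "\<tau> \<notin> breaks"
  shows "(tref has_vector_derivative vref \<tau>) (at \<tau> within S)"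
  unfolding tref_def[abs_def] vref_def using assms
  by (intro derivative_intros ramp_has_derivative) (auto simp: breaks_def)

lemma ramp_has_derivative': "\<tau> \<notin> breaks \<Longrightarrow> i < N \<Longrightarrow> (ramp (ons i) has_vector_derivative pulse (ons i) \<tau>) (at \<tau> within S)"
  by (rule ramp_has_derivative) (auto simp: breaks_def)

text \<open>The lower bound comes from integrating \<open>vref \<ge> 0\<close>, the upper one from
  the monotonicity of the ramps.\<close>

lemma tref_increment: "s \<le> t \<Longrightarrow> tref s \<le> tref t" "s \<le> t \<Longrightarrow> tref t - tref s \<le> t - s"
proof -
  assume st: "s \<le> t"
  have "(1 + real N)-lipschitz_on {s..t} tref"
  proof (rule lipschitz_onI)
    fix x y
    have "\<bar>\<Sum>i<N. ramp (ons i) x - ramp (ons i) y\<bar> \<le> (\<Sum>i<N. \<bar>x - y\<bar>)"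
      by (intro order_trans[OF sum_abs] sum_mono ramp_lipschitz)
    then show "dist (tref x) (tref y) \<le> (1 + real N) * dist x y"
      unfolding tref_def dist_real_def sum_subtractf by (simp add: algebra_simps)
  qed simp
  then have "(vref has_integral tref t - tref s) {s..t}"
    using st by (intro fundamental_theorem_of_calculus_lipschitz[OF _ _ negligible_breaks] tref_has_derivative) auto
  then show "tref s \<le> tref t"
    using has_integral_nonneg[of vref "tref t - tref s" "{s..t}"] vref_bounds by auto
  show "tref t - tref s \<le> t - s"
    using sum_mono[of "{..<N}" "\<lambda>i. ramp (ons i) s" "\<lambda>i. ramp (ons i) t"] ramp_mono[OF st] by (simp add: tref_def)
qed

lemma tref_lipschitz: "\<bar>tref s - tref t\<bar> \<le> \<bar>s - t\<bar>"
  using tref_increment[of s t] tref_increment[of t s] by (cases "s \<le> t") auto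

lemma ramp_t0: "i < N \<Longrightarrow> ramp (ons i) t0 = 0"
  using \<theta>_range[of i] by (auto simp: ramp_def ons_def)

lemma ramp_fin: "i < N \<Longrightarrow> ramp (ons i) fin = 1"
proof -
  assume i: "i < N"
  then have "real i + 1 \<le> real N" by linarith
  then have "1 \<le> fin - ons i" using \<theta>_range[OF i] unfolding fin_def ons_def by simp
  then show ?thesis by (simp add: ramp_def)
qed

lemma tref_t0: "tref t0 = t0" by (simp add: tref_def ramp_t0)
lemma tref_fin: "tref fin = t1" by (simp add: tref_def ramp_fin) (simp add: fin_def)

lemma tref_range: "\<tau> \<in> {t0..fin} \<Longrightarrow> tref \<tau> \<in> {t0..t1}"
  using tref_increment(1)[of t0 \<tau>] tref_increment(1)[of \<tau> fin] by (auto simp: tref_t0 tref_fin)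

lemma tref_measurable [measurable]: "tref \<in> borel_measurable borel"
  by (rule borel_measurable_mono) (auto simp: mono_def tref_increment)

lemma vref_measurable [measurable]: "vref \<in> borel_measurable borel"
  unfolding vref_def[abs_def] by measurable

text \<open>\<open>X\<close> may fail to be differentiable at \<open>\<theta> i\<close>, but on an
  inserted interval the composition is constant, so its derivative is zero there. Elsewhere the
  clock has speed one and the chain rule applies.\<close>

lemma reparametrization:
  fixes X :: "real \<Rightarrow> 'a::euclidean_space"
  assumes lip: "L-lipschitz_on {t0..t1} X" and E: "negligible E"
    and deriv: "\<And>t. t \<in> {t0..t1} - E \<Longrightarrow> (X has_vector_derivative X' t) (at t within {t0..t1})"
  shows "\<exists>E'. negligible E' \<and> breaks \<subseteq> E' \<and> (\<forall>\<tau>\<in>{t0..fin} - E'. (vref \<tau> \<noteq> 0 \<longrightarrow> tref \<tau> \<notin> E) \<and>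
      ((\<lambda>\<tau>. X (tref \<tau>)) has_vector_derivative vref \<tau> *\<^sub>R X' (tref \<tau>)) (at \<tau> within {t0..fin}))"
    and "L-lipschitz_on {t0..fin} (\<lambda>\<tau>. X (tref \<tau>))"
proof -
  \<comment> \<open>Off the inserted intervals \<open>tref\<close> subtracts some
    \<open>k \<le> N\<close>, so these translates of \<open>E\<close> contain every point that the
    clock sends into \<open>E\<close>.\<close>
  define E' where "E' = breaks \<union> (\<Union>k\<in>{..N}. (+) (real k) ` E)"
  have "negligible E'"
    unfolding E'_def by (intro negligible_Un negligible_breaks negligible_Union) (auto intro: negligible_translation E)
  have nE: "tref \<tau> \<notin> E" if "\<tau> \<notin> E'" "vref \<tau> \<noteq> 0" for \<tau>
  proof (cases \<tau> rule: pulse_cases)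
    case (2 k)
    then have "\<tau> = real k + tref \<tau>" by simp
    then show ?thesis using that(1) 2(1) unfolding E'_def by blast
  qed (use that in auto)
  have d: "((\<lambda>\<tau>. X (tref \<tau>)) has_vector_derivative vref \<tau> *\<^sub>R X' (tref \<tau>)) (at \<tau> within {t0..fin})"
    if \<tau>: "\<tau> \<in> {t0..fin} - E'" for \<tau>
  proof (cases \<tau> rule: pulse_cases)
    case (1 i)
    have "((\<lambda>_. X (\<theta> i)) has_vector_derivative 0) (at \<tau>)" by (rule has_vector_derivative_const)
    then have "((\<lambda>\<tau>. X (tref \<tau>)) has_vector_derivative 0) (at \<tau>)"
    proof (rule has_vector_derivative_transform_within_open[of _ _ _ "{ons i<..<ons i + 1}"])
      show "\<tau> \<in> {ons i<..<ons i + 1}" using 1 by (auto simp: pulse_def)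
      fix s assume "s \<in> {ons i<..<ons i + 1}"
      then have "pulse (ons i) s = 1" by (simp add: pulse_def)
      then have "tref s = \<theta> i"
      proof (cases s rule: pulse_cases)
        case (1 j)
        then have "j = i" using \<open>i < N\<close> \<open>pulse (ons i) s = 1\<close> by force
        then show ?thesis using 1 by simp
      next
        case (2 k)
        then show ?thesis using \<open>i < N\<close> \<open>pulse (ons i) s = 1\<close> by force
      qed
      then show "X (\<theta> i) = X (tref s)" by simp
    qed simp
    then show ?thesis using 1 by (simp add: has_vector_derivative_at_within)
  next
    case (2 k)
    have "(X has_vector_derivative X' (tref \<tau>)) (at (tref \<tau>) within tref ` {t0..fin})"
    proof (rule has_vector_derivative_within_subset[OF deriv])
      show "tref \<tau> \<in> {t0..t1} - E" using tref_range[of \<tau>] nE[of \<tau>] \<tau> 2(3) by auto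
      show "tref ` {t0..fin} \<subseteq> {t0..t1}" using tref_range by blast
    qed
    moreover have "(tref has_vector_derivative vref \<tau>) (at \<tau> within {t0..fin})"
      using \<tau> by (intro tref_has_derivative) (auto simp: E'_def)
    ultimately show ?thesis
      using vector_diff_chain_within[of tref "vref \<tau>" \<tau> "{t0..fin}" X "X' (tref \<tau>)"] by (simp add: o_def)
  qed
  have "L-lipschitz_on {t0..fin} (\<lambda>\<tau>. X (tref \<tau>))"
  proof (rule lipschitz_onI)
    fix s t assume st: "s \<in> {t0..fin}" "t \<in> {t0..fin}"
    have "dist (X (tref s)) (X (tref t)) \<le> L * dist (tref s) (tref t)"
      by (rule lipschitz_onD[OF lip tref_range[OF st(1)] tref_range[OF st(2)]])
    also have "\<dots> \<le> L * dist s t"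
      using lipschitz_on_nonneg[OF lip] tref_lipschitz by (intro mult_left_mono) (auto simp: dist_real_def)
    finally show "dist (X (tref s)) (X (tref t)) \<le> L * dist s t" .
  qed (rule lipschitz_on_nonneg[OF lip])
  then show "L-lipschitz_on {t0..fin} (\<lambda>\<tau>. X (tref \<tau>))" .
  show "\<exists>E'. negligible E' \<and> breaks \<subseteq> E' \<and> (\<forall>\<tau>\<in>{t0..fin} - E'. (vref \<tau> \<noteq> 0 \<longrightarrow> tref \<tau> \<notin> E) \<and>
      ((\<lambda>\<tau>. X (tref \<tau>)) has_vector_derivative vref \<tau> *\<^sub>R X' (tref \<tau>)) (at \<tau> within {t0..fin}))"
    using \<open>negligible E'\<close> nE d by (intro exI[of _ E']) (auto simp: E'_def)
qed

end

text \<open>Where the clock \<open>s\<close> stands still it has no inverse, but any right inverse \<open>r\<close> is monotone, hence Borel, and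
  \<open>y \<circ> r\<close> does not depend on its choice.\<close>

lemma realize_time_change:
  fixes y :: "real \<Rightarrow> 'a::euclidean_space" and c s :: "real \<Rightarrow> real"
  assumes "a < b" and mono: "\<And>\<sigma> \<tau>. a \<le> \<sigma> \<Longrightarrow> \<sigma> \<le> \<tau> \<Longrightarrow> \<tau> \<le> b \<Longrightarrow> s \<sigma> \<le> s \<tau>" and less: "s a < s b"
    and lip_s: "L-lipschitz_on {a..b} s"
    and lip_y: "\<And>\<sigma> \<tau>. \<sigma> \<in> {a..b} \<Longrightarrow> \<tau> \<in> {a..b} \<Longrightarrow> norm (y \<sigma> - y \<tau>) \<le> M * \<bar>s \<sigma> - s \<tau>\<bar>" and "M \<ge> 0"
    and E: "negligible E"
    and ds: "\<And>\<tau>. \<tau> \<in> {a..b} - E \<Longrightarrow> (s has_vector_derivative c \<tau>) (at \<tau> within {a..b})"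
    and dy: "\<And>\<tau>. \<tau> \<in> {a..b} - E \<Longrightarrow> (y has_vector_derivative c \<tau> *\<^sub>R g \<tau>) (at \<tau> within {a..b})"
    and c: "\<And>\<tau>. \<tau> \<in> {a..b} - E \<Longrightarrow> 0 \<le> c \<tau>"
    and zero: "negligible (s ` {\<tau> \<in> {a..b} - E. c \<tau> = 0})"
  shows "\<exists>(r :: real \<Rightarrow> real) E'. r \<in> borel_measurable borel \<and> (\<forall>t. r t \<in> {a..b}) \<and> (\<forall>t\<in>{s a..s b}. s (r t) = t) \<and>
    M-lipschitz_on {s a..s b} (\<lambda>t. y (r t)) \<and> y (r (s a)) = y a \<and> y (r (s b)) = y b \<and> negligible E' \<and>
    (\<forall>t\<in>{s a..s b} - E'. ((\<lambda>t. y (r t)) has_vector_derivative g (r t)) (at t within {s a..s b}))"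
proof -
  have "\<exists>\<tau>\<in>{a..b}. s \<tau> = t" if "t \<in> {s a..s b}" for t
    using IVT'[of s a t b] that \<open>a < b\<close> lipschitz_on_continuous_on[OF lip_s] by fastforce
  then obtain r0 where r0: "\<And>t. t \<in> {s a..s b} \<Longrightarrow> r0 t \<in> {a..b} \<and> s (r0 t) = t" by metis
  \<comment> \<open>Clamping to the range of the clock extends the right inverse monotonically to
    the whole line.\<close>
  define cl where "cl = (\<lambda>t. max (s a) (min (s b) t))"
  have cl: "cl t \<in> {s a..s b}" "t \<in> {s a..s b} \<Longrightarrow> cl t = t" for t using less by (auto simp: cl_def)
  define r where "r = (\<lambda>t. r0 (cl t))"
  have r: "r t \<in> {a..b}" "t \<in> {s a..s b} \<Longrightarrow> s (r t) = t" for t using r0 cl by (auto simp: r_def)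
  have "mono r"
  proof (rule monoI)
    fix t t' :: real assume "t \<le> t'"
    then have "cl t \<le> cl t'" by (auto simp: cl_def)
    show "r t \<le> r t'"
    proof (rule ccontr)
      assume "\<not> r t \<le> r t'"
      then have "s (r t') \<le> s (r t)" using r(1)[of t] r(1)[of t'] by (intro mono) auto
      then have "cl t' \<le> cl t" using r0 cl(1) by (simp add: r_def)
      then have "cl t = cl t'" using \<open>cl t \<le> cl t'\<close> by simp
      then show False using \<open>\<not> r t \<le> r t'\<close> by (simp add: r_def)
    qed
  qed
  have lip: "M-lipschitz_on {s a..s b} (\<lambda>t. y (r t))"
  proof (rule lipschitz_onI)
    fix t t' assume t: "t \<in> {s a..s b}" "t' \<in> {s a..s b}"
    show "dist (y (r t)) (y (r t')) \<le> M * dist t t'"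
      using lip_y[OF r(1)[of t] r(1)[of t']] r(2)[OF t(1)] r(2)[OF t(2)] by (simp add: dist_norm)
  qed fact
  \<comment> \<open>Exceptional times: the image of \<open>E\<close>, null since \<open>s\<close> is
    Lipschitz, and the times at which the clock stands still.\<close>
  define E' where "E' = s ` ({a..b} \<inter> E) \<union> s ` {\<tau> \<in> {a..b} - E. c \<tau> = 0}"
  have "negligible (s ` ({a..b} \<inter> E))"
  proof (rule negligible_locally_Lipschitz_image)
    show "negligible ({a..b} \<inter> E)" using E by (rule negligible_subset) auto
    fix x assume "x \<in> {a..b} \<inter> E"
    then show "\<exists>T B. open T \<and> x \<in> T \<and> (\<forall>y\<in>{a..b} \<inter> E \<inter> T. norm (s y - s x) \<le> B * norm (y - x))"
      using lipschitz_onD[OF lip_s] by (intro exI[of _ UNIV] exI[of _ L]) (auto simp: dist_norm)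
  qed simp
  then have E': "negligible E'" unfolding E'_def using zero by (rule negligible_Un)
  have d: "((\<lambda>t. y (r t)) has_vector_derivative g (r t)) (at t within {s a..s b})" if t: "t \<in> {s a..s b} - E'" for t
  proof -
    define \<tau> where "\<tau> = r t"
    have \<tau>: "\<tau> \<in> {a..b}" "s \<tau> = t" using r t by (auto simp: \<tau>_def)
    then have "\<tau> \<notin> E" "c \<tau> \<noteq> 0" using t unfolding E'_def by blast+
    then have "c \<tau> > 0" using c[of \<tau>] \<tau> by auto
    note ds = ds[of \<tau>, unfolded has_vector_derivative_def has_derivative_within_alt]
      and dy = dy[of \<tau>, unfolded has_vector_derivative_def has_derivative_within_alt]
    have ds': "\<exists>d>0. \<forall>z\<in>{a..b}. \<bar>z - \<tau>\<bar> < d \<longrightarrow> \<bar>s z - s \<tau> - (z - \<tau>) * c \<tau>\<bar> \<le> e * \<bar>z - \<tau>\<bar>" if "e > 0" for e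
      using ds \<tau> \<open>\<tau> \<notin> E\<close> that by auto
    have dy': "\<exists>d>0. \<forall>z\<in>{a..b}. \<bar>z - \<tau>\<bar> < d \<longrightarrow> norm (y z - y \<tau> - (z - \<tau>) *\<^sub>R c \<tau> *\<^sub>R g \<tau>) \<le> e * \<bar>z - \<tau>\<bar>" if "e > 0" for e
      using dy \<tau> \<open>\<tau> \<notin> E\<close> that by auto
    obtain d0 where "d0 > 0" and d0: "\<And>z. z \<in> {a..b} \<Longrightarrow> \<bar>z - \<tau>\<bar> < d0 \<Longrightarrow> \<bar>s z - s \<tau> - (z - \<tau>) * c \<tau>\<bar> \<le> c \<tau> / 2 * \<bar>z - \<tau>\<bar>"
      using ds'[of "c \<tau> / 2"] \<open>c \<tau> > 0\<close> by auto
    have lower: "c \<tau> / 2 * \<bar>z - \<tau>\<bar> \<le> \<bar>s z - s \<tau>\<bar>" if "z \<in> {a..b}" "\<bar>z - \<tau>\<bar> < d0" for z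
    proof -
      have "\<bar>(z - \<tau>) * c \<tau>\<bar> = c \<tau> * \<bar>z - \<tau>\<bar>" using \<open>c \<tau> > 0\<close> by (simp add: abs_mult)
      then show ?thesis using d0[OF that] by linarith
    qed
    \<comment> \<open>By monotonicity the clock cannot return: if \<open>z\<close> is at least
      \<open>\<delta>\<close> away from \<open>\<tau>\<close>, the clock has moved by at least
      \<open>c \<tau> / 4 * \<delta>\<close> already at distance \<open>\<delta> / 2\<close>. So
      \<open>r\<close> is continuous at \<open>t\<close>.\<close>
    have close: "\<bar>z - \<tau>\<bar> < \<delta>" if z: "z \<in> {a..b}" "\<bar>s z - s \<tau>\<bar> < c \<tau> / 4 * \<delta>" and \<delta>: "0 < \<delta>" "\<delta> \<le> d0" for z \<delta>
    proof (rule ccontr)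
      assume "\<not> \<bar>z - \<tau>\<bar> < \<delta>"
      define w where "w = (if \<tau> \<le> z then \<tau> + \<delta> / 2 else \<tau> - \<delta> / 2)"
      have w: "w \<in> {a..b}" "\<bar>w - \<tau>\<bar> = \<delta> / 2" "\<tau> \<le> z \<Longrightarrow> \<tau> \<le> w \<and> w \<le> z" "\<not> \<tau> \<le> z \<Longrightarrow> z \<le> w \<and> w \<le> \<tau>"
        using \<open>\<not> \<bar>z - \<tau>\<bar> < \<delta>\<close> z \<tau> \<delta> by (auto simp: w_def)
      have "c \<tau> / 2 * (\<delta> / 2) \<le> \<bar>s w - s \<tau>\<bar>" using lower[OF w(1)] w(2) \<delta> by simp
      also have "\<bar>s w - s \<tau>\<bar> \<le> \<bar>s z - s \<tau>\<bar>"
      proof (cases "\<tau> \<le> z")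
        case True
        then have "s \<tau> \<le> s w" "s w \<le> s z" using w(3) \<tau> z by (auto intro!: mono)
        then show ?thesis by simp
      next
        case False
        then have "s w \<le> s \<tau>" "s z \<le> s w" using w(4) \<tau> z by (auto intro!: mono)
        then show ?thesis by simp
      qed
      finally show False using z(2) by simp
    qed
    show ?thesis unfolding has_vector_derivative_def has_derivative_within_alt
    proof (intro conjI allI impI bounded_linear_scaleR_left)
      fix e :: real assume "e > 0"
      define B where "B = 1 + norm (g \<tau>)"
      have gp: "B > 0" using norm_ge_zero[of "g \<tau>"] unfolding B_def by linarith
      \<comment> \<open>The error of \<open>y\<close> and that of \<open>s\<close> times
        \<open>g \<tau>\<close> together give the factor \<open>B\<close>; the lower bound on the
        motion of the clock gives \<open>c \<tau> / 2\<close>.\<close>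
      define e' where "e' = e * (c \<tau> / 2) / B"
      have "e' > 0" using \<open>e > 0\<close> \<open>c \<tau> > 0\<close> gp by (simp add: e'_def)
      obtain d1 where "d1 > 0" and d1: "\<And>z. z \<in> {a..b} \<Longrightarrow> \<bar>z - \<tau>\<bar> < d1 \<Longrightarrow> \<bar>s z - s \<tau> - (z - \<tau>) * c \<tau>\<bar> \<le> e' * \<bar>z - \<tau>\<bar>"
        using ds'[OF \<open>e' > 0\<close>] by auto
      obtain d2 where "d2 > 0" and d2: "\<And>z. z \<in> {a..b} \<Longrightarrow> \<bar>z - \<tau>\<bar> < d2 \<Longrightarrow> norm (y z - y \<tau> - (z - \<tau>) *\<^sub>R c \<tau> *\<^sub>R g \<tau>) \<le> e' * \<bar>z - \<tau>\<bar>"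
        using dy'[OF \<open>e' > 0\<close>] by auto
      define \<delta> where "\<delta> = min d0 (min d1 d2)"
      have \<delta>: "\<delta> > 0" "\<delta> \<le> d0" "\<delta> \<le> d1" "\<delta> \<le> d2" using \<open>d0 > 0\<close> \<open>d1 > 0\<close> \<open>d2 > 0\<close> by (auto simp: \<delta>_def)
      show "\<exists>d>0. \<forall>t'\<in>{s a..s b}. norm (t' - t) < d \<longrightarrow>
         norm (y (r t') - y (r t) - (t' - t) *\<^sub>R g (r t)) \<le> e * norm (t' - t)"
      proof (intro exI conjI ballI impI)
        show "c \<tau> / 4 * \<delta> > 0" using \<delta> \<open>c \<tau> > 0\<close> by simp
        fix t' assume t': "t' \<in> {s a..s b}" "norm (t' - t) < c \<tau> / 4 * \<delta>"
        define z where "z = r t'"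
        have z: "z \<in> {a..b}" "s z = t'" using r t' by (auto simp: z_def)
        then have zd: "\<bar>z - \<tau>\<bar> < \<delta>" using close[of z \<delta>] t'(2) \<tau> \<delta> by simp
        have "y z - y \<tau> - (s z - s \<tau>) *\<^sub>R g \<tau> = (y z - y \<tau> - (z - \<tau>) *\<^sub>R c \<tau> *\<^sub>R g \<tau>) - (s z - s \<tau> - (z - \<tau>) * c \<tau>) *\<^sub>R g \<tau>"
          by (simp add: algebra_simps)
        then have "norm (y z - y \<tau> - (s z - s \<tau>) *\<^sub>R g \<tau>) \<le>
          norm (y z - y \<tau> - (z - \<tau>) *\<^sub>R c \<tau> *\<^sub>R g \<tau>) + \<bar>s z - s \<tau> - (z - \<tau>) * c \<tau>\<bar> * norm (g \<tau>)"
          by (metis norm_scaleR norm_triangle_ineq4 real_norm_def)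
        also have "\<dots> \<le> e' * \<bar>z - \<tau>\<bar> + e' * \<bar>z - \<tau>\<bar> * norm (g \<tau>)"
          using d1[OF z(1)] d2[OF z(1)] zd \<delta> by (intro add_mono mult_right_mono) auto
        also have "\<dots> = e' * B * \<bar>z - \<tau>\<bar>" by (simp add: B_def algebra_simps)
        also have "\<dots> = e * (c \<tau> / 2 * \<bar>z - \<tau>\<bar>)" using gp by (simp add: e'_def)
        also have "\<dots> \<le> e * \<bar>s z - s \<tau>\<bar>" using lower[OF z(1)] zd \<delta> \<open>e > 0\<close> by (intro mult_left_mono) auto
        finally show "norm (y (r t') - y (r t) - (t' - t) *\<^sub>R g (r t)) \<le> e * norm (t' - t)"
          using z \<tau> by (simp add: z_def \<tau>_def)
      qed
    qed
  qed
  \<comment> \<open>If the clock stands still next to an end point, \<open>r (s a)\<close> may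
    differ from \<open>a\<close>, but the states there agree.\<close>
  have eqy: "y (r (s \<tau>)) = y \<tau>" if "\<tau> \<in> {a..b}" for \<tau>
  proof -
    have "s \<tau> \<in> {s a..s b}" using that by (auto intro!: mono)
    then have "s (r (s \<tau>)) = s \<tau>" by (rule r(2))
    then show ?thesis using lip_y[OF r(1)[of "s \<tau>"] that] by simp
  qed
  show ?thesis
    using borel_measurable_mono[OF \<open>mono r\<close>] r lip E' d eqy \<open>a < b\<close>
    by (intro exI[of _ r] exI[of _ E']) auto
qed

section \<open>Adjoint functions\<close>

text \<open>The transpose, written over the basis so that its measurable dependence on the operator
  is evident.\<close>

definition blinfun_adjoint :: "('a::euclidean_space \<Rightarrow>\<^sub>L 'a) \<Rightarrow> 'a \<Rightarrow> 'a" where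
  "blinfun_adjoint A w = (\<Sum>b\<in>Basis. (blinfun_apply A b \<bullet> w) *\<^sub>R b)"

lemma inner_blinfun_adjoint: "blinfun_adjoint A w \<bullet> z = w \<bullet> blinfun_apply A z"
proof -
  have "w \<bullet> blinfun_apply A z = w \<bullet> blinfun_apply A (\<Sum>b\<in>Basis. (z \<bullet> b) *\<^sub>R b)"
    by (simp add: euclidean_representation)
  also have "\<dots> = blinfun_adjoint A w \<bullet> z"
    by (simp add: blinfun_adjoint_def blinfun.sum_right blinfun.scaleR_right inner_sum_right inner_sum_left inner_commute mult.commute)
  finally show ?thesis by simp
qed

lemma norm_blinfun_adjoint_le: "norm (blinfun_adjoint A w) \<le> norm A * norm w"
proof -
  let ?a = "blinfun_adjoint A w"
  have "norm ?a * norm ?a = w \<bullet> blinfun_apply A ?a"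
    using inner_blinfun_adjoint[of A w ?a] by (simp add: power2_norm_eq_inner power2_eq_square[symmetric])
  also have "\<dots> \<le> norm w * norm (blinfun_apply A ?a)" by (rule norm_cauchy_schwarz)
  also have "\<dots> \<le> norm w * (norm A * norm ?a)" by (intro mult_left_mono norm_blinfun) auto
  finally have "norm ?a * norm ?a \<le> (norm A * norm w) * norm ?a" by (simp add: mult_ac)
  then show ?thesis by (cases "norm ?a = 0") (auto simp: mult_le_cancel_right)
qed

lemma blinfun_adjoint_diff: "blinfun_adjoint A w - blinfun_adjoint A z = blinfun_adjoint A (w - z)"
  by (simp add: blinfun_adjoint_def inner_diff_right scaleR_diff_left sum_subtractf)

text \<open>\<open>Rad\<close> leaves a margin \<open>1\<close> around the trajectory.
  \<open>Bu\<close> bounds the reference control and will also have to bound the inserted control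
  values. \<open>Mb\<close> bounds \<open>f\<close>, \<open>ft\<close> and \<open>fx\<close> over a
  time interval enlarged on both sides, so that varied clocks stay inside. State and control are
  defined on the whole line to make Borel measurability available.\<close>

locale reference = control_system f ft fx
  for f :: "real \<Rightarrow> 'a::euclidean_space \<Rightarrow> 'b::euclidean_space \<Rightarrow> 'a" and ft fx +
  fixes t0 t1 :: real and x :: "real \<Rightarrow> 'a" and u :: "real \<Rightarrow> 'b" and Rad Bu Mb :: real
  assumes t0_less_t1: "t0 < t1"
    and cont_x: "continuous_on UNIV x"
    and x_eq: "\<And>t. t \<in> {t0..t1} \<Longrightarrow> x t = x t0 + integral {t0..t} (\<lambda>s. f s (x s) (u s))"
    and x_Rad: "\<And>t. t \<in> {t0..t1} \<Longrightarrow> norm (x t) + 1 \<le> Rad"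
    and u_measurable [measurable]: "u \<in> borel_measurable borel"
    and u_bound: "\<And>t. norm (u t) \<le> Bu"
    and Mb_pos: "Mb > 0"
    and f_Mb: "\<And>t y w. (t, y, w) \<in> box3 (t0 - (1 + (t1 - t0))) (t1 + (1 + (t1 - t0))) Rad Bu \<Longrightarrow> norm (f t y w) \<le> Mb"
    and ft_Mb: "\<And>z. z \<in> box3 (t0 - (1 + (t1 - t0))) (t1 + (1 + (t1 - t0))) Rad Bu \<Longrightarrow> norm (ft z) \<le> Mb"
    and fx_Mb: "\<And>z. z \<in> box3 (t0 - (1 + (t1 - t0))) (t1 + (1 + (t1 - t0))) Rad Bu \<Longrightarrow> norm (fx z) \<le> Mb"
begin

definition Ct :: real where "Ct = 1 + (t1 - t0)"
text \<open>The constant \<open>Ct\<close> bounds the displacement of the clock by the size of a parameter.\<close>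

definition Box :: "(real \<times> 'a \<times> 'b) set" where "Box = box3 (t0 - Ct) (t1 + Ct) Rad Bu"

lemma Ct_ge_1: "Ct \<ge> 1" using t0_less_t1 by (simp add: Ct_def)

lemma Box_bounds:
  "(t, y, w) \<in> Box \<Longrightarrow> norm (f t y w) \<le> Mb" "z \<in> Box \<Longrightarrow> norm (ft z) \<le> Mb" "z \<in> Box \<Longrightarrow> norm (fx z) \<le> Mb"
  using f_Mb ft_Mb fx_Mb by (simp_all add: Box_def Ct_def)

lemma Box_iff: "(t, y, w) \<in> Box \<longleftrightarrow> t \<in> {t0 - Ct..t1 + Ct} \<and> norm y \<le> Rad \<and> norm w \<le> Bu"
  by (auto simp: Box_def box3_def)

lemma Rad_pos: "Rad > 0"
proof -
  have "norm (x t0) + 1 \<le> Rad" using x_Rad t0_less_t1 by simp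
  then show ?thesis using norm_ge_zero[of "x t0"] by linarith
qed

lemma ref_in_Box: "t \<in> {t0..t1} \<Longrightarrow> norm w \<le> Bu \<Longrightarrow> (t, x t, w) \<in> Box"
  using x_Rad[of t] Ct_ge_1 by (auto simp: Box_iff)

lemma f_measurable [measurable (raw)]:
  assumes "g1 \<in> borel_measurable M" "g2 \<in> borel_measurable M" "g3 \<in> borel_measurable M"
  shows "(\<lambda>s. f (g1 s) (g2 s) (g3 s)) \<in> borel_measurable M"
proof -
  have "(\<lambda>s. (\<lambda>(t, x, u). f t x u) (g1 s, g2 s, g3 s)) \<in> borel_measurable M"
    by (rule measurable_compose[OF _ borel_measurable_continuous_onI[OF cont_f]]) (use assms in measurable)
  then show ?thesis by simp
qed

lemma ft_measurable [measurable (raw)]: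
  assumes "g1 \<in> borel_measurable M" "g2 \<in> borel_measurable M" "g3 \<in> borel_measurable M"
  shows "(\<lambda>s. ft (g1 s, g2 s, g3 s)) \<in> borel_measurable M"
  by (rule measurable_compose[OF _ borel_measurable_continuous_onI[OF cont_ft]]) (use assms in measurable)

lemma fx_measurable [measurable (raw)]:
  assumes "g1 \<in> borel_measurable M" "g2 \<in> borel_measurable M" "g3 \<in> borel_measurable M"
  shows "(\<lambda>s. blinfun_apply (fx (g1 s, g2 s, g3 s)) b) \<in> borel_measurable M"
proof (rule measurable_compose[of "\<lambda>s. (g1 s, g2 s, g3 s)" M borel "\<lambda>z. blinfun_apply (fx z) b"])
  show "(\<lambda>z. blinfun_apply (fx z) b) \<in> borel_measurable borel"
    by (intro borel_measurable_continuous_onI continuous_intros cont_fx)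
qed (use assms in measurable)

lemma x_measurable [measurable]: "x \<in> borel_measurable borel"
  using cont_x by (rule borel_measurable_continuous_onI)

lemma x_lipschitz: "Mb-lipschitz_on {t0..t1} x"
  and x_deriv: "\<exists>E. negligible E \<and> (\<forall>t\<in>{t0..t1} - E. (x has_vector_derivative f t (x t) (u t)) (at t within {t0..t1}))"
proof -
  have b: "norm (f t (x t) (u t)) \<le> Mb" if "t \<in> {t0..t1}" for t
    using Box_bounds(1)[OF ref_in_Box[OF that u_bound]] .
  have i: "(\<lambda>t. f t (x t) (u t)) integrable_on {t0..t1}"
    by (rule bounded_borel_integrable_on[OF _ b]) measurable
  note * = integral_equation_regular[OF i b less_imp_le[OF Mb_pos] x_eq]
  show "Mb-lipschitz_on {t0..t1} x" by (rule *)
  show "\<exists>E. negligible E \<and> (\<forall>t\<in>{t0..t1} - E. (x has_vector_derivative f t (x t) (u t)) (at t within {t0..t1}))" by (rule *)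
qed

text \<open>Terminal values are left open: each endpoint function prescribes its own. Lipschitz
  continuity is demanded because it is stable under products and under composition with
  \<open>tref\<close>.\<close>

definition adjoint_pair :: "(real \<Rightarrow> 'a) \<Rightarrow> (real \<Rightarrow> real) \<Rightarrow> bool" where
  "adjoint_pair \<psi> \<psi>t \<longleftrightarrow> (\<exists>L. L-lipschitz_on {t0..t1} \<psi>) \<and> (\<exists>L. L-lipschitz_on {t0..t1} \<psi>t) \<and>
     (\<exists>E. negligible E \<and> (\<forall>t\<in>{t0..t1} - E.
        (\<psi> has_vector_derivative - blinfun_adjoint (fx (t, x t, u t)) (\<psi> t)) (at t within {t0..t1}) \<and>
        (\<psi>t has_vector_derivative - (\<psi> t \<bullet> ft (t, x t, u t))) (at t within {t0..t1})))"

lemma backward_integral: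
  fixes y :: "real \<Rightarrow> 'c::euclidean_space"
  assumes i: "g integrable_on {t0..t1}" and b: "\<And>t. t \<in> {t0..t1} \<Longrightarrow> norm (g t) \<le> B" "B \<ge> 0"
    and y: "\<And>t. t \<in> {t0..t1} \<Longrightarrow> y t = y1 - integral {t..t1} g"
  shows "B-lipschitz_on {t0..t1} y"
    "\<exists>E. negligible E \<and> (\<forall>t\<in>{t0..t1} - E. (y has_vector_derivative g t) (at t within {t0..t1}))"
proof -
  define y0 where "y0 = y1 - integral {t0..t1} g"
  have y': "y t = y0 + integral {t0..t} g" if "t \<in> {t0..t1}" for t
  proof -
    have "integral {t0..t1} g = integral {t0..t} g + integral {t..t1} g"
      using Henstock_Kurzweil_Integration.integral_combine[of t0 t t1 g] i that by simp
    then show ?thesis using y[OF that] by (simp add: y0_def)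
  qed
  show "B-lipschitz_on {t0..t1} y"
    "\<exists>E. negligible E \<and> (\<forall>t\<in>{t0..t1} - E. (y has_vector_derivative g t) (at t within {t0..t1}))"
    using integral_equation_regular[OF i b y'] by blast+
qed

text \<open>The equation for \<open>\<psi>\<close> is linear with bounded coefficients and does not
  involve \<open>\<psi>t\<close>, which is then a plain integral.\<close>

lemma adjoint_pair_exists:
  obtains \<psi> \<psi>t where "adjoint_pair \<psi> \<psi>t" "\<psi> t1 = c" "\<psi>t t1 = ct"
proof -
  let ?h = "\<lambda>s w. - blinfun_adjoint (fx (s, x s, u s)) w"
  have hb: "norm (?h s w) \<le> Mb * norm w" if "s \<in> {t0..t1}" for s w
  proof -
    have "norm (?h s w) \<le> norm (fx (s, x s, u s)) * norm w" by (simp add: norm_blinfun_adjoint_le)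
    also have "\<dots> \<le> Mb * norm w"
      by (intro mult_right_mono Box_bounds(3) ref_in_Box that u_bound) auto
    finally show ?thesis .
  qed
  \<comment> \<open>A function known only on \<open>{t0..t1}\<close> is extended by constants, which
    makes the integrands Borel on the line.\<close>
  have cl: "continuous_on UNIV (\<lambda>s. y (max t0 (min t1 s)))" if "continuous_on {t0..t1} y" for y :: "real \<Rightarrow> 'c::euclidean_space"
    using t0_less_t1 by (intro continuous_on_compose2[OF that] continuous_intros) auto
  have ybd: "\<exists>B\<ge>0. \<forall>s\<in>{t0..t1}. norm (y s) \<le> B" if "continuous_on {t0..t1} y" for y :: "real \<Rightarrow> 'a"
    using compact_imp_bounded[OF compact_continuous_image[OF that]] unfolding bounded_pos by (meson compact_Icc imageI less_imp_le)
  have int: "(\<lambda>s. ?h s (y s)) integrable_on {t0..t1}" if y: "continuous_on {t0..t1} y" for y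
  proof -
    obtain B where B: "B \<ge> 0" "\<And>s. s \<in> {t0..t1} \<Longrightarrow> norm (y s) \<le> B" using ybd[OF y] by blast
    have [measurable]: "(\<lambda>s. y (max t0 (min t1 s))) \<in> borel_measurable borel"
      by (rule borel_measurable_continuous_onI[OF cl[OF y]])
    have "(\<lambda>s. ?h s (y (max t0 (min t1 s)))) integrable_on {t0..t1}"
    proof (rule bounded_borel_integrable_on)
      show "(\<lambda>s. ?h s (y (max t0 (min t1 s)))) \<in> borel_measurable borel"
        unfolding blinfun_adjoint_def by measurable
      show "norm (?h t (y (max t0 (min t1 t)))) \<le> Mb * B" if "t \<in> {t0..t1}" for t
        using that hb[OF that, of "y t"] B(2)[OF that] Mb_pos
        by (auto intro: order_trans mult_left_mono)
    qed
    then show ?thesis by (rule integrable_eq) auto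
  qed
  obtain \<psi> where \<psi>: "continuous_on {t0..t1} \<psi>" "\<And>t. t \<in> {t0..t1} \<Longrightarrow> \<psi> t = c - integral {t..t1} (\<lambda>s. ?h s (\<psi> s))"
  proof (rule integral_equation_exists_backward[of t0 t1 ?h Mb c])
    show "norm (?h s y - ?h s z) \<le> Mb * norm (y - z)" if "s \<in> {t0..t1}" for s y z
    proof -
      have "?h s y - ?h s z = ?h s (y - z)" by (simp add: blinfun_adjoint_diff[symmetric])
      then show ?thesis using hb[OF that] by simp
    qed
  qed (use int t0_less_t1 in auto)
  obtain B where B: "B \<ge> 0" "\<And>s. s \<in> {t0..t1} \<Longrightarrow> norm (\<psi> s) \<le> B" using ybd[OF \<psi>(1)] by blast
  have hB: "norm (?h t (\<psi> t)) \<le> Mb * B" if "t \<in> {t0..t1}" for t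
    using hb[OF that, of "\<psi> t"] B(2)[OF that] Mb_pos by (auto intro: order_trans mult_left_mono)
  have MB: "0 \<le> Mb * B" using Mb_pos B by simp
  note 1 = backward_integral[OF int[OF \<psi>(1)] hB MB \<psi>(2)]
  let ?g = "\<lambda>s. - (\<psi> s \<bullet> ft (s, x s, u s))"
  define \<psi>t where "\<psi>t = (\<lambda>t. ct - integral {t..t1} ?g)"
  have gB: "norm (?g t) \<le> Mb * B" if "t \<in> {t0..t1}" for t
  proof -
    have "norm (?g t) \<le> norm (\<psi> t) * norm (ft (t, x t, u t))" by (simp add: Cauchy_Schwarz_ineq2)
    also have "\<dots> \<le> B * Mb"
      using B(1) by (intro mult_mono B(2) Box_bounds(2) ref_in_Box that u_bound) auto
    finally show ?thesis by (simp add: mult.commute)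
  qed
  have gi: "?g integrable_on {t0..t1}"
  proof -
    have [measurable]: "(\<lambda>s. \<psi> (max t0 (min t1 s))) \<in> borel_measurable borel"
      by (rule borel_measurable_continuous_onI[OF cl[OF \<psi>(1)]])
    have "(\<lambda>s. - (\<psi> (max t0 (min t1 s)) \<bullet> ft (s, x s, u s))) integrable_on {t0..t1}"
    proof (rule bounded_borel_integrable_on)
      show "norm (- (\<psi> (max t0 (min t1 t)) \<bullet> ft (t, x t, u t))) \<le> Mb * B" if "t \<in> {t0..t1}" for t
        using gB[OF that] that by simp
    qed measurable
    then show ?thesis by (rule integrable_eq) auto
  qed
  have \<psi>t: "\<psi>t t = ct - integral {t..t1} ?g" for t by (simp add: \<psi>t_def)
  note 2 = backward_integral[OF gi gB MB \<psi>t]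
  obtain E1 E2 where E: "negligible E1" "negligible E2"
    "\<forall>t\<in>{t0..t1} - E1. (\<psi> has_vector_derivative ?h t (\<psi> t)) (at t within {t0..t1})"
    "\<forall>t\<in>{t0..t1} - E2. (\<psi>t has_vector_derivative ?g t) (at t within {t0..t1})"
    using 1(2) 2(2) by blast
  have "negligible (E1 \<union> E2)" using E by (intro negligible_Un)
  then have "adjoint_pair \<psi> \<psi>t"
    unfolding adjoint_pair_def using 1(1) 2(1) E(3,4) by (intro conjI exI[of _ "E1 \<union> E2"]) auto
  moreover have "\<psi> t1 = c" using \<psi>(2)[of t1] t0_less_t1 by simp
  moreover have "\<psi>t t1 = ct" by (simp add: \<psi>t_def)
  ultimately show thesis by (rule that)
qed

end

section \<open>The flow under a varied clock\<close>

type_synonym 'a flow_param = "(real \<times> 'a \<times> real) param"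

locale flow = reference f ft fx t0 t1 x u Rad Bu Mb + clock t0 t1 N \<theta>
  for f :: "real \<Rightarrow> 'a::euclidean_space \<Rightarrow> 'b::euclidean_space \<Rightarrow> 'a" and ft fx t0 t1 x u Rad Bu Mb N \<theta> +
  fixes v :: "nat \<Rightarrow> 'b"
  assumes v_bound: "\<And>i. i < N \<Longrightarrow> norm (v i) \<le> Bu"
begin

abbreviation dist_param :: "'a flow_param \<Rightarrow> 'a flow_param \<Rightarrow> real" where
  "dist_param \<equiv> param_dist N"

abbreviation dist0 :: "'a flow_param \<Rightarrow> real" where
  "dist0 p \<equiv> param_dist N p param_zero"

text \<open>A parameter \<open>((\<xi>, y, \<sigma>), \<rho>)\<close> shifts the initial time by \<open>\<xi>\<close> and the initial state by \<open>y\<close>, gives the clock \<open>tp\<close> the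
  speed \<open>1 + \<sigma>\<close> off the inserted intervals and \<open>\<rho> i\<close> on the \<open>i\<close>-th one. The clipping of the state makes the
  right-hand side globally Lipschitz and is inactive near the reference trajectory.\<close>

definition ut :: "real \<Rightarrow> 'b" where
  "ut \<tau> = vref \<tau> *\<^sub>R u (tref \<tau>) + (\<Sum>i<N. pulse (ons i) \<tau> *\<^sub>R v i)"

definition tp :: "'a flow_param \<Rightarrow> real \<Rightarrow> real" where
  "tp p \<tau> = t0 + fst (fst p) + (1 + snd (snd (fst p))) * (tref \<tau> - t0) + (\<Sum>i<N. snd p i * ramp (ons i) \<tau>)"

definition vp :: "'a flow_param \<Rightarrow> real \<Rightarrow> real" where
  "vp p \<tau> = (1 + snd (snd (fst p))) * vref \<tau> + (\<Sum>i<N. snd p i * pulse (ons i) \<tau>)"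

definition clip :: "'a \<Rightarrow> 'a" where "clip = closest_point (cball 0 Rad)"

text \<open>The integral form carries the initial value and needs no exceptional set.\<close>

definition is_sol :: "'a flow_param \<Rightarrow> (real \<Rightarrow> 'a) \<Rightarrow> bool" where
  "is_sol p y \<longleftrightarrow> continuous_on {t0..fin} y \<and> (\<forall>\<tau>\<in>{t0..fin}.
     y \<tau> = x t0 + fst (snd (fst p)) + integral {t0..\<tau>} (\<lambda>s. vp p s *\<^sub>R f (tp p s) (clip (y s)) (ut s)))"

lemma flow_cases:
  obtains i where "i < N" "pulse (ons i) \<tau> = 1" "\<And>j. j < N \<Longrightarrow> j \<noteq> i \<Longrightarrow> pulse (ons j) \<tau> = 0"
      "vref \<tau> = 0" "tref \<tau> = \<theta> i" "ut \<tau> = v i" "\<And>p. vp p \<tau> = snd p i"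
  | "\<And>j. j < N \<Longrightarrow> pulse (ons j) \<tau> = 0" "vref \<tau> = 1" "ut \<tau> = u (tref \<tau>)" "\<And>p. vp p \<tau> = 1 + snd (snd (fst p))"
proof (cases \<tau> rule: pulse_cases)
  case (1 i)
  have eq: "pulse (ons j) \<tau> = of_bool (j = i)" if "j < N" for j using 1 that by auto
  have "(\<Sum>j<N. pulse (ons j) \<tau> *\<^sub>R v j) = (\<Sum>j<N. of_bool (j = i) *\<^sub>R v j)"
    by (intro sum.cong) (auto simp: eq)
  also have "\<dots> = (\<Sum>j<N. if j = i then v i else 0)" by (intro sum.cong) auto
  also have "\<dots> = v i" using 1 by simp
  finally have "ut \<tau> = v i" using 1 by (simp add: ut_def)
  moreover have "vp p \<tau> = snd p i" for p
  proof -
    have "(\<Sum>j<N. snd p j * pulse (ons j) \<tau>) = (\<Sum>j<N. if j = i then snd p i else 0)"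
      by (intro sum.cong) (auto simp: eq)
    then show ?thesis using 1 by (simp add: vp_def)
  qed
  ultimately show thesis using that(1) 1 by blast
next
  case (2 k)
  then show thesis using that(2) by (simp add: ut_def vp_def)
qed

lemma ut_bound: "norm (ut \<tau>) \<le> Bu"
  by (cases \<tau> rule: flow_cases) (auto simp: u_bound v_bound)

lemma ut_measurable [measurable]: "ut \<in> borel_measurable borel"
  unfolding ut_def[abs_def] by measurable

lemma vp_measurable [measurable]: "vp p \<in> borel_measurable borel"
  unfolding vp_def[abs_def] by measurable

lemma ramp_measurable [measurable]: "ramp c \<in> borel_measurable borel"
  unfolding ramp_def[abs_def] by measurable

lemma tp_measurable [measurable]: "tp p \<in> borel_measurable borel"
  unfolding tp_def[abs_def] by measurable

lemma tp_zero: "tp param_zero = tref"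
  by (auto simp: tp_def fun_eq_iff)

lemma vp_zero: "vp param_zero = vref"
  by (auto simp: vp_def fun_eq_iff)

lemma param_components:
  "\<bar>fst (fst p) - fst (fst q)\<bar> \<le> norm (fst p - fst q)"
  "norm (fst (snd (fst p)) - fst (snd (fst q))) \<le> norm (fst p - fst q)"
  "\<bar>snd (snd (fst p)) - snd (snd (fst q))\<bar> \<le> norm (fst p - fst q)" for p q :: "'a flow_param"
proof -
  let ?A = "fst p - fst q"
  have 1: "norm (fst ?A) \<le> norm ?A" "norm (snd ?A) \<le> norm ?A"
    using norm_fst_le[of "fst ?A" "snd ?A"] norm_snd_le[of "snd ?A" "fst ?A"] by (simp_all only: prod.collapse)
  have 2: "norm (fst (snd ?A)) \<le> norm (snd ?A)" "norm (snd (snd ?A)) \<le> norm (snd ?A)"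
    using norm_fst_le[of "fst (snd ?A)" "snd (snd ?A)"] norm_snd_le[of "snd (snd ?A)" "fst (snd ?A)"] by (simp_all only: prod.collapse)
  show "\<bar>fst (fst p) - fst (fst q)\<bar> \<le> norm ?A" using 1(1) by simp
  show "norm (fst (snd (fst p)) - fst (snd (fst q))) \<le> norm ?A" using order_trans[OF 2(1) 1(2)] by simp
  show "\<bar>snd (snd (fst p)) - snd (snd (fst q))\<bar> \<le> norm ?A" using order_trans[OF 2(2) 1(2)] by simp
qed

text \<open>The origin of \<open>Ct\<close>: the shift of the initial time counts once, the change
  of speed acts for the time \<open>t1 - t0\<close>, and ramps are at most \<open>1\<close>.\<close>

lemma tp_diff:
  assumes "\<tau> \<in> {t0..fin}"
  shows "\<bar>tp p \<tau> - tp q \<tau>\<bar> \<le> Ct * dist_param p q"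
proof -
  define e where "e = norm (fst p - fst q)"
  define S where "S = (\<Sum>i<N. \<bar>snd p i - snd q i\<bar>)"
  have S0: "S \<ge> 0" unfolding S_def by (intro sum_nonneg) auto
  have th: "0 \<le> tref \<tau> - t0" "tref \<tau> - t0 \<le> t1 - t0" using tref_range[OF assms] by auto
  have "tp p \<tau> - tp q \<tau> = (fst (fst p) - fst (fst q)) + (snd (snd (fst p)) - snd (snd (fst q))) * (tref \<tau> - t0)
      + (\<Sum>i<N. (snd p i - snd q i) * ramp (ons i) \<tau>)"
    by (simp add: tp_def algebra_simps sum_subtractf)
  moreover have "\<bar>(snd (snd (fst p)) - snd (snd (fst q))) * (tref \<tau> - t0)\<bar> \<le> e * (t1 - t0)"
    unfolding abs_mult e_def using th by (intro mult_mono param_components(3)) auto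
  moreover have "\<bar>\<Sum>i<N. (snd p i - snd q i) * ramp (ons i) \<tau>\<bar> \<le> S"
    unfolding S_def
  proof (rule order_trans[OF sum_abs sum_mono])
    fix i
    show "\<bar>(snd p i - snd q i) * ramp (ons i) \<tau>\<bar> \<le> \<bar>snd p i - snd q i\<bar>"
      using ramp_bounds[of "ons i" \<tau>] mult_left_mono[of "ramp (ons i) \<tau>" 1 "\<bar>snd p i - snd q i\<bar>"] by (simp add: abs_mult)
  qed
  ultimately have "\<bar>tp p \<tau> - tp q \<tau>\<bar> \<le> e + e * (t1 - t0) + S"
    using param_components(1)[of p q] unfolding e_def by linarith
  also have "\<dots> \<le> e + e * (t1 - t0) + Ct * S" using S0 Ct_ge_1 mult_right_mono[of 1 Ct S] by simp
  also have "\<dots> = Ct * dist_param p q" by (simp add: param_dist_def e_def S_def Ct_def algebra_simps)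
  finally show ?thesis .
qed

lemma vp_diff: "\<bar>vp p \<tau> - vp q \<tau>\<bar> \<le> dist_param p q"
proof (cases \<tau> rule: flow_cases)
  case (1 i)
  then have "\<bar>snd p i - snd q i\<bar> \<le> (\<Sum>i<N. \<bar>snd p i - snd q i\<bar>)" by (intro member_le_sum) auto
  then show ?thesis using 1 by (simp add: param_dist_def) (smt (verit) norm_ge_zero)
next
  case 2
  have S: "0 \<le> (\<Sum>i<N. \<bar>snd p i - snd q i\<bar>)" by (intro sum_nonneg) auto
  have "\<bar>vp p \<tau> - vp q \<tau>\<bar> \<le> norm (fst p - fst q)" using 2 param_components(3)[of p q] by simp
  then show ?thesis using S unfolding param_dist_def by linarith
qed

lemma vp_le_2: "dist0 p \<le> 1 \<Longrightarrow> \<bar>vp p \<tau>\<bar> \<le> 2"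
  using vp_diff[of p \<tau> param_zero] vref_bounds[of \<tau>] by (simp add: vp_zero)

lemma clip_lipschitz: "norm (clip y - clip z) \<le> norm (y - z)"
  unfolding clip_def using Rad_pos by (intro lipschitz_on_closest_point_cball) auto

lemma clip_bound: "norm (clip y) \<le> Rad"
proof -
  have "clip y \<in> cball 0 Rad" unfolding clip_def using Rad_pos by (intro closest_point_in_set) auto
  then show ?thesis by simp
qed

lemma clip_id: "norm y \<le> Rad \<Longrightarrow> clip y = y"
  unfolding clip_def by (intro closest_point_self) auto

lemma clip_continuous: "continuous_on UNIV clip"
  unfolding clip_def using Rad_pos by (intro continuous_on_closest_point) auto

lemma in_Box:
  assumes "dist0 p \<le> 1" "\<tau> \<in> {t0..fin}"
  shows "(tp p \<tau>, clip y, ut \<tau>) \<in> Box"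
proof -
  have "\<bar>tp p \<tau> - tref \<tau>\<bar> \<le> Ct * dist0 p" using tp_diff[OF assms(2), of p param_zero] by (simp add: tp_zero)
  also have "\<dots> \<le> Ct" using assms(1) Ct_ge_1 mult_left_mono[of "dist0 p" 1 Ct] by simp
  finally show ?thesis using tref_range[OF assms(2)] by (auto simp: Box_iff clip_bound ut_bound)
qed

lemma rhs_bound:
  assumes "dist0 p \<le> 1" "\<tau> \<in> {t0..fin}"
  shows "norm (vp p \<tau> *\<^sub>R f (tp p \<tau>) (clip y) (ut \<tau>)) \<le> 2 * Mb"
  unfolding norm_scaleR using Box_bounds(1)[OF in_Box[OF assms]] vp_le_2[OF assms(1)] by (intro mult_mono) auto

lemma rhs_integrable:
  assumes "dist0 p \<le> 1" and y: "continuous_on {t0..fin} y"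
  shows "(\<lambda>s. vp p s *\<^sub>R f (tp p s) (clip (y s)) (ut s)) integrable_on {t0..fin}"
proof -
  have "continuous_on UNIV (\<lambda>s. y (max t0 (min fin s)))"
    using t0_fin by (intro continuous_on_compose2[OF y] continuous_intros) auto
  then have "continuous_on UNIV (\<lambda>s. clip (y (max t0 (min fin s))))"
    by (rule continuous_on_compose2[OF clip_continuous]) auto
  then have [measurable]: "(\<lambda>s. clip (y (max t0 (min fin s)))) \<in> borel_measurable borel"
    by (rule borel_measurable_continuous_onI)
  have "(\<lambda>s. vp p s *\<^sub>R f (tp p s) (clip (y (max t0 (min fin s)))) (ut s)) integrable_on {t0..fin}"
    by (rule bounded_borel_integrable_on[OF _ rhs_bound[OF assms(1)]]) measurable
  then show ?thesis by (rule integrable_eq) auto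
qed

lemma rhs_lipschitz:
  assumes "dist0 p \<le> 1" "\<tau> \<in> {t0..fin}"
  shows "norm (vp p \<tau> *\<^sub>R f (tp p \<tau>) (clip y) (ut \<tau>) - vp p \<tau> *\<^sub>R f (tp p \<tau>) (clip z) (ut \<tau>)) \<le> 2 * Mb * norm (y - z)"
proof -
  have "norm (f (tp p \<tau>) (clip y) (ut \<tau>) - f (tp p \<tau>) (clip z) (ut \<tau>)) \<le> Mb * norm (clip y - clip z)"
    using in_Box[OF assms] Box_bounds(3) unfolding Box_def by (intro f_lipschitz_x) auto
  also have "\<dots> \<le> Mb * norm (y - z)" using Mb_pos clip_lipschitz by (intro mult_left_mono) auto
  finally have "\<bar>vp p \<tau>\<bar> * norm (f (tp p \<tau>) (clip y) (ut \<tau>) - f (tp p \<tau>) (clip z) (ut \<tau>)) \<le> 2 * (Mb * norm (y - z))"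
    using vp_le_2[OF assms(1)] by (intro mult_mono) auto
  then show ?thesis by (simp flip: scaleR_diff_right)
qed

lemma sol_exists: "dist0 p \<le> 1 \<Longrightarrow> \<exists>y. is_sol p y"
  unfolding is_sol_def
  by (rule integral_equation_exists[of t0 fin "\<lambda>s y. vp p s *\<^sub>R f (tp p s) (clip y) (ut s)" "2 * Mb" "x t0 + fst (snd (fst p))"])
    (use t0_fin rhs_lipschitz rhs_integrable in auto)

text \<open>Gronwall constant. The \<open>1\<close> is the change of the initial state,
  \<open>Mb\<close> the change of speed, \<open>2 * Mb * Ct\<close> the change of the clock inside
  \<open>f\<close>. Speeds are at most \<open>2\<close>, whence the exponent.\<close>

definition Cy :: real where
  "Cy = (1 + (Mb + 2 * Mb * Ct) * (fin - t0)) * exp (2 * Mb * (fin - t0))"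

lemma Cy_pos: "Cy > 0"
  unfolding Cy_def using Mb_pos Ct_ge_1 t0_fin by (intro mult_pos_pos add_pos_nonneg) auto

lemma f_lipschitz_Box:
  assumes "(s, y, w) \<in> Box" "(t, z, w) \<in> Box"
  shows "norm (f s y w - f t z w) \<le> Mb * (norm (y - z) + \<bar>s - t\<bar>)"
proof -
  have m: "(s, z, w) \<in> Box" using assms by (auto simp: Box_iff)
  have "norm (f s y w - f s z w) \<le> Mb * norm (y - z)"
    using assms m Box_bounds(3) unfolding Box_def by (intro f_lipschitz_x) auto
  moreover have "norm (f s z w - f t z w) \<le> Mb * \<bar>s - t\<bar>"
    using assms m Box_bounds(2) unfolding Box_def by (intro f_lipschitz_t) auto
  moreover have "norm (f s y w - f t z w) \<le> norm (f s y w - f s z w) + norm (f s z w - f t z w)"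
    using norm_triangle_ineq[of "f s y w - f s z w" "f s z w - f t z w"] by simp
  ultimately show ?thesis by (simp add: distrib_left)
qed

lemma sol_diff:
  assumes p: "dist0 p \<le> 1" "is_sol p y" and q: "dist0 q \<le> 1" "is_sol q z" and \<tau>: "\<tau> \<in> {t0..fin}"
  shows "norm (y \<tau> - z \<tau>) \<le> Cy * dist_param p q"
proof -
  define d where "d = dist_param p q"
  have "d \<ge> 0" by (simp add: d_def)
  define K where "K = Mb + 2 * Mb * Ct"
  have "K \<ge> 0" using Mb_pos Ct_ge_1 by (simp add: K_def)
  let ?g = "\<lambda>p y s. vp p s *\<^sub>R f (tp p s) (clip (y s)) (ut s)"
  have cy: "continuous_on {t0..fin} y" and cz: "continuous_on {t0..fin} z" using p q by (auto simp: is_sol_def)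
  have g_diff: "norm (?g p y s - ?g q z s) \<le> K * d + 2 * Mb * norm (y s - z s)" if s: "s \<in> {t0..fin}" for s
  proof -
    \<comment> \<open>One factor changes at a time: first the speed, then the arguments of
      \<open>f\<close>.\<close>
    have "?g p y s - ?g q z s = (vp p s - vp q s) *\<^sub>R f (tp p s) (clip (y s)) (ut s)
       + vp q s *\<^sub>R (f (tp p s) (clip (y s)) (ut s) - f (tp q s) (clip (z s)) (ut s))"
      by (simp add: algebra_simps)
    then have "norm (?g p y s - ?g q z s) \<le> \<bar>vp p s - vp q s\<bar> * norm (f (tp p s) (clip (y s)) (ut s))
       + \<bar>vp q s\<bar> * norm (f (tp p s) (clip (y s)) (ut s) - f (tp q s) (clip (z s)) (ut s))"
      by (metis norm_scaleR norm_triangle_ineq real_norm_def)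
    also have "\<dots> \<le> d * Mb + 2 * (Mb * (norm (clip (y s) - clip (z s)) + \<bar>tp p s - tp q s\<bar>))"
      using vp_diff[of p s q] vp_le_2[OF q(1)] \<open>d \<ge> 0\<close>
      by (intro add_mono mult_mono Box_bounds(1) f_lipschitz_Box in_Box s p q) (auto simp: d_def)
    also have "\<dots> \<le> d * Mb + 2 * (Mb * (norm (y s - z s) + Ct * d))"
      using tp_diff[OF s, of p q] clip_lipschitz Mb_pos unfolding d_def
      by (intro add_left_mono mult_left_mono add_mono) auto
    also have "\<dots> = K * d + 2 * Mb * norm (y s - z s)" by (simp add: K_def algebra_simps)
    finally show ?thesis .
  qed
  have "norm (y \<tau> - z \<tau>) \<le> (d + K * d * (fin - t0)) * exp (2 * Mb * (\<tau> - t0))"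
  proof (rule gronwall[where b = fin])
    show "continuous_on {t0..fin} (\<lambda>s. norm (y s - z s))" using cy cz by (intro continuous_intros)
    fix t assume t: "t \<in> {t0..fin}"
    have gi: "?g p y integrable_on {t0..t}" "?g q z integrable_on {t0..t}"
      using rhs_integrable[OF p(1) cy] rhs_integrable[OF q(1) cz] t by (auto elim!: integrable_on_subinterval)
    have ni: "(\<lambda>s. norm (y s - z s)) integrable_on {t0..t}"
      using t by (intro integrable_continuous_interval continuous_intros continuous_on_subset[OF cy] continuous_on_subset[OF cz]) auto
    have "y t - z t = (fst (snd (fst p)) - fst (snd (fst q))) + (integral {t0..t} (?g p y) - integral {t0..t} (?g q z))"
      using p(2) q(2) t by (simp add: is_sol_def)
    also have "\<dots> = (fst (snd (fst p)) - fst (snd (fst q))) + integral {t0..t} (\<lambda>s. ?g p y s - ?g q z s)"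
      by (simp only: Henstock_Kurzweil_Integration.integral_diff[OF gi])
    finally have "norm (y t - z t) \<le> norm (fst (snd (fst p)) - fst (snd (fst q))) + norm (integral {t0..t} (\<lambda>s. ?g p y s - ?g q z s))"
      by (simp only: norm_triangle_ineq)
    also have "norm (fst (snd (fst p)) - fst (snd (fst q))) \<le> d"
      using param_components(2)[of p q] by (simp add: d_def param_dist_def add_increasing2 sum_nonneg)
    also have "norm (integral {t0..t} (\<lambda>s. ?g p y s - ?g q z s)) \<le> integral {t0..t} (\<lambda>s. K * d + 2 * Mb * norm (y s - z s))"
      using t g_diff ni by (intro integral_norm_bound_integral integrable_diff gi integrable_add integrable_on_mult_right) auto
    also have "\<dots> = K * d * (t - t0) + 2 * Mb * integral {t0..t} (\<lambda>s. norm (y s - z s))"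
      using t ni by (subst Henstock_Kurzweil_Integration.integral_add) (auto intro: integrable_on_mult_right)
    also have "\<dots> \<le> K * d * (fin - t0) + 2 * Mb * integral {t0..t} (\<lambda>s. norm (y s - z s))"
      using t \<open>K \<ge> 0\<close> \<open>d \<ge> 0\<close> by (intro add_right_mono mult_left_mono) auto
    finally show "norm (y t - z t) \<le> d + K * d * (fin - t0) + 2 * Mb * integral {t0..t} (\<lambda>s. norm (y s - z s))"
      by simp
  qed (use \<tau> Mb_pos in auto)
  also have "\<dots> \<le> (d + K * d * (fin - t0)) * exp (2 * Mb * (fin - t0))"
    using \<tau> Mb_pos \<open>K \<ge> 0\<close> \<open>d \<ge> 0\<close> t0_fin by (intro mult_left_mono) auto
  also have "\<dots> = Cy * d" by (simp add: Cy_def K_def algebra_simps)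
  finally show ?thesis by (simp add: d_def)
qed

lemma sol_t0: "is_sol p y \<Longrightarrow> y t0 = x t0 + fst (snd (fst p))"
  using t0_fin by (simp add: is_sol_def)

text \<open>Inserted intervals do not disturb the reference solution: there \<open>vref\<close> is
  \<open>0\<close>, so the foreign control value is multiplied by zero.\<close>

lemma ref_sol: "is_sol param_zero (\<lambda>\<tau>. x (tref \<tau>))"
  unfolding is_sol_def
proof (intro conjI ballI)
  obtain E where E: "negligible E" "\<And>t. t\<in>{t0..t1} - E \<Longrightarrow> (x has_vector_derivative f t (x t) (u t)) (at t within {t0..t1})"
    using x_deriv by blast
  note rep = reparametrization[OF x_lipschitz E]
  obtain E' where E': "negligible E'"
    "\<And>\<tau>. \<tau> \<in> {t0..fin} - E' \<Longrightarrow> ((\<lambda>\<tau>. x (tref \<tau>)) has_vector_derivative vref \<tau> *\<^sub>R f (tref \<tau>) (x (tref \<tau>)) (u (tref \<tau>))) (at \<tau> within {t0..fin})"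
    using rep(1) by blast
  show "continuous_on {t0..fin} (\<lambda>\<tau>. x (tref \<tau>))" using rep(2) by (rule lipschitz_on_continuous_on)
  fix \<tau> assume \<tau>: "\<tau> \<in> {t0..fin}"
  have "((\<lambda>\<tau>. vref \<tau> *\<^sub>R f (tref \<tau>) (x (tref \<tau>)) (u (tref \<tau>))) has_integral x (tref \<tau>) - x (tref t0)) {t0..\<tau>}"
  proof (rule fundamental_theorem_of_calculus_lipschitz[OF _ _ E'(1)])
    show "Mb-lipschitz_on {t0..\<tau>} (\<lambda>\<tau>. x (tref \<tau>))" using rep(2) by (rule lipschitz_on_subset) (use \<tau> in auto)
    show "((\<lambda>\<tau>. x (tref \<tau>)) has_vector_derivative vref t *\<^sub>R f (tref t) (x (tref t)) (u (tref t))) (at t within {t0..\<tau>})"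
      if "t \<in> {t0..\<tau>} - E'" for t
      using that \<tau> by (intro has_vector_derivative_within_subset[OF E'(2)]) auto
  qed (use \<tau> in auto)
  then have "((\<lambda>s. vp param_zero s *\<^sub>R f (tp param_zero s) (clip (x (tref s))) (ut s)) has_integral x (tref \<tau>) - x (tref t0)) {t0..\<tau>}"
  proof (rule has_integral_eq[rotated])
    fix s assume "s \<in> {t0..\<tau>}"
    then have "clip (x (tref s)) = x (tref s)"
      using x_Rad[OF tref_range[of s]] \<tau> by (intro clip_id) auto
    then show "vref s *\<^sub>R f (tref s) (x (tref s)) (u (tref s)) = vp param_zero s *\<^sub>R f (tp param_zero s) (clip (x (tref s))) (ut s)"
      by (cases s rule: flow_cases) (simp_all add: vp_zero tp_zero)
  qed
  then show "x (tref \<tau>) = x t0 + fst (snd (fst param_zero)) +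
     integral {t0..\<tau>} (\<lambda>s. vp param_zero s *\<^sub>R f (tp param_zero s) (clip (x (tref s))) (ut s))"
    by (simp add: integral_unique tref_t0)
qed

lemma dist0_zero: "dist0 param_zero = 0" by (simp add: param_dist_def)

lemma sol_near_ref:
  assumes "dist0 p \<le> 1" "is_sol p y" "\<tau> \<in> {t0..fin}"
  shows "norm (y \<tau> - x (tref \<tau>)) \<le> Cy * dist0 p"
  using sol_diff[OF assms(1,2) _ ref_sol assms(3)] by (simp add: dist0_zero)

text \<open>The margin \<open>1\<close> in \<open>Rad\<close> absorbs the deviation from the
  reference solution.\<close>

lemma sol_clip:
  assumes "dist0 p \<le> 1" "Cy * dist0 p \<le> 1" "is_sol p y" "\<tau> \<in> {t0..fin}"
  shows "clip (y \<tau>) = y \<tau>" "norm (y \<tau>) \<le> Rad"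
proof -
  have "norm (y \<tau>) \<le> norm (x (tref \<tau>)) + norm (y \<tau> - x (tref \<tau>))" by (rule norm_triangle_sub)
  also have "\<dots> \<le> Rad" using sol_near_ref[OF assms(1,3,4)] assms(2) x_Rad[OF tref_range[OF assms(4)]] by linarith
  finally show "norm (y \<tau>) \<le> Rad" .
  then show "clip (y \<tau>) = y \<tau>" by (rule clip_id)
qed

lemma sol_lipschitz_deriv:
  assumes p: "dist0 p \<le> 1" and y: "is_sol p y"
  shows "(2 * Mb)-lipschitz_on {t0..fin} y"
    "\<exists>E. negligible E \<and> (\<forall>\<tau>\<in>{t0..fin} - E. (y has_vector_derivative vp p \<tau> *\<^sub>R f (tp p \<tau>) (clip (y \<tau>)) (ut \<tau>)) (at \<tau> within {t0..fin}))"
proof -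
  let ?g = "\<lambda>s. vp p s *\<^sub>R f (tp p s) (clip (y s)) (ut s)"
  have i: "?g integrable_on {t0..fin}" using y by (intro rhs_integrable p) (simp add: is_sol_def)
  have y': "y t = (x t0 + fst (snd (fst p))) + integral {t0..t} ?g" if "t \<in> {t0..fin}" for t
    using y that by (simp add: is_sol_def)
  have "0 \<le> 2 * Mb" using Mb_pos by simp
  note * = integral_equation_regular[OF i rhs_bound[OF p] this y']
  show "(2 * Mb)-lipschitz_on {t0..fin} y" by (rule *)
  show "\<exists>E. negligible E \<and> (\<forall>\<tau>\<in>{t0..fin} - E. (y has_vector_derivative ?g \<tau>) (at \<tau> within {t0..fin}))" by (rule *)
qed

lemma tp_has_derivative:
  assumes "\<tau> \<notin> breaks"
  shows "(tp p has_vector_derivative vp p \<tau>) (at \<tau> within S)"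
proof -
  have "((\<lambda>\<tau>. t0 + fst (fst p) + (1 + snd (snd (fst p))) * (tref \<tau> - t0) + (\<Sum>i<N. snd p i * ramp (ons i) \<tau>))
     has_vector_derivative (0 + (1 + snd (snd (fst p))) * (vref \<tau> - 0) + (\<Sum>i<N. snd p i * pulse (ons i) \<tau>))) (at \<tau> within S)"
    using assms
    by (intro has_vector_derivative_add has_vector_derivative_sum has_vector_derivative_mult_right has_vector_derivative_diff
        has_vector_derivative_const tref_has_derivative ramp_has_derivative') auto
  then show ?thesis by (simp add: tp_def[abs_def] vp_def)
qed

lemma tp_lipschitz: "(\<bar>1 + snd (snd (fst p))\<bar> + (\<Sum>i<N. \<bar>snd p i\<bar>))-lipschitz_on S (tp p)"
proof (rule lipschitz_onI)
  fix s t
  have "tp p s - tp p t = (1 + snd (snd (fst p))) * (tref s - tref t) + (\<Sum>i<N. snd p i * (ramp (ons i) s - ramp (ons i) t))"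
    by (simp add: tp_def algebra_simps sum_subtractf)
  also have "\<bar>\<dots>\<bar> \<le> \<bar>1 + snd (snd (fst p))\<bar> * \<bar>tref s - tref t\<bar> + (\<Sum>i<N. \<bar>snd p i\<bar> * \<bar>ramp (ons i) s - ramp (ons i) t\<bar>)"
    by (intro order_trans[OF abs_triangle_ineq] add_mono order_trans[OF sum_abs]) (simp_all add: abs_mult)
  also have "\<dots> \<le> \<bar>1 + snd (snd (fst p))\<bar> * \<bar>s - t\<bar> + (\<Sum>i<N. \<bar>snd p i\<bar> * \<bar>s - t\<bar>)"
    by (intro add_mono sum_mono mult_left_mono tref_lipschitz ramp_lipschitz) auto
  finally show "dist (tp p s) (tp p t) \<le> (\<bar>1 + snd (snd (fst p))\<bar> + (\<Sum>i<N. \<bar>snd p i\<bar>)) * dist s t"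
    by (simp add: dist_real_def distrib_right sum_distrib_right)
qed (auto intro!: add_nonneg_nonneg sum_nonneg)

end

section \<open>Closure properties of Lipschitz functions\<close>

abbreviation lipschitz_some :: "real set \<Rightarrow> (real \<Rightarrow> 'a::real_normed_vector) \<Rightarrow> bool" where
  "lipschitz_some S g \<equiv> \<exists>L. L-lipschitz_on S g"

lemma lipschitz_some_add: "lipschitz_some S g \<Longrightarrow> lipschitz_some S h \<Longrightarrow> lipschitz_some S (\<lambda>t. g t + h t)"
  using lipschitz_on_add by blast

lemma lipschitz_some_diff: "lipschitz_some S g \<Longrightarrow> lipschitz_some S h \<Longrightarrow> lipschitz_some S (\<lambda>t. g t - h t)"
  using lipschitz_on_diff by blast

lemma lipschitz_some_inner:
  fixes g h :: "real \<Rightarrow> 'a::euclidean_space"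
  shows "lipschitz_some {a..b} g \<Longrightarrow> lipschitz_some {a..b} h \<Longrightarrow> lipschitz_some {a..b} (\<lambda>t. g t \<bullet> h t)"
  using lipschitz_on_inner by metis

lemma lipschitz_some_const: "lipschitz_some S (\<lambda>_. c)"
  using lipschitz_on_constant by blast

lemma lipschitz_some_mult:
  fixes g h :: "real \<Rightarrow> real"
  shows "lipschitz_some {a..b} g \<Longrightarrow> lipschitz_some {a..b} h \<Longrightarrow> lipschitz_some {a..b} (\<lambda>t. g t * h t)"
  using lipschitz_some_inner[of a b g h] by simp

lemma lipschitz_some_sum:
  "(\<And>i. i \<in> I \<Longrightarrow> lipschitz_some S (g i)) \<Longrightarrow> lipschitz_some S (\<lambda>t. \<Sum>i\<in>I. g i t)"
  by (induction I rule: infinite_finite_induct) (simp_all add: lipschitz_some_const lipschitz_some_add)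

section \<open>The function \<open>H + \<psi>\<^sub>t\<close> along the reference state\<close>

context reference begin

definition ham :: "(real \<Rightarrow> 'a) \<Rightarrow> (real \<Rightarrow> real) \<Rightarrow> real \<Rightarrow> 'b \<Rightarrow> real" where
  "ham \<psi> \<psi>t t w = \<psi> t \<bullet> f t (x t) w + \<psi>t t"

lemma ham_integral:
  assumes adj: "adjoint_pair \<psi> \<psi>t"
  shows "(\<lambda>s. ham \<psi> \<psi>t s (u s)) integrable_on {t0..t1}"
    "lipschitz_some {t0..t1} (\<lambda>t. integral {t0..t} (\<lambda>s. ham \<psi> \<psi>t s (u s)))"
proof -
  have c: "continuous_on {t0..t1} \<psi>" "continuous_on {t0..t1} \<psi>t"
    using adj unfolding adjoint_pair_def by (meson lipschitz_on_continuous_on)+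
  obtain B where B: "\<And>t. t \<in> {t0..t1} \<Longrightarrow> norm (\<psi> t) \<le> B"
    using compact_imp_bounded[OF compact_continuous_image[OF c(1)]] unfolding bounded_iff by (meson compact_Icc imageI)
  obtain B' where B': "\<And>t. t \<in> {t0..t1} \<Longrightarrow> norm (\<psi>t t) \<le> B'"
    using compact_imp_bounded[OF compact_continuous_image[OF c(2)]] unfolding bounded_iff by (meson compact_Icc imageI)
  have "B \<ge> 0" "B' \<ge> 0" using B[of t0] B'[of t0] t0_less_t1 norm_ge_zero by (meson atLeastAtMost_iff less_imp_le order_refl order_trans)+
  have b: "norm (ham \<psi> \<psi>t t (u t)) \<le> B * Mb + B'" if "t \<in> {t0..t1}" for t
  proof -
    have "norm (ham \<psi> \<psi>t t (u t)) \<le> \<bar>\<psi> t \<bullet> f t (x t) (u t)\<bar> + \<bar>\<psi>t t\<bar>" by (simp add: ham_def abs_triangle_ineq)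
    also have "\<bar>\<psi> t \<bullet> f t (x t) (u t)\<bar> \<le> norm (\<psi> t) * norm (f t (x t) (u t))" by (rule Cauchy_Schwarz_ineq2)
    also have "\<dots> \<le> B * Mb"
      using \<open>B \<ge> 0\<close> by (intro mult_mono B that Box_bounds(1) ref_in_Box u_bound) auto
    finally show ?thesis using B'[OF that] by simp
  qed
  have [measurable]: "(\<lambda>s. \<psi> (max t0 (min t1 s))) \<in> borel_measurable borel" "(\<lambda>s. \<psi>t (max t0 (min t1 s))) \<in> borel_measurable borel"
    using t0_less_t1
    by (auto intro!: borel_measurable_continuous_onI continuous_on_compose2[OF c(1)] continuous_on_compose2[OF c(2)] continuous_intros)
  have "(\<lambda>s. \<psi> (max t0 (min t1 s)) \<bullet> f s (x s) (u s) + \<psi>t (max t0 (min t1 s))) integrable_on {t0..t1}"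
  proof (rule bounded_borel_integrable_on)
    show "norm (\<psi> (max t0 (min t1 t)) \<bullet> f t (x t) (u t) + \<psi>t (max t0 (min t1 t))) \<le> B * Mb + B'" if "t \<in> {t0..t1}" for t
      using b[OF that] that by (simp add: ham_def)
  qed measurable
  then show i: "(\<lambda>s. ham \<psi> \<psi>t s (u s)) integrable_on {t0..t1}"
    by (rule integrable_eq) (auto simp: ham_def)
  have "B * Mb + B' \<ge> 0" using \<open>B \<ge> 0\<close> \<open>B' \<ge> 0\<close> Mb_pos by simp
  from lipschitz_on_integral[OF i b this, of 0] show "lipschitz_some {t0..t1} (\<lambda>t. integral {t0..t} (\<lambda>s. ham \<psi> \<psi>t s (u s)))"
    by auto
qed

end

context flow begin

lemma pulse_sum:
  assumes "i < N" "pulse (ons i) \<tau> = 1" "\<And>j. j < N \<Longrightarrow> j \<noteq> i \<Longrightarrow> pulse (ons j) \<tau> = 0"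
  shows "(\<Sum>j<N. a j * pulse (ons j) \<tau>) = a i"
proof -
  have "(\<Sum>j<N. a j * pulse (ons j) \<tau>) = (\<Sum>j<N. if j = i then a i else 0)"
    using assms by (intro sum.cong) auto
  then show ?thesis using assms(1) by simp
qed

lemma tp_t0: "tp p t0 = t0 + fst (fst p)"
  by (simp add: tp_def tref_t0 ramp_t0)

text \<open>The function \<open>Z\<close> below has derivative \<open>\<phi> \<bullet> err\<close>: the adjoint equations cancel all terms that are linear in the
  difference of two solutions and of their clocks.\<close>

lemma flow_strict:
  assumes adj: "adjoint_pair \<psi> \<psi>t" and Y: "\<And>p. dist0 p \<le> 1 \<Longrightarrow> is_sol p (Y p)"
  shows "strict_param_deriv N (\<lambda>p. \<psi> t1 \<bullet> Y p fin + \<psi>t t1 * tp p fin)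
     (\<psi>t t0, \<psi> t0, integral {t0..t1} (\<lambda>s. ham \<psi> \<psi>t s (u s))) (\<lambda>i. ham \<psi> \<psi>t (\<theta> i) (v i))"
  unfolding strict_param_deriv_def
proof (intro allI impI)
  fix \<epsilon> :: real assume "\<epsilon> > 0"
  obtain L1 L2 E0 where L: "L1-lipschitz_on {t0..t1} \<psi>" "L2-lipschitz_on {t0..t1} \<psi>t" and E0: "negligible E0"
    "\<And>t. t\<in>{t0..t1} - E0 \<Longrightarrow> (\<psi> has_vector_derivative - blinfun_adjoint (fx (t, x t, u t)) (\<psi> t)) (at t within {t0..t1})"
    "\<And>t. t\<in>{t0..t1} - E0 \<Longrightarrow> (\<psi>t has_vector_derivative - (\<psi> t \<bullet> ft (t, x t, u t))) (at t within {t0..t1})"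
    using adj unfolding adjoint_pair_def by blast
  \<comment> \<open>The asserted derivative in the speed of the clock is the integral of
    \<open>ham\<close>; this primitive records how it builds up along \<open>tref\<close>.\<close>
  define X where "X = (\<lambda>t. integral {t0..t} (\<lambda>s. ham \<psi> \<psi>t s (u s)))"
  obtain L3 where L3: "L3-lipschitz_on {t0..t1} X" using ham_integral(2)[OF adj] unfolding X_def by blast
  obtain E1 where E1: "negligible E1" "\<And>t. t\<in>{t0..t1} - E1 \<Longrightarrow> (X has_vector_derivative ham \<psi> \<psi>t t (u t)) (at t within {t0..t1})"
    using has_vector_derivative_indefinite_integral[OF ham_integral(1)[OF adj]] unfolding X_def by blast
  note rep1 = reparametrization[OF L(1) E0(1,2)]
  note rep2 = reparametrization[OF L(2) E0(1,3)]
  note rep3 = reparametrization[OF L3 E1]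
  define \<phi> where "\<phi> = (\<lambda>\<tau>. \<psi> (tref \<tau>))"
  define \<eta> where "\<eta> = (\<lambda>\<tau>. \<psi>t (tref \<tau>))"
  obtain F1 where F1: "negligible F1" "breaks \<subseteq> F1"
    "\<And>\<tau>. \<tau> \<in> {t0..fin} - F1 \<Longrightarrow> (\<phi> has_vector_derivative vref \<tau> *\<^sub>R - blinfun_adjoint (fx (tref \<tau>, x (tref \<tau>), u (tref \<tau>))) (\<phi> \<tau>)) (at \<tau> within {t0..fin})"
    using rep1(1) unfolding \<phi>_def by blast
  obtain F2 where F2: "negligible F2"
    "\<And>\<tau>. \<tau> \<in> {t0..fin} - F2 \<Longrightarrow> (\<eta> has_vector_derivative vref \<tau> *\<^sub>R - (\<phi> \<tau> \<bullet> ft (tref \<tau>, x (tref \<tau>), u (tref \<tau>)))) (at \<tau> within {t0..fin})"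
    using rep2(1) unfolding \<eta>_def \<phi>_def by blast
  obtain F3 where F3: "negligible F3"
    "\<And>\<tau>. \<tau> \<in> {t0..fin} - F3 \<Longrightarrow> ((\<lambda>\<tau>. X (tref \<tau>)) has_vector_derivative vref \<tau> *\<^sub>R ham \<psi> \<psi>t (tref \<tau>) (u (tref \<tau>))) (at \<tau> within {t0..fin})"
    using rep3(1) by blast
  have "compact (\<psi> ` {t0..t1})" by (intro compact_continuous_image lipschitz_on_continuous_on[OF L(1)]) auto
  then obtain B where B: "B > 0" "\<And>t. t \<in> {t0..t1} \<Longrightarrow> norm (\<psi> t) \<le> B"
    using compact_imp_bounded[of "\<psi> ` {t0..t1}"] unfolding bounded_pos by (meson imageI)
  \<comment> \<open>\<open>Cz\<close> bounds the joint change of state and clock; \<open>Ce\<close>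
    collects the three error terms estimated below.\<close>
  define Cz where "Cz = Cy + Ct"
  have Cz: "Cz > 0" using Cy_pos Ct_ge_1 by (simp add: Cz_def)
  define Ce where "Ce = 1 + 2 * Cz + Mb * Cz"
  have Ce: "Ce > 0" using Cz Mb_pos by (simp add: Ce_def add_pos_pos)
  \<comment> \<open>Chosen so that the error rate \<open>B * (e * Ce * d)\<close> over the length
    \<open>fin - t0\<close> adds up to \<open>\<epsilon> * d\<close>.\<close>
  define e where "e = \<epsilon> / (B * Ce * (fin - t0))"
  have e: "e > 0" using \<open>\<epsilon> > 0\<close> B Ce t0_fin by (simp add: e_def)
  obtain \<delta>1 where \<delta>1: "\<delta>1 > 0"
    "\<And>s t r x y z u. (s, x, u) \<in> Box \<Longrightarrow> (t, y, u) \<in> Box \<Longrightarrow> (r, z, u) \<in> Box \<Longrightarrow>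
      \<bar>s - r\<bar> < \<delta>1 \<Longrightarrow> \<bar>t - r\<bar> < \<delta>1 \<Longrightarrow> norm (x - z) < \<delta>1 \<Longrightarrow> norm (y - z) < \<delta>1 \<Longrightarrow>
      norm (f s x u - f t y u - (fx (r, z, u) (x - y) + (s - t) *\<^sub>R ft (r, z, u))) \<le> e * (norm (x - y) + \<bar>s - t\<bar>)"
    using f_strictly_differentiable[OF e, of "t0 - Ct" "t1 + Ct" Rad Bu] unfolding Box_def by blast
  \<comment> \<open>\<open>1\<close> and \<open>1 / Cy\<close> make the clipping inactive,
    \<open>\<delta>1 / Cz\<close> admits the strict estimate for \<open>f\<close>, and the last two
    entries keep \<open>f\<close> and the speed within \<open>e\<close> of the reference.\<close>
  define \<delta> where "\<delta> = Min {1, 1 / Cy, \<delta>1 / Cz, e / (Mb * Cz), e}"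
  have \<delta>: "\<delta> > 0" "\<delta> \<le> 1" "\<delta> \<le> 1 / Cy" "\<delta> \<le> \<delta>1 / Cz" "\<delta> \<le> e / (Mb * Cz)" "\<delta> \<le> e"
    using e \<delta>1(1) Cz Cy_pos Mb_pos by (auto simp: \<delta>_def)
  have near: "dist0 p \<le> 1" "Cy * dist0 p \<le> 1" "Cz * dist0 p < \<delta>1" "Mb * (Cz * dist0 p) \<le> e" "dist0 p \<le> e"
    if "dist0 p < \<delta>" for p
  proof -
    show "dist0 p \<le> 1" "dist0 p \<le> e" using that \<delta> by linarith+
    have "dist0 p \<le> 1 / Cy" "dist0 p < \<delta>1 / Cz" "dist0 p \<le> e / (Mb * Cz)" using that \<delta> by linarith+
    then show "Cy * dist0 p \<le> 1" "Cz * dist0 p < \<delta>1" "Mb * (Cz * dist0 p) \<le> e"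
      using Cy_pos Cz Mb_pos by (simp_all add: pos_le_divide_eq pos_less_divide_eq mult_ac)
  qed
  show "\<exists>\<delta>>0. \<forall>p\<in>param_cone N. \<forall>q\<in>param_cone N. dist0 p < \<delta> \<longrightarrow> dist0 q < \<delta> \<longrightarrow>
     \<bar>\<psi> t1 \<bullet> Y p fin + \<psi>t t1 * tp p fin - (\<psi> t1 \<bullet> Y q fin + \<psi>t t1 * tp q fin) -
      param_deriv N (\<psi>t t0, \<psi> t0, integral {t0..t1} (\<lambda>s. ham \<psi> \<psi>t s (u s))) (\<lambda>i. ham \<psi> \<psi>t (\<theta> i) (v i)) p q\<bar>
     \<le> \<epsilon> * dist_param p q"
  proof (intro exI[of _ \<delta>] conjI ballI impI)
    fix p q assume "dist0 p < \<delta>" "dist0 q < \<delta>"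
    note np = near[OF \<open>dist0 p < \<delta>\<close>] and nq = near[OF \<open>dist0 q < \<delta>\<close>]
    note Yp = Y[OF np(1)] and Yq = Y[OF nq(1)]
    define d where "d = dist_param p q"
    have "d \<ge> 0" by (simp add: d_def)
    define z where "z = (\<lambda>\<tau>. Y p \<tau> - Y q \<tau>)"
    define w where "w = (\<lambda>\<tau>. tp p \<tau> - tp q \<tau>)"
    define \<Delta>\<sigma> where "\<Delta>\<sigma> = snd (snd (fst p)) - snd (snd (fst q))"
    define \<Delta>\<rho> where "\<Delta>\<rho> = (\<lambda>i. snd p i - snd q i)"
    define H where "H = (\<lambda>i. ham \<psi> \<psi>t (\<theta> i) (v i))"
    \<comment> \<open>The subtracted bracket is the part of the asserted derivative that the speeds
      have produced up to \<open>\<tau>\<close>; the initial data enter through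
      \<open>Z t0\<close>.\<close>
    define Z where "Z = (\<lambda>\<tau>. \<phi> \<tau> \<bullet> z \<tau> + \<eta> \<tau> * w \<tau> - (\<Delta>\<sigma> * X (tref \<tau>) + (\<Sum>i<N. \<Delta>\<rho> i * H i * ramp (ons i) \<tau>)))"
    have zw: "norm (z \<tau>) + \<bar>w \<tau>\<bar> \<le> Cz * d" if "\<tau> \<in> {t0..fin}" for \<tau>
      using sol_diff[OF np(1) Yp nq(1) Yq that] tp_diff[OF that, of p q] by (simp add: z_def w_def Cz_def d_def algebra_simps)
    have lip_ramp: "lipschitz_some {t0..fin} (ramp c)" for c
      by (intro exI[of _ 1] lipschitz_onI) (auto simp: dist_real_def ramp_lipschitz)
    have lip_z: "lipschitz_some {t0..fin} z"
      unfolding z_def using sol_lipschitz_deriv(1)[OF np(1) Yp] sol_lipschitz_deriv(1)[OF nq(1) Yq]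
      by (intro lipschitz_some_diff exI)
    have lip_w: "lipschitz_some {t0..fin} w"
      unfolding w_def using tp_lipschitz by (intro lipschitz_some_diff) blast+
    have "lipschitz_some {t0..fin} Z"
      unfolding Z_def \<phi>_def \<eta>_def
      by (intro lipschitz_some_diff lipschitz_some_add lipschitz_some_inner lipschitz_some_mult lipschitz_some_sum
          lipschitz_some_const lip_ramp lip_z lip_w exI[of "\<lambda>L. L-lipschitz_on {t0..fin} _", OF rep1(2)]
          exI[of "\<lambda>L. L-lipschitz_on {t0..fin} _", OF rep2(2)] exI[of "\<lambda>L. L-lipschitz_on {t0..fin} _", OF rep3(2)])
    then obtain K where K: "K-lipschitz_on {t0..fin} Z" ..
    obtain Ep where Ep: "negligible Ep" "\<And>\<tau>. \<tau> \<in> {t0..fin} - Ep \<Longrightarrow>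
        (Y p has_vector_derivative vp p \<tau> *\<^sub>R f (tp p \<tau>) (clip (Y p \<tau>)) (ut \<tau>)) (at \<tau> within {t0..fin})"
      using sol_lipschitz_deriv(2)[OF np(1) Yp] by blast
    obtain Eq where Eq: "negligible Eq" "\<And>\<tau>. \<tau> \<in> {t0..fin} - Eq \<Longrightarrow>
        (Y q has_vector_derivative vp q \<tau> *\<^sub>R f (tp q \<tau>) (clip (Y q \<tau>)) (ut \<tau>)) (at \<tau> within {t0..fin})"
      using sol_lipschitz_deriv(2)[OF nq(1) Yq] by blast
    \<comment> \<open>The difference of the two right-hand sides minus its linearization at the
      reference in speed, state and clock.\<close>
    define err where "err = (\<lambda>\<tau>. vp p \<tau> *\<^sub>R f (tp p \<tau>) (clip (Y p \<tau>)) (ut \<tau>) - vp q \<tau> *\<^sub>R f (tp q \<tau>) (clip (Y q \<tau>)) (ut \<tau>)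
       - (vp p \<tau> - vp q \<tau>) *\<^sub>R f (tref \<tau>) (x (tref \<tau>)) (ut \<tau>)
       - vref \<tau> *\<^sub>R (fx (tref \<tau>, x (tref \<tau>), ut \<tau>) (z \<tau>) + w \<tau> *\<^sub>R ft (tref \<tau>, x (tref \<tau>), ut \<tau>)))"
    define NE where "NE = F1 \<union> F2 \<union> F3 \<union> Ep \<union> Eq"
    have NE: "negligible NE" unfolding NE_def using F1(1) F2(1) F3(1) Ep(1) Eq(1) by (intro negligible_Un)
    have dZ: "(Z has_vector_derivative \<phi> \<tau> \<bullet> err \<tau>) (at \<tau> within {t0..fin})" if \<tau>: "\<tau> \<in> {t0..fin} - NE" for \<tau>
    proof -
      have nb: "\<tau> \<notin> breaks" using \<tau> F1(2) by (auto simp: NE_def)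
      define zp where "zp = vp p \<tau> *\<^sub>R f (tp p \<tau>) (clip (Y p \<tau>)) (ut \<tau>) - vp q \<tau> *\<^sub>R f (tp q \<tau>) (clip (Y q \<tau>)) (ut \<tau>)"
      have dz: "(z has_vector_derivative zp) (at \<tau> within {t0..fin})"
        unfolding z_def zp_def using \<tau> by (intro has_vector_derivative_diff Ep(2) Eq(2)) (auto simp: NE_def)
      have dw: "(w has_vector_derivative vp p \<tau> - vp q \<tau>) (at \<tau> within {t0..fin})"
        unfolding w_def by (intro has_vector_derivative_diff tp_has_derivative nb)
      let ?A = "fx (tref \<tau>, x (tref \<tau>), u (tref \<tau>))" and ?F = "ft (tref \<tau>, x (tref \<tau>), u (tref \<tau>))"
      have d\<phi>: "(\<phi> has_vector_derivative vref \<tau> *\<^sub>R - blinfun_adjoint ?A (\<phi> \<tau>)) (at \<tau> within {t0..fin})"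
        using \<tau> by (intro F1(3)) (auto simp: NE_def)
      have d\<eta>: "(\<eta> has_vector_derivative vref \<tau> *\<^sub>R - (\<phi> \<tau> \<bullet> ?F)) (at \<tau> within {t0..fin})"
        using \<tau> by (intro F2(2)) (auto simp: NE_def)
      have dX: "((\<lambda>\<tau>. X (tref \<tau>)) has_vector_derivative vref \<tau> *\<^sub>R ham \<psi> \<psi>t (tref \<tau>) (u (tref \<tau>))) (at \<tau> within {t0..fin})"
        using \<tau> by (intro F3(2)) (auto simp: NE_def)
      have "(Z has_vector_derivative (\<phi> \<tau> \<bullet> zp + (vref \<tau> *\<^sub>R - blinfun_adjoint ?A (\<phi> \<tau>)) \<bullet> z \<tau>)
         + (\<eta> \<tau> * (vp p \<tau> - vp q \<tau>) + (vref \<tau> *\<^sub>R - (\<phi> \<tau> \<bullet> ?F)) * w \<tau>)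
         - (\<Delta>\<sigma> * (vref \<tau> *\<^sub>R ham \<psi> \<psi>t (tref \<tau>) (u (tref \<tau>))) + (\<Sum>i<N. \<Delta>\<rho> i * H i * pulse (ons i) \<tau>))) (at \<tau> within {t0..fin})"
        unfolding Z_def using nb
        by (intro has_vector_derivative_diff has_vector_derivative_add has_vector_derivative_sum has_vector_derivative_mult_right
            bounded_bilinear.has_vector_derivative[OF bounded_bilinear_inner d\<phi> dz]
            bounded_bilinear.has_vector_derivative[OF bounded_bilinear_mult d\<eta> dw] dX ramp_has_derivative') auto
      moreover have "(\<phi> \<tau> \<bullet> zp + (vref \<tau> *\<^sub>R - blinfun_adjoint ?A (\<phi> \<tau>)) \<bullet> z \<tau>)
         + (\<eta> \<tau> * (vp p \<tau> - vp q \<tau>) + (vref \<tau> *\<^sub>R - (\<phi> \<tau> \<bullet> ?F)) * w \<tau>)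
         - (\<Delta>\<sigma> * (vref \<tau> *\<^sub>R ham \<psi> \<psi>t (tref \<tau>) (u (tref \<tau>))) + (\<Sum>i<N. \<Delta>\<rho> i * H i * pulse (ons i) \<tau>)) = \<phi> \<tau> \<bullet> err \<tau>"
      \<comment> \<open>On an inserted interval \<open>vref\<close> is \<open>0\<close> and the
        speeds differ by \<open>\<Delta>\<rho> i\<close>; elsewhere \<open>vref\<close> is
        \<open>1\<close> and they differ by \<open>\<Delta>\<sigma>\<close>. In both cases
        \<open>ham\<close> at the active control value accounts for the term linear in the
        speeds.\<close>
      proof (cases \<tau> rule: flow_cases)
        case (1 i)
        have "(\<Sum>j<N. \<Delta>\<rho> j * H j * pulse (ons j) \<tau>) = \<Delta>\<rho> i * H i" by (rule pulse_sum[OF 1(1-3)])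
        then show ?thesis
          unfolding err_def zp_def[symmetric] using 1
          by (simp add: H_def ham_def \<phi>_def \<eta>_def \<Delta>\<rho>_def inner_diff_right algebra_simps)
      next
        case 2
        have "(\<Sum>j<N. \<Delta>\<rho> j * H j * pulse (ons j) \<tau>) = 0" using 2(1) by (intro sum.neutral) auto
        then show ?thesis
          unfolding err_def zp_def[symmetric] using 2
          by (simp add: ham_def \<phi>_def \<eta>_def \<Delta>\<sigma>_def inner_diff_right inner_add_right inner_blinfun_adjoint algebra_simps)
      qed
      ultimately show ?thesis by simp
    qed
    have err_le: "norm (\<phi> \<tau> \<bullet> err \<tau>) \<le> B * (e * Ce * d)" if \<tau>: "\<tau> \<in> {t0..fin}" for \<tau>
    proof -
      let ?fp = "f (tp p \<tau>) (clip (Y p \<tau>)) (ut \<tau>)" and ?fq = "f (tp q \<tau>) (clip (Y q \<tau>)) (ut \<tau>)" and ?fh = "f (tref \<tau>) (x (tref \<tau>)) (ut \<tau>)"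
      let ?l = "fx (tref \<tau>, x (tref \<tau>), ut \<tau>) (z \<tau>) + w \<tau> *\<^sub>R ft (tref \<tau>, x (tref \<tau>), ut \<tau>)"
      have Bh: "(tref \<tau>, x (tref \<tau>), ut \<tau>) \<in> Box" by (intro ref_in_Box tref_range \<tau> ut_bound)
      have cp: "clip (Y p \<tau>) = Y p \<tau>" by (rule sol_clip(1)[OF np(1,2) Yp \<tau>])
      have cq: "clip (Y q \<tau>) = Y q \<tau>" by (rule sol_clip(1)[OF nq(1,2) Yq \<tau>])
      have yp: "norm (Y p \<tau> - x (tref \<tau>)) + \<bar>tp p \<tau> - tref \<tau>\<bar> \<le> Cz * dist0 p"
        using sol_near_ref[OF np(1) Yp \<tau>] tp_diff[OF \<tau>, of p param_zero] by (simp add: tp_zero Cz_def algebra_simps)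
      have yq: "norm (Y q \<tau> - x (tref \<tau>)) + \<bar>tp q \<tau> - tref \<tau>\<bar> \<le> Cz * dist0 q"
        using sol_near_ref[OF nq(1) Yq \<tau>] tp_diff[OF \<tau>, of q param_zero] by (simp add: tp_zero Cz_def algebra_simps)
      have t1: "norm ((vp p \<tau> - vp q \<tau>) *\<^sub>R (?fp - ?fh)) \<le> d * e"
      proof -
        have "norm (?fp - ?fh) \<le> Mb * (norm (clip (Y p \<tau>) - x (tref \<tau>)) + \<bar>tp p \<tau> - tref \<tau>\<bar>)"
          by (rule f_lipschitz_Box[OF in_Box[OF np(1) \<tau>] Bh])
        also have "\<dots> \<le> Mb * (Cz * dist0 p)" using yp Mb_pos cp by (intro mult_left_mono) auto
        finally have "norm (?fp - ?fh) \<le> e" using np(4) by linarith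
        then show ?thesis using vp_diff[of p \<tau> q] \<open>d \<ge> 0\<close> by (auto simp: d_def intro: mult_mono)
      qed
      have t2: "norm (vp q \<tau> *\<^sub>R (?fp - ?fq - ?l)) \<le> 2 * (e * (Cz * d))"
      proof -
        have small: "norm (Y p \<tau> - x (tref \<tau>)) < \<delta>1" "\<bar>tp p \<tau> - tref \<tau>\<bar> < \<delta>1"
          "norm (Y q \<tau> - x (tref \<tau>)) < \<delta>1" "\<bar>tp q \<tau> - tref \<tau>\<bar> < \<delta>1"
          using yp yq np(3) nq(3) norm_ge_zero[of "Y p \<tau> - x (tref \<tau>)"] norm_ge_zero[of "Y q \<tau> - x (tref \<tau>)"] by linarith+
        have zw_eq: "z \<tau> = clip (Y p \<tau>) - clip (Y q \<tau>)" "w \<tau> = tp p \<tau> - tp q \<tau>"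
          by (simp_all add: z_def w_def cp cq)
        have "norm (?fp - ?fq - ?l) \<le> e * (norm (z \<tau>) + \<bar>w \<tau>\<bar>)"
          unfolding zw_eq
          by (rule \<delta>1(2)[OF in_Box[OF np(1) \<tau>] in_Box[OF nq(1) \<tau>] Bh])
            (use small in \<open>simp_all add: cp cq\<close>)
        also have "\<dots> \<le> e * (Cz * d)" using zw[OF \<tau>] e by (intro mult_left_mono) auto
        finally show ?thesis using vp_le_2[OF nq(1), of \<tau>] by (auto intro: mult_mono)
      qed
      have t3: "norm ((vp q \<tau> - vref \<tau>) *\<^sub>R ?l) \<le> e * (Mb * (Cz * d))"
      proof -
        have "norm (fx (tref \<tau>, x (tref \<tau>), ut \<tau>) (z \<tau>)) \<le> Mb * norm (z \<tau>)"
          by (rule order_trans[OF norm_blinfun]) (intro mult_right_mono Box_bounds(3) Bh norm_ge_zero)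
        moreover have "norm (w \<tau> *\<^sub>R ft (tref \<tau>, x (tref \<tau>), ut \<tau>)) \<le> \<bar>w \<tau>\<bar> * Mb"
          using Box_bounds(2)[OF Bh] by (auto intro: mult_left_mono)
        ultimately have "norm ?l \<le> Mb * (norm (z \<tau>) + \<bar>w \<tau>\<bar>)"
          using norm_triangle_ineq[of "fx (tref \<tau>, x (tref \<tau>), ut \<tau>) (z \<tau>)" "w \<tau> *\<^sub>R ft (tref \<tau>, x (tref \<tau>), ut \<tau>)"]
          by (simp add: algebra_simps)
        also have "\<dots> \<le> Mb * (Cz * d)" using zw[OF \<tau>] Mb_pos by (intro mult_left_mono) auto
        finally have "norm ?l \<le> Mb * (Cz * d)" .
        moreover have "\<bar>vp q \<tau> - vref \<tau>\<bar> \<le> e" using vp_diff[of q \<tau> param_zero] nq(5) by (simp add: vp_zero)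
        ultimately show ?thesis using e by (auto intro: mult_mono)
      qed
      \<comment> \<open>Each term has one small factor: \<open>f\<close> near its reference value,
        the strict estimate for \<open>f\<close>, and the speed near \<open>vref\<close>.\<close>
      have "err \<tau> = (vp p \<tau> - vp q \<tau>) *\<^sub>R (?fp - ?fh) + vp q \<tau> *\<^sub>R (?fp - ?fq - ?l) + (vp q \<tau> - vref \<tau>) *\<^sub>R ?l"
        by (simp add: err_def algebra_simps)
      then have "norm (err \<tau>) \<le> norm ((vp p \<tau> - vp q \<tau>) *\<^sub>R (?fp - ?fh)) + norm (vp q \<tau> *\<^sub>R (?fp - ?fq - ?l)) + norm ((vp q \<tau> - vref \<tau>) *\<^sub>R ?l)"
        by (simp only: norm_triangle_mono norm_triangle_ineq order_refl)
      also have "\<dots> \<le> d * e + 2 * (e * (Cz * d)) + e * (Mb * (Cz * d))" using t1 t2 t3 by linarith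
      also have "\<dots> = e * Ce * d" by (simp add: Ce_def algebra_simps)
      finally have "norm (\<phi> \<tau>) * norm (err \<tau>) \<le> B * (e * Ce * d)"
        using B(2)[OF tref_range[OF \<tau>]] B(1) by (intro mult_mono) (auto simp: \<phi>_def)
      then show ?thesis using Cauchy_Schwarz_ineq2[of "\<phi> \<tau>" "err \<tau>"] by simp
    qed
    have "norm (Z fin - Z t0) \<le> B * (e * Ce * d) * (fin - t0)"
      using t0_fin B(1) e Ce \<open>d \<ge> 0\<close> err_le dZ
      by (intro lipschitz_increment_bound_ae[OF _ K NE]) auto
    also have "\<dots> = \<epsilon> * d" using B(1) Ce t0_fin by (simp add: e_def)
    finally have *: "\<bar>Z fin - Z t0\<bar> \<le> \<epsilon> * d" by simp
    have X0: "X t0 = 0" by (simp add: X_def)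
    \<comment> \<open>The value at \<open>t0\<close> carries the dependence on the initial data, the
      bracket at \<open>fin\<close> that on the speeds; together they form the asserted
      derivative.\<close>
    have "Z fin = \<psi> t1 \<bullet> z fin + \<psi>t t1 * w fin - (\<Delta>\<sigma> * X t1 + (\<Sum>i<N. \<Delta>\<rho> i * H i))"
      by (simp add: Z_def \<phi>_def \<eta>_def tref_fin ramp_fin)
    moreover have "Z t0 = \<psi> t0 \<bullet> (fst (snd (fst p)) - fst (snd (fst q))) + \<psi>t t0 * (fst (fst p) - fst (fst q))"
      by (simp add: Z_def \<phi>_def \<eta>_def tref_t0 ramp_t0 X0 z_def w_def sol_t0[OF Yp] sol_t0[OF Yq] tp_t0)
    ultimately have "Z fin - Z t0 = \<psi> t1 \<bullet> Y p fin + \<psi>t t1 * tp p fin - (\<psi> t1 \<bullet> Y q fin + \<psi>t t1 * tp q fin) -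
      param_deriv N (\<psi>t t0, \<psi> t0, X t1) H p q"
      by (simp add: param_deriv_def z_def w_def \<Delta>\<sigma>_def \<Delta>\<rho>_def inner_prod_def inner_diff_right algebra_simps)
    with * show "\<bar>\<psi> t1 \<bullet> Y p fin + \<psi>t t1 * tp p fin - (\<psi> t1 \<bullet> Y q fin + \<psi>t t1 * tp q fin) -
      param_deriv N (\<psi>t t0, \<psi> t0, integral {t0..t1} (\<lambda>s. ham \<psi> \<psi>t s (u s))) (\<lambda>i. ham \<psi> \<psi>t (\<theta> i) (v i)) p q\<bar>
     \<le> \<epsilon> * dist_param p q"
      by (simp add: X_def H_def[abs_def] d_def)
  qed (rule \<delta>(1))
qed

end

section \<open>Derivatives of endpoint functions and realization of parameters\<close>

context flow begin

lemma sol_zero_fin: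
  assumes "\<And>p. dist0 p \<le> 1 \<Longrightarrow> is_sol p (Y p)"
  shows "Y param_zero fin = x t1"
  using sol_near_ref[of param_zero "Y param_zero" fin, OF _ assms] t0_fin by (simp add: tref_fin dist0_zero)

text \<open>The terminal values of \<open>\<psi>\<close> and \<open>\<psi>t\<close> are opposite to
  the terminal gradient, so the terminal part of the chain rule is minus the functional treated in
  \<open>flow_strict\<close>. The components in the initial data are the residuals of the initial
  transversality conditions.\<close>

lemma endpoint_strict:
  fixes G :: "real \<times> 'a \<times> real \<times> 'a \<Rightarrow> real"
  assumes adj: "adjoint_pair \<psi> \<psi>t" and Y: "\<And>p. dist0 p \<le> 1 \<Longrightarrow> is_sol p (Y p)"
    and deriv: "\<And>z. (G has_derivative blinfun_apply (G' z)) (at z)" and cont: "continuous_on UNIV G'"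
    and G': "\<And>a b c d. blinfun_apply (G' (t0, x t0, t1, x t1)) (a, b, c, d) = g1 * a + g2 \<bullet> b + g3 * c + g4 \<bullet> d"
    and \<psi>1: "\<psi> t1 = - g4" and \<psi>t1: "\<psi>t t1 = - g3"
  shows "strict_param_deriv N (\<lambda>p. G (t0 + fst (fst p), x t0 + fst (snd (fst p)), tp p fin, Y p fin))
     (g1 - \<psi>t t0, g2 - \<psi> t0, - integral {t0..t1} (\<lambda>s. ham \<psi> \<psi>t s (u s))) (\<lambda>i. - ham \<psi> \<psi>t (\<theta> i) (v i))"
  unfolding strict_param_deriv_def
proof (intro allI impI)
  fix \<epsilon> :: real assume "\<epsilon> > 0"
  let ?z0 = "(t0, x t0, t1, x t1)"
  define zz where "zz = (\<lambda>p. (t0 + fst (fst p), x t0 + fst (snd (fst p)), tp p fin, Y p fin))"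
  \<comment> \<open>\<open>2\<close> for initial time and initial state, \<open>Ct\<close> for the
    final time, \<open>Cy\<close> for the final state.\<close>
  define C where "C = 2 + Ct + Cy"
  have C: "C > 0" using Ct_ge_1 Cy_pos by (simp add: C_def)
  have fin_in: "fin \<in> {t0..fin}" using t0_fin by simp
  have zz0: "zz param_zero = ?z0"
    using sol_zero_fin[OF Y] by (simp add: zz_def tp_zero tref_fin)
  have zz_diff: "norm (zz p - zz q) \<le> C * dist_param p q" if "dist0 p \<le> 1" "dist0 q \<le> 1" for p q
  proof -
    have np: "norm (fst p - fst q) \<le> dist_param p q" by (simp add: param_dist_def sum_nonneg)
    have n4: "norm (a, b, c, d) \<le> \<bar>a\<bar> + norm b + \<bar>c\<bar> + norm d" for a c :: real and b d :: 'a
      using norm_Pair_le[of a "(b, c, d)"] norm_Pair_le[of b "(c, d)"] norm_Pair_le[of c d] by simp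
    have "norm (zz p - zz q) \<le> \<bar>fst (fst p) - fst (fst q)\<bar> + norm (fst (snd (fst p)) - fst (snd (fst q)))
        + \<bar>tp p fin - tp q fin\<bar> + norm (Y p fin - Y q fin)"
      unfolding zz_def diff_Pair by (rule order_trans[OF n4]) simp
    also have "\<dots> \<le> dist_param p q + dist_param p q + Ct * dist_param p q + Cy * dist_param p q"
      using np param_components(1,2)[of p q]
      by (intro add_mono tp_diff sol_diff Y that fin_in) linarith+
    also have "\<dots> = C * dist_param p q" by (simp add: C_def algebra_simps)
    finally show ?thesis .
  qed
  \<comment> \<open>One half of \<open>\<epsilon>\<close> is spent on the nonlinearity of
    \<open>G\<close>, the other on the flow.\<close>
  define e where "e = \<epsilon> / (2 * C)"
  have e: "e > 0" using \<open>\<epsilon> > 0\<close> C by (simp add: e_def)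
  obtain \<delta>1 where \<delta>1: "\<delta>1 > 0" "\<And>y z. norm (y - ?z0) < \<delta>1 \<Longrightarrow> norm (z - ?z0) < \<delta>1 \<Longrightarrow>
    norm (G y - G z - G' ?z0 (y - z)) \<le> e * norm (y - z)"
    using C1_strictly_differentiable[OF deriv cont e, of ?z0] by blast
  define D where "D = (\<psi>t t0, \<psi> t0, integral {t0..t1} (\<lambda>s. ham \<psi> \<psi>t s (u s)))"
  define c where "c = (\<lambda>i. ham \<psi> \<psi>t (\<theta> i) (v i))"
  have "\<epsilon> / 2 > 0" using \<open>\<epsilon> > 0\<close> by simp
  then obtain \<delta>2 where \<delta>2: "\<delta>2 > 0" "\<And>p q. p \<in> param_cone N \<Longrightarrow> q \<in> param_cone N \<Longrightarrow> dist0 p < \<delta>2 \<Longrightarrow> dist0 q < \<delta>2 \<Longrightarrow>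
     \<bar>\<psi> t1 \<bullet> Y p fin + \<psi>t t1 * tp p fin - (\<psi> t1 \<bullet> Y q fin + \<psi>t t1 * tp q fin) - param_deriv N D c p q\<bar> \<le> \<epsilon> / 2 * dist_param p q"
    using flow_strict[OF adj Y] unfolding strict_param_deriv_def D_def c_def by meson
  define \<delta> where "\<delta> = Min {1, \<delta>1 / C, \<delta>2}"
  have \<delta>: "\<delta> > 0" "\<delta> \<le> 1" "\<delta> \<le> \<delta>1 / C" "\<delta> \<le> \<delta>2" using \<delta>1(1) \<delta>2(1) C by (auto simp: \<delta>_def)
  show "\<exists>\<delta>>0. \<forall>p\<in>param_cone N. \<forall>q\<in>param_cone N. dist0 p < \<delta> \<longrightarrow> dist0 q < \<delta> \<longrightarrow>
     \<bar>G (t0 + fst (fst p), x t0 + fst (snd (fst p)), tp p fin, Y p fin) - G (t0 + fst (fst q), x t0 + fst (snd (fst q)), tp q fin, Y q fin)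
      - param_deriv N (g1 - \<psi>t t0, g2 - \<psi> t0, - integral {t0..t1} (\<lambda>s. ham \<psi> \<psi>t s (u s))) (\<lambda>i. - ham \<psi> \<psi>t (\<theta> i) (v i)) p q\<bar>
     \<le> \<epsilon> * dist_param p q"
  proof (intro exI[of _ \<delta>] conjI ballI impI)
    fix p q assume pq: "p \<in> param_cone N" "q \<in> param_cone N" "dist0 p < \<delta>" "dist0 q < \<delta>"
    have zn: "norm (zz r - ?z0) < \<delta>1" if "dist0 r < \<delta>" for r
    proof -
      have "dist0 r < \<delta>1 / C" using that \<delta> by linarith
      then have "C * dist0 r < \<delta>1" using C by (simp add: pos_less_divide_eq mult.commute)
      moreover have "norm (zz r - ?z0) \<le> C * dist0 r"
        using zz_diff[of r param_zero] that \<delta>(2) by (simp add: zz0 dist0_zero)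
      ultimately show ?thesis by linarith
    qed
    have d1: "dist0 p \<le> 1" "dist0 q \<le> 1" using pq \<delta> by linarith+
    have "norm (G (zz p) - G (zz q) - G' ?z0 (zz p - zz q)) \<le> e * norm (zz p - zz q)"
      by (intro \<delta>1(2) zn pq)
    also have "\<dots> \<le> e * (C * dist_param p q)" using e by (intro mult_left_mono zz_diff d1) auto
    also have "\<dots> = \<epsilon> / 2 * dist_param p q" using C by (simp add: e_def)
    finally have 1: "\<bar>G (zz p) - G (zz q) - G' ?z0 (zz p - zz q)\<bar> \<le> \<epsilon> / 2 * dist_param p q" by simp
    have 2: "\<bar>\<psi> t1 \<bullet> Y p fin + \<psi>t t1 * tp p fin - (\<psi> t1 \<bullet> Y q fin + \<psi>t t1 * tp q fin) - param_deriv N D c p q\<bar> \<le> \<epsilon> / 2 * dist_param p q"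
      using pq \<delta> by (intro \<delta>2(2)) linarith+
    have "G' ?z0 (zz p - zz q) = g1 * (fst (fst p) - fst (fst q)) + g2 \<bullet> (fst (snd (fst p)) - fst (snd (fst q)))
       + g3 * (tp p fin - tp q fin) + g4 \<bullet> (Y p fin - Y q fin)"
      by (simp add: zz_def G')
    moreover have "param_deriv N (g1 - \<psi>t t0, g2 - \<psi> t0, - integral {t0..t1} (\<lambda>s. ham \<psi> \<psi>t s (u s))) (\<lambda>i. - ham \<psi> \<psi>t (\<theta> i) (v i)) p q
       = g1 * (fst (fst p) - fst (fst q)) + g2 \<bullet> (fst (snd (fst p)) - fst (snd (fst q))) - param_deriv N D c p q"
      by (simp add: param_deriv_def D_def c_def inner_prod_def inner_diff_left left_diff_distrib sum_negf)
    ultimately have 3: "G' ?z0 (zz p - zz q) - param_deriv N (g1 - \<psi>t t0, g2 - \<psi> t0, - integral {t0..t1} (\<lambda>s. ham \<psi> \<psi>t s (u s))) (\<lambda>i. - ham \<psi> \<psi>t (\<theta> i) (v i)) p q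
       = - (\<psi> t1 \<bullet> Y p fin + \<psi>t t1 * tp p fin - (\<psi> t1 \<bullet> Y q fin + \<psi>t t1 * tp q fin) - param_deriv N D c p q)"
      by (simp add: \<psi>1 \<psi>t1 inner_diff_right right_diff_distrib)
    have "\<bar>G (zz p) - G (zz q) - param_deriv N (g1 - \<psi>t t0, g2 - \<psi> t0, - integral {t0..t1} (\<lambda>s. ham \<psi> \<psi>t s (u s))) (\<lambda>i. - ham \<psi> \<psi>t (\<theta> i) (v i)) p q\<bar>
       \<le> \<epsilon> * dist_param p q"
      using 1 2 3 by linarith
    then show "\<bar>G (t0 + fst (fst p), x t0 + fst (snd (fst p)), tp p fin, Y p fin) - G (t0 + fst (fst q), x t0 + fst (snd (fst q)), tp q fin, Y q fin)
      - param_deriv N (g1 - \<psi>t t0, g2 - \<psi> t0, - integral {t0..t1} (\<lambda>s. ham \<psi> \<psi>t s (u s))) (\<lambda>i. - ham \<psi> \<psi>t (\<theta> i) (v i)) p q\<bar>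
     \<le> \<epsilon> * dist_param p q"
      by (simp add: zz_def)
  qed (rule \<delta>(1))
qed

text \<open>Solutions for the varied clock become trajectories in real time by composition with a
  right inverse of the clock. The bound \<open>1/2\<close> keeps the speed positive off the inserted
  intervals, so the clock stands still only on an inserted interval with speed zero.\<close>

lemma realization:
  assumes cone: "p \<in> param_cone N" and small: "dist0 p \<le> 1/2" "Cy * dist0 p \<le> 1" and y: "is_sol p y"
  shows "\<exists>X W E. t0 + fst (fst p) < tp p fin \<and> Mb-lipschitz_on {t0 + fst (fst p)..tp p fin} X \<and> W \<in> borel_measurable borel \<and>
     (\<forall>t. \<exists>\<tau>. W t = ut \<tau>) \<and> X (t0 + fst (fst p)) = x t0 + fst (snd (fst p)) \<and> X (tp p fin) = y fin \<and> negligible E \<and>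
     (\<forall>t\<in>{t0 + fst (fst p)..tp p fin} - E. (X has_vector_derivative f t (X t) (W t)) (at t within {t0 + fst (fst p)..tp p fin})) \<and>
     (\<forall>t\<in>{t0 + fst (fst p)..tp p fin} \<inter> {t0..t1}. norm (X t - x t) \<le> (Cy + Mb * Ct) * dist0 p)"
proof -
  let ?s = "tp p"
  have d1: "dist0 p \<le> 1" using small by linarith
  define \<sigma> where "\<sigma> = 1 + snd (snd (fst p))"
  have "\<bar>snd (snd (fst p))\<bar> \<le> norm (fst p)" using param_components(3)[of p param_zero] by simp
  also have "\<dots> \<le> dist0 p" by (simp add: param_dist_def sum_nonneg)
  finally have \<sigma>: "\<sigma> > 0" using small by (simp add: \<sigma>_def)
  have \<rho>: "\<And>i. i < N \<Longrightarrow> snd p i \<ge> 0" using cone by (auto simp: param_cone_def)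
  have v0: "vp p \<tau> \<ge> 0" for \<tau>
    by (cases \<tau> rule: flow_cases) (use \<rho> \<sigma> in \<open>auto simp: \<sigma>_def\<close>)
  have incr: "?s b - ?s a \<ge> \<sigma> * (tref b - tref a)" if "a \<le> b" for a b
  proof -
    have "?s b - ?s a = \<sigma> * (tref b - tref a) + (\<Sum>i<N. snd p i * (ramp (ons i) b - ramp (ons i) a))"
      by (simp add: tp_def \<sigma>_def algebra_simps sum_subtractf)
    moreover have "(\<Sum>i<N. snd p i * (ramp (ons i) b - ramp (ons i) a)) \<ge> 0"
      using \<rho> ramp_mono[OF that] by (intro sum_nonneg mult_nonneg_nonneg) auto
    ultimately show ?thesis by simp
  qed
  have mono: "?s a \<le> ?s b" if "a \<le> b" for a b
  proof -
    have "0 \<le> \<sigma> * (tref b - tref a)" using \<sigma> tref_increment(1)[OF that] by simp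
    then show ?thesis using incr[OF that] by linarith
  qed
  have less: "?s t0 < ?s fin"
  proof -
    have "0 < \<sigma> * (t1 - t0)" using \<sigma> t0_less_t1 by simp
    then show ?thesis using incr[of t0 fin] t0_fin by (simp add: tref_fin tref_t0)
  qed
  obtain E where E: "negligible E" "\<And>\<tau>. \<tau> \<in> {t0..fin} - E \<Longrightarrow> (y has_vector_derivative vp p \<tau> *\<^sub>R f (tp p \<tau>) (clip (y \<tau>)) (ut \<tau>)) (at \<tau> within {t0..fin})"
    using sol_lipschitz_deriv(2)[OF d1 y] by blast
  define E2 where "E2 = E \<union> breaks"
  have E2: "negligible E2" unfolding E2_def using E(1) negligible_breaks by (rule negligible_Un)
  have cont_y: "continuous_on {t0..fin} y" using y by (simp add: is_sol_def)
  \<comment> \<open>The state moves only with the clock: the integral of \<open>Mb\<close> times the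
    speed bounds increments of \<open>y\<close> by increments of the clock.\<close>
  have lip1: "norm (y b - y a) \<le> Mb * (?s b - ?s a)" if ab: "t0 \<le> a" "a \<le> b" "b \<le> fin" for a b
  proof -
    let ?g = "\<lambda>s. vp p s *\<^sub>R f (tp p s) (clip (y s)) (ut s)"
    have i: "?g integrable_on {t0..fin}" by (rule rhs_integrable[OF d1 cont_y])
    have I: "integral {t0..a} ?g + integral {a..b} ?g = integral {t0..b} ?g"
      using ab by (intro Henstock_Kurzweil_Integration.integral_combine integrable_on_subinterval[OF i]) auto
    have yt: "y t = x t0 + fst (snd (fst p)) + integral {t0..t} ?g" if "t \<in> {t0..fin}" for t
      using y that unfolding is_sol_def by blast
    have "y a = x t0 + fst (snd (fst p)) + integral {t0..a} ?g" "y b = x t0 + fst (snd (fst p)) + integral {t0..b} ?g"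
      using ab by (auto intro: yt)
    then have yba: "y b - y a = integral {a..b} ?g" by (simp add: I[symmetric])
    have v: "(vp p has_integral ?s b - ?s a) {a..b}"
      using ab by (intro fundamental_theorem_of_calculus_lipschitz[OF _ tp_lipschitz negligible_breaks] tp_has_derivative) auto
    have "norm (integral {a..b} ?g) \<le> integral {a..b} (\<lambda>s. Mb * vp p s)"
    proof (rule integral_norm_bound_integral)
      show "?g integrable_on {a..b}" using ab by (intro integrable_on_subinterval[OF i]) auto
      show "(\<lambda>s. Mb * vp p s) integrable_on {a..b}" using v by (intro integrable_on_mult_right) blast
      fix s assume "s \<in> {a..b}"
      then have "norm (f (tp p s) (clip (y s)) (ut s)) \<le> Mb" using ab by (intro Box_bounds(1) in_Box d1) auto
      then have "vp p s * norm (f (tp p s) (clip (y s)) (ut s)) \<le> vp p s * Mb" using v0 by (intro mult_left_mono)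
      then show "norm (?g s) \<le> Mb * vp p s" using v0[of s] by (simp add: mult.commute)
    qed
    also have "\<dots> = Mb * (?s b - ?s a)" using has_integral_mult_right[OF v, of Mb] by (rule integral_unique)
    finally show ?thesis unfolding yba .
  qed
  have lip: "norm (y a - y b) \<le> Mb * \<bar>?s a - ?s b\<bar>" if "a \<in> {t0..fin}" "b \<in> {t0..fin}" for a b
    using lip1[of a b] lip1[of b a] mono[of a b] mono[of b a] that
    by (cases "a \<le> b") (auto simp: norm_minus_commute)
  have dy: "(y has_vector_derivative vp p \<tau> *\<^sub>R f (?s \<tau>) (y \<tau>) (ut \<tau>)) (at \<tau> within {t0..fin})" if "\<tau> \<in> {t0..fin} - E2" for \<tau>
    using E(2)[of \<tau>] that sol_clip(1)[OF d1 small(2) y, of \<tau>] by (auto simp: E2_def)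
  have ds: "(?s has_vector_derivative vp p \<tau>) (at \<tau> within {t0..fin})" if "\<tau> \<in> {t0..fin} - E2" for \<tau>
    using that by (intro tp_has_derivative) (auto simp: E2_def)
  \<comment> \<open>The clock is constant on an inserted interval of speed zero, so it stands still
    at finitely many clock readings only; each is read off at the midpoint of its interval.\<close>
  have zero: "negligible (?s ` {\<tau> \<in> {t0..fin} - E2. vp p \<tau> = 0})"
  proof (rule negligible_subset)
    show "negligible ((\<lambda>i. ?s (ons i + 1/2)) ` {..<N})" by (intro negligible_finite) auto
    show "?s ` {\<tau> \<in> {t0..fin} - E2. vp p \<tau> = 0} \<subseteq> (\<lambda>i. ?s (ons i + 1/2)) ` {..<N}"
    proof
      fix t assume "t \<in> ?s ` {\<tau> \<in> {t0..fin} - E2. vp p \<tau> = 0}"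
      then obtain \<tau> where \<tau>: "t = ?s \<tau>" "vp p \<tau> = 0" by blast
      show "t \<in> (\<lambda>i. ?s (ons i + 1/2)) ` {..<N}"
      proof (cases \<tau> rule: flow_cases)
        case (1 i)
        let ?m = "ons i + 1/2"
        have m: "pulse (ons i) ?m = 1" by (simp add: pulse_def)
        have rho0: "snd p i = 0" using 1 \<tau> by simp
        have "tref ?m = \<theta> i"
        proof (cases ?m rule: flow_cases)
          case (1 j)
          then have "j = i" using 1(3)[OF \<open>i < N\<close>] m by auto
          then show ?thesis using 1 by simp
        next
          case 2
          then show ?thesis using 2(1)[OF \<open>i < N\<close>] m by simp
        qed
        moreover have "snd p j * ramp (ons j) \<tau> = snd p j * ramp (ons j) ?m" if "j < N" for j
        proof -
          consider "j < i" | "j = i" | "i < j" by linarith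
          then show ?thesis
          proof cases
            case A: 1
            have "ons i < \<tau>" using 1(2) by (simp add: pulse_def split: if_splits)
            then show ?thesis using ons_less[OF A 1(1)] by (simp add: ramp_def)
          next
            case 2
            then show ?thesis using rho0 by simp
          next
            case A: 3
            have "\<tau> < ons i + 1" using 1(2) by (simp add: pulse_def split: if_splits)
            then show ?thesis using ons_less[OF A that] by (simp add: ramp_def)
          qed
        qed
        then have "(\<Sum>j<N. snd p j * ramp (ons j) \<tau>) = (\<Sum>j<N. snd p j * ramp (ons j) ?m)" by (intro sum.cong) auto
        ultimately have "?s \<tau> = ?s ?m" unfolding tp_def using 1(5) by simp
        then show ?thesis using \<tau>(1) 1(1) by blast
      next
        case 2
        then show ?thesis using \<tau>(2) \<sigma> by (simp add: \<sigma>_def)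
      qed
    qed
  qed
  obtain r E' where r: "r \<in> borel_measurable borel" "\<And>t. r t \<in> {t0..fin}"
    "\<And>t. t \<in> {?s t0..?s fin} \<Longrightarrow> ?s (r t) = t" "Mb-lipschitz_on {?s t0..?s fin} (\<lambda>t. y (r t))" "y (r (?s t0)) = y t0" "y (r (?s fin)) = y fin"
    "negligible E'" "\<And>t. t \<in> {?s t0..?s fin} - E' \<Longrightarrow>
      ((\<lambda>t. y (r t)) has_vector_derivative f (?s (r t)) (y (r t)) (ut (r t))) (at t within {?s t0..?s fin})"
    using realize_time_change[OF t0_fin mono less tp_lipschitz lip less_imp_le[OF Mb_pos] E2 ds dy v0 zero] by blast
  \<comment> \<open>Comparison at the parameter \<open>r t\<close>: there the varied clock shows
    \<open>t\<close>, and the reference clock differs from it by at most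
    \<open>Ct * dist0 p\<close>.\<close>
  have close: "norm (y (r t) - x t) \<le> (Cy + Mb * Ct) * dist0 p" if t: "t \<in> {?s t0..?s fin} \<inter> {t0..t1}" for t
  proof -
    have st: "?s (r t) = t" using r(3) t by auto
    have 1: "norm (y (r t) - x (tref (r t))) \<le> Cy * dist0 p" by (rule sol_near_ref[OF d1 y r(2)])
    have "norm (x (tref (r t)) - x t) \<le> Mb * \<bar>tref (r t) - t\<bar>"
      using lipschitz_onD[OF x_lipschitz tref_range[OF r(2)[of t]], of t] t by (simp add: dist_norm)
    also have "\<dots> \<le> Mb * (Ct * dist0 p)"
      using tp_diff[OF r(2)[of t], of p param_zero] Mb_pos st by (intro mult_left_mono) (auto simp: tp_zero abs_minus_commute)
    finally have "norm (x (tref (r t)) - x t) \<le> Mb * (Ct * dist0 p)" .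
    moreover have "norm (y (r t) - x t) \<le> norm (y (r t) - x (tref (r t))) + norm (x (tref (r t)) - x t)"
      using norm_triangle_ineq[of "y (r t) - x (tref (r t))" "x (tref (r t)) - x t"] by simp
    ultimately show ?thesis using 1 by (simp add: algebra_simps)
  qed
  have W: "(\<lambda>t. ut (r t)) \<in> borel_measurable borel" using measurable_compose[OF r(1) ut_measurable] .
  have "((\<lambda>t. y (r t)) has_vector_derivative f t (y (r t)) (ut (r t))) (at t within {?s t0..?s fin})"
    if "t \<in> {?s t0..?s fin} - E'" for t
    using r(8)[OF that] r(3)[of t] that by simp
  then show ?thesis
    using less r(4,5,6,7) W close sol_t0[OF y]
    by (intro exI[of _ "\<lambda>t. y (r t)"] exI[of _ "\<lambda>t. ut (r t)"] exI[of _ E']) (auto simp: tp_t0)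
qed

end

section \<open>Multipliers\<close>

lemma absolutely_continuous_fun_subset:
  "absolutely_continuous_fun a b g \<Longrightarrow> a \<le> c \<Longrightarrow> d \<le> b \<Longrightarrow> absolutely_continuous_fun c d g"
  unfolding absolutely_continuous_fun_def by (meson order_trans)

context reference begin

text \<open>One numbering for all endpoint functions: \<open>G 0\<close> is the cost, indices from
  \<open>1\<close> to \<open>m - 1\<close> are inequalities, those from \<open>m\<close> to
  \<open>M - 1\<close> equalities. The competitors are Lipschitz trajectories with Borel controls in
  \<open>U\<close> everywhere, the kind that \<open>realization\<close> produces.\<close>

definition optimal_trajectory ::
  "'b set \<Rightarrow> nat \<Rightarrow> nat \<Rightarrow> (nat \<Rightarrow> real \<times> 'a \<times> real \<times> 'a \<Rightarrow> real) \<Rightarrow> bool" where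
  "optimal_trajectory U m M G \<longleftrightarrow> (\<exists>\<epsilon>>0. \<forall>s0 s1 X W E. s0 < s1 \<longrightarrow> (\<exists>L. L-lipschitz_on {s0..s1} X) \<longrightarrow>
     W \<in> borel_measurable borel \<longrightarrow> bounded (range W) \<longrightarrow> range W \<subseteq> U \<longrightarrow> negligible E \<longrightarrow>
     (\<forall>t\<in>{s0..s1} - E. (X has_vector_derivative f t (X t) (W t)) (at t within {s0..s1})) \<longrightarrow>
     \<bar>s0 - t0\<bar> < \<epsilon> \<longrightarrow> \<bar>s1 - t1\<bar> < \<epsilon> \<longrightarrow> (\<forall>t\<in>{s0..s1} \<inter> {t0..t1}. norm (X t - x t) < \<epsilon>) \<longrightarrow>
     (\<forall>k. 1 \<le> k \<longrightarrow> k < m \<longrightarrow> G k (s0, X s0, s1, X s1) \<le> 0) \<longrightarrow>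
     (\<forall>k. m \<le> k \<longrightarrow> k < M \<longrightarrow> G k (s0, X s0, s1, X s1) = 0) \<longrightarrow>
     G 0 (t0, x t0, t1, x t1) \<le> G 0 (s0, X s0, s1, X s1))"

text \<open>These are the conditions that do not mention inserted pairs; the three vanishing sums
  are the derivatives in initial time, initial state and speed of the clock. The inequality for
  \<open>ham\<close>, which depends on the pairs, is kept apart.\<close>

definition multipliers ::
  "nat \<Rightarrow> nat \<Rightarrow> (nat \<Rightarrow> real \<times> 'a \<times> real \<times> 'a \<Rightarrow> real) \<Rightarrow> (nat \<Rightarrow> real) \<Rightarrow> (nat \<Rightarrow> 'a) \<Rightarrow>
   (nat \<Rightarrow> real \<Rightarrow> 'a) \<Rightarrow> (nat \<Rightarrow> real \<Rightarrow> real) \<Rightarrow> (nat \<Rightarrow> real) \<Rightarrow> bool" where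
  "multipliers m M G g1 g2 \<psi> \<psi>t l \<longleftrightarrow>
     (\<forall>k<m. l k \<ge> 0) \<and> (\<Sum>k<M. \<bar>l k\<bar>) = 1 \<and> (\<forall>k\<ge>M. l k = 0) \<and>
     (\<forall>k. 1 \<le> k \<longrightarrow> k < m \<longrightarrow> l k * G k (t0, x t0, t1, x t1) = 0) \<and>
     (\<Sum>k<M. l k * (g1 k - \<psi>t k t0)) = 0 \<and> (\<Sum>k<M. l k *\<^sub>R (g2 k - \<psi> k t0)) = 0 \<and>
     (\<Sum>k<M. l k * integral {t0..t1} (\<lambda>s. ham (\<psi> k) (\<psi>t k) s (u s))) = 0"

lemma finite_multipliers:
  fixes G :: "nat \<Rightarrow> real \<times> 'a \<times> real \<times> 'a \<Rightarrow> real"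
  assumes mM: "1 \<le> m" "m \<le> M" and uU: "range u \<subseteq> U"
    and deriv: "\<And>k z. k < M \<Longrightarrow> (G k has_derivative blinfun_apply (G' k z)) (at z)"
    and cont: "\<And>k. k < M \<Longrightarrow> continuous_on UNIV (G' k)"
    and G': "\<And>k a b c d. k < M \<Longrightarrow> blinfun_apply (G' k (t0, x t0, t1, x t1)) (a, b, c, d) = g1 k * a + g2 k \<bullet> b + g3 k * c + g4 k \<bullet> d"
    and adj: "\<And>k. k < M \<Longrightarrow> adjoint_pair (\<psi> k) (\<psi>t k)"
    and \<psi>1: "\<And>k. k < M \<Longrightarrow> \<psi> k t1 = - g4 k" "\<And>k. k < M \<Longrightarrow> \<psi>t k t1 = - g3 k"
    and feas: "\<And>k. 1 \<le> k \<Longrightarrow> k < m \<Longrightarrow> G k (t0, x t0, t1, x t1) \<le> 0" "\<And>k. m \<le> k \<Longrightarrow> k < M \<Longrightarrow> G k (t0, x t0, t1, x t1) = 0"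
    and opt: "optimal_trajectory U m M G"
    and A: "finite A" "A \<subseteq> {t0..t1} \<times> (U \<inter> cball 0 Bu)"
  obtains l where "multipliers m M G g1 g2 \<psi> \<psi>t l" "\<And>\<theta> w. (\<theta>, w) \<in> A \<Longrightarrow> (\<Sum>k<M. l k * ham (\<psi> k) (\<psi>t k) \<theta> w) \<le> 0"
proof -
  obtain ys where ys: "set ys = A" using finite_list[OF A(1)] by blast
  \<comment> \<open>The clock needs its insertion times in nondecreasing order; one time may occur
    with several control values.\<close>
  define xs where "xs = sort_key fst ys"
  have xs: "set xs = A" "sorted (map fst xs)" by (simp_all add: xs_def ys)
  define N where "N = length xs"
  define \<theta> where "\<theta> = (\<lambda>i. fst (xs ! i))"
  define v where "v = (\<lambda>i. snd (xs ! i))"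
  have nth: "(\<theta> i, v i) \<in> A" if "i < N" for i using that xs(1) nth_mem[of i xs] by (simp add: \<theta>_def v_def N_def)
  have v: "v i \<in> U" "norm (v i) \<le> Bu" "\<theta> i \<in> {t0..t1}" if "i < N" for i using nth[OF that] A(2) by auto
  have mono: "\<theta> i \<le> \<theta> j" if "i < j" "j < N" for i j
    using sorted_nth_mono[OF xs(2), of i j] that by (simp add: \<theta>_def N_def)
  interpret flow f ft fx t0 t1 x u Rad Bu Mb N \<theta> v
    by unfold_locales (use t0_less_t1 mono v in auto)
  define Y where "Y = (\<lambda>p. SOME y. is_sol p y)"
  have Y: "is_sol p (Y p)" if "dist0 p \<le> 1" for p
    unfolding Y_def using sol_exists[OF that] by (rule someI_ex)
  define zz where "zz = (\<lambda>p. (t0 + fst (fst p), x t0 + fst (snd (fst p)), tp p fin, Y p fin))"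
  have fin_in: "fin \<in> {t0..fin}" using t0_fin by simp
  have zz0: "zz param_zero = (t0, x t0, t1, x t1)"
    using sol_zero_fin[OF Y] by (simp add: zz_def tp_zero tref_fin)
  obtain \<epsilon> where "\<epsilon> > 0" and \<epsilon>: "\<And>s0 s1 X W E. s0 < s1 \<Longrightarrow> \<exists>L. L-lipschitz_on {s0..s1} X \<Longrightarrow>
     W \<in> borel_measurable borel \<Longrightarrow> bounded (range W) \<Longrightarrow> range W \<subseteq> U \<Longrightarrow> negligible E \<Longrightarrow>
     \<forall>t\<in>{s0..s1} - E. (X has_vector_derivative f t (X t) (W t)) (at t within {s0..s1}) \<Longrightarrow>
     \<bar>s0 - t0\<bar> < \<epsilon> \<Longrightarrow> \<bar>s1 - t1\<bar> < \<epsilon> \<Longrightarrow> \<forall>t\<in>{s0..s1} \<inter> {t0..t1}. norm (X t - x t) < \<epsilon> \<Longrightarrow>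
     \<forall>k. 1 \<le> k \<longrightarrow> k < m \<longrightarrow> G k (s0, X s0, s1, X s1) \<le> 0 \<Longrightarrow>
     \<forall>k. m \<le> k \<longrightarrow> k < M \<longrightarrow> G k (s0, X s0, s1, X s1) = 0 \<Longrightarrow>
     G 0 (t0, x t0, t1, x t1) \<le> G 0 (s0, X s0, s1, X s1)"
    using opt unfolding optimal_trajectory_def by blast
  have utU: "ut \<tau> \<in> U" for \<tau>
    by (cases \<tau> rule: flow_cases) (use v uU in auto)
  have CC: "Cy + Mb * Ct > 0" using Cy_pos Mb_pos Ct_ge_1 by (simp add: add_pos_pos)
  \<comment> \<open>\<open>1/2\<close> and \<open>1 / Cy\<close> permit the realization; the other
    entries bring the end points of the interval and the state within
    \<open>\<epsilon>\<close>.\<close>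
  define \<delta> where "\<delta> = Min {1/2, 1 / Cy, \<epsilon> / Ct, \<epsilon> / (Cy + Mb * Ct)}"
  have \<delta>: "\<delta> > 0" "\<delta> \<le> 1/2" "\<delta> \<le> 1 / Cy" "\<delta> \<le> \<epsilon> / Ct" "\<delta> \<le> \<epsilon> / (Cy + Mb * Ct)"
  proof -
    show "\<delta> > 0" using \<open>\<epsilon> > 0\<close> Cy_pos Ct_ge_1 CC by (auto simp: \<delta>_def)
    show "\<delta> \<le> 1/2" "\<delta> \<le> 1 / Cy" "\<delta> \<le> \<epsilon> / Ct" "\<delta> \<le> \<epsilon> / (Cy + Mb * Ct)"
      unfolding \<delta>_def by (intro Min_le; simp)+
  qed
  have optimal: "G 0 (zz param_zero) \<le> G 0 (zz p)"
    if p: "p \<in> param_cone N" "dist0 p < \<delta>" "\<And>k. 1 \<le> k \<Longrightarrow> k < m \<Longrightarrow> G k (zz p) \<le> 0" "\<And>k. m \<le> k \<Longrightarrow> k < M \<Longrightarrow> G k (zz p) = 0" for p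
  proof -
    have small: "dist0 p \<le> 1/2" "Cy * dist0 p \<le> 1" "Ct * dist0 p < \<epsilon>" "(Cy + Mb * Ct) * dist0 p < \<epsilon>"
    proof -
      have "dist0 p \<le> 1 / Cy" "dist0 p < \<epsilon> / Ct" "dist0 p < \<epsilon> / (Cy + Mb * Ct)" using p(2) \<delta> by linarith+
      then show "Cy * dist0 p \<le> 1" "Ct * dist0 p < \<epsilon>" "(Cy + Mb * Ct) * dist0 p < \<epsilon>"
        using Cy_pos Ct_ge_1 CC by (simp_all add: pos_le_divide_eq pos_less_divide_eq mult.commute)
    qed (use p \<delta> in linarith)
    then have d1: "dist0 p \<le> 1" by linarith
    let ?s0 = "t0 + fst (fst p)" and ?s1 = "tp p fin"
    obtain X W E where X: "?s0 < ?s1" "Mb-lipschitz_on {?s0..?s1} X" "W \<in> borel_measurable borel"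
      "\<forall>t. \<exists>\<tau>. W t = ut \<tau>" "X ?s0 = x t0 + fst (snd (fst p))" "X ?s1 = Y p fin" "negligible E"
      "\<forall>t\<in>{?s0..?s1} - E. (X has_vector_derivative f t (X t) (W t)) (at t within {?s0..?s1})"
      "\<forall>t\<in>{?s0..?s1} \<inter> {t0..t1}. norm (X t - x t) \<le> (Cy + Mb * Ct) * dist0 p"
      using realization[OF p(1) small(1,2) Y[OF d1]] by blast
    have zzX: "(?s0, X ?s0, ?s1, X ?s1) = zz p" by (simp add: zz_def X(5,6))
    have lipX: "\<exists>L. L-lipschitz_on {?s0..?s1} X" using X(2) by blast
    have "G 0 (t0, x t0, t1, x t1) \<le> G 0 (?s0, X ?s0, ?s1, X ?s1)"
    proof (rule \<epsilon>[OF X(1) lipX X(3) _ _ X(7,8)])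
      show "bounded (range W)" unfolding bounded_iff using X(4) ut_bound by (metis rangeE)
      show "range W \<subseteq> U" using X(4) utU by (metis image_subsetI)
      have "\<bar>?s0 - t0\<bar> \<le> Ct * dist0 p" "\<bar>?s1 - t1\<bar> \<le> Ct * dist0 p"
        using tp_diff[of t0 p param_zero] tp_diff[OF fin_in, of p param_zero] t0_fin
        by (simp_all add: tp_zero tref_fin tref_t0 tp_t0)
      then show "\<bar>?s0 - t0\<bar> < \<epsilon>" "\<bar>?s1 - t1\<bar> < \<epsilon>" using small(3) by linarith+
      show "\<forall>t\<in>{?s0..?s1} \<inter> {t0..t1}. norm (X t - x t) < \<epsilon>" using X(9) small(4) by (meson le_less_trans)
    qed (use p(3,4) in \<open>simp_all add: zzX\<close>)
    then show ?thesis unfolding zzX zz0 .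
  qed
  let ?D = "\<lambda>k. (g1 k - \<psi>t k t0, g2 k - \<psi> k t0, - integral {t0..t1} (\<lambda>s. ham (\<psi> k) (\<psi>t k) s (u s)))"
  obtain l :: "nat \<Rightarrow> real" where l: "\<And>k. k < m \<Longrightarrow> l k \<ge> 0" "(\<Sum>k<M. \<bar>l k\<bar>) = 1" "\<And>k. k \<ge> M \<Longrightarrow> l k = 0"
    "\<And>k. 1 \<le> k \<Longrightarrow> k < m \<Longrightarrow> l k * G k (zz param_zero) = 0"
    "(\<Sum>k<M. l k *\<^sub>R ?D k) = 0" "\<And>i. i < N \<Longrightarrow> (\<Sum>k<M. l k * - ham (\<psi> k) (\<psi>t k) (\<theta> i) (v i)) \<ge> 0"
  proof (rule fritz_john[of m M N "\<lambda>k p. G k (zz p)" ?D "\<lambda>k i. - ham (\<psi> k) (\<psi>t k) (\<theta> i) (v i)" \<delta>, OF mM])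
    show "strict_param_deriv N (\<lambda>p. G k (zz p)) (?D k) (\<lambda>i. - ham (\<psi> k) (\<psi>t k) (\<theta> i) (v i))" if "k < M" for k
      unfolding zz_def using that
      by (intro endpoint_strict[where G' = "G' k" and ?g3.0 = "g3 k" and ?g4.0 = "g4 k"] adj Y deriv cont G' \<psi>1)
    show "G k (zz param_zero) \<le> 0" if "1 \<le> k" "k < m" for k using feas(1)[OF that] by (simp add: zz0)
    show "G k (zz param_zero) = 0" if "m \<le> k" "k < M" for k using feas(2)[OF that] by (simp add: zz0)
    show "\<delta> > 0" by (rule \<delta>(1))
    show "G 0 (zz param_zero) \<le> G 0 (zz p)" if "p \<in> param_cone N" "dist0 p < \<delta>"
      "\<And>k. 1 \<le> k \<Longrightarrow> k < m \<Longrightarrow> G k (zz p) \<le> 0" "\<And>k. m \<le> k \<Longrightarrow> k < M \<Longrightarrow> G k (zz p) = 0" for p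
      by (rule optimal[OF that])
  qed (rule that)
  show thesis
  proof
    have f: "fst (\<Sum>k<M. l k *\<^sub>R ?D k) = 0" "fst (snd (\<Sum>k<M. l k *\<^sub>R ?D k)) = 0" "snd (snd (\<Sum>k<M. l k *\<^sub>R ?D k)) = 0"
      unfolding l(5) by auto
    show "multipliers m M G g1 g2 \<psi> \<psi>t l"
      unfolding multipliers_def using l(1-4) f by (simp add: zz0 fst_sum snd_sum sum_negf)
    fix t w assume "(t, w) \<in> A"
    then obtain i where i: "i < N" "xs ! i = (t, w)" using xs(1) by (metis N_def in_set_conv_nth)
    then show "(\<Sum>k<M. l k * ham (\<psi> k) (\<psi>t k) t w) \<le> 0"
      using l(6)[OF i(1)] by (simp add: \<theta>_def v_def sum_negf)
  qed
qed

text \<open>Each single condition involves finitely many coordinates, hence is closed under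
  pointwise convergence.\<close>

lemma closed_multipliers: "closed {l. multipliers m M G g1 g2 \<psi> \<psi>t l}"
proof -
  have c: "continuous_on UNIV (\<lambda>l :: nat \<Rightarrow> real. l k)" for k
    by (rule continuous_on_coordinate[OF continuous_on_id])
  show ?thesis
    unfolding multipliers_def
    by (intro closed_Collect_conj closed_Collect_all closed_Collect_imp open_Collect_const closed_Collect_le closed_Collect_eq
        continuous_intros c)
qed

end

text \<open>The control bound \<open>B\<close> may be enlarged at will: \<open>U\<close> can be
  unbounded, so no single bound covers the control values of all finite sets of pairs. A new
  \<open>Mb\<close> goes with each \<open>B\<close>.\<close>

lemma (in control_system) reference_exists:
  assumes t01: "t0 < t1" and cont_x: "continuous_on UNIV x"
    and x_eq: "\<And>t. t \<in> {t0..t1} \<Longrightarrow> x t = x t0 + integral {t0..t} (\<lambda>s. f s (x s) (u s))"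
    and u_meas: "u \<in> borel_measurable borel" and u_bd: "bounded (range u)"
  shows "\<exists>R B0. \<forall>B\<ge>B0. \<exists>Mb. reference f ft fx t0 t1 x u (R + 1) B Mb"
proof -
  have "bounded (x ` {t0..t1})"
    using cont_x by (intro compact_imp_bounded compact_continuous_image) (auto elim: continuous_on_subset)
  then obtain R where R: "\<And>t. t \<in> {t0..t1} \<Longrightarrow> norm (x t) \<le> R" unfolding bounded_iff by blast
  obtain B0 where B0: "\<And>t. norm (u t) \<le> B0" using u_bd unfolding bounded_iff by blast
  have ref: "\<exists>Mb. reference f ft fx t0 t1 x u (R + 1) B Mb" if "B \<ge> B0" for B
  proof -
    obtain Mb where Mb: "Mb > 0" "\<And>t y w. (t, y, w) \<in> box3 (t0 - (1 + (t1 - t0))) (t1 + (1 + (t1 - t0))) (R + 1) B \<Longrightarrow> norm (f t y w) \<le> Mb"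
     "\<And>z. z \<in> box3 (t0 - (1 + (t1 - t0))) (t1 + (1 + (t1 - t0))) (R + 1) B \<Longrightarrow> norm (ft z) \<le> Mb"
     "\<And>z. z \<in> box3 (t0 - (1 + (t1 - t0))) (t1 + (1 + (t1 - t0))) (R + 1) B \<Longrightarrow> norm (fx z) \<le> Mb"
      using box3_bound[of "t0 - (1 + (t1 - t0))" "t1 + (1 + (t1 - t0))" "R + 1" B] by blast
    have "reference f ft fx t0 t1 x u (R + 1) B Mb"
    proof unfold_locales
      show "norm (u t) \<le> B" for t using B0[of t] that by linarith
      show "norm (x t) + 1 \<le> R + 1" if "t \<in> {t0..t1}" for t using R[OF that] by simp
    qed (fact t01 cont_x x_eq u_meas Mb)+
    then show ?thesis ..
  qed
  then show ?thesis by blast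
qed

text \<open>Finite intersection property: the multipliers that satisfy the inequality of one pair
  form a closed set, and finitely many of these sets meet by
  \<open>finite_multipliers\<close>.\<close>

lemma (in control_system) multipliers_exist:
  fixes G :: "nat \<Rightarrow> real \<times> 'a \<times> real \<times> 'a \<Rightarrow> real"
  assumes t01: "t0 < t1" and cont_x: "continuous_on UNIV x"
    and x_eq: "\<And>t. t \<in> {t0..t1} \<Longrightarrow> x t = x t0 + integral {t0..t} (\<lambda>s. f s (x s) (u s))"
    and u_meas: "u \<in> borel_measurable borel" and u_bd: "bounded (range u)" and uU: "range u \<subseteq> U"
    and mM: "1 \<le> m" "m \<le> M"
    and deriv: "\<And>k z. k < M \<Longrightarrow> (G k has_derivative blinfun_apply (G' k z)) (at z)"
    and cont: "\<And>k. k < M \<Longrightarrow> continuous_on UNIV (G' k)"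
    and G': "\<And>k a b c d. k < M \<Longrightarrow> blinfun_apply (G' k (t0, x t0, t1, x t1)) (a, b, c, d) = g1 k * a + g2 k \<bullet> b + g3 k * c + g4 k \<bullet> d"
    and feas: "\<And>k. 1 \<le> k \<Longrightarrow> k < m \<Longrightarrow> G k (t0, x t0, t1, x t1) \<le> 0" "\<And>k. m \<le> k \<Longrightarrow> k < M \<Longrightarrow> G k (t0, x t0, t1, x t1) = 0"
    and opt: "reference.optimal_trajectory f t0 t1 x U m M G"
  shows "\<exists>l \<psi> \<psi>t Rad Bu Mb. reference f ft fx t0 t1 x u Rad Bu Mb \<and>
    (\<forall>k<M. reference.adjoint_pair ft fx t0 t1 x u (\<psi> k) (\<psi>t k) \<and> \<psi> k t1 = - g4 k \<and> \<psi>t k t1 = - g3 k) \<and>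
    reference.multipliers f t0 t1 x u m M G g1 g2 \<psi> \<psi>t l \<and>
    (\<forall>t\<in>{t0..t1}. \<forall>w\<in>U. (\<Sum>k<M. l k * reference.ham f x (\<psi> k) (\<psi>t k) t w) \<le> 0)"
proof -
  obtain R B0 where ref: "\<And>B. B \<ge> B0 \<Longrightarrow> \<exists>Mb. reference f ft fx t0 t1 x u (R + 1) B Mb"
    using reference_exists[OF t01 cont_x x_eq u_meas u_bd] by blast
  then obtain Mb0 where ref0: "reference f ft fx t0 t1 x u (R + 1) B0 Mb0" by blast
  \<comment> \<open>Adjoint functions are fixed once, for the smallest bound.
    \<open>adjoint_pair\<close>, \<open>ham\<close> and \<open>multipliers\<close> do not depend on
    \<open>Rad\<close>, \<open>Bu\<close> or \<open>Mb\<close>, so they are shared with all later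
    choices of \<open>B\<close>.\<close>
  interpret r0: reference f ft fx t0 t1 x u "R + 1" B0 Mb0 by (rule ref0)
  have "\<forall>k. \<exists>\<psi> \<psi>t. r0.adjoint_pair \<psi> \<psi>t \<and> \<psi> t1 = - g4 k \<and> \<psi>t t1 = - g3 k"
    using r0.adjoint_pair_exists by metis
  then obtain \<psi> \<psi>t where adj: "\<And>k. r0.adjoint_pair (\<psi> k) (\<psi>t k)" "\<And>k. \<psi> k t1 = - g4 k" "\<And>k. \<psi>t k t1 = - g3 k"
    by metis
  define K where "K = PiE UNIV (\<lambda>_::nat. {-1..1::real})"
  define S where "S = (\<lambda>(t, w). {l. r0.multipliers m M G g1 g2 \<psi> \<psi>t l \<and> (\<Sum>k<M. l k * r0.ham (\<psi> k) (\<psi>t k) t w) \<le> 0})"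
  have "K \<inter> \<Inter> (S ` ({t0..t1} \<times> U)) \<noteq> {}"
  proof (rule compact_imp_fip_image)
    show "compact K" unfolding K_def by (rule compact_PiE_UNIV) auto
    show "closed (S i)" for i
    proof -
      have c: "continuous_on UNIV (\<lambda>l :: nat \<Rightarrow> real. l k)" for k
        by (rule continuous_on_coordinate[OF continuous_on_id])
      show ?thesis unfolding S_def case_prod_unfold
        by (intro closed_Collect_conj r0.closed_multipliers closed_Collect_le continuous_intros c)
    qed
    fix A assume A: "finite A" "A \<subseteq> {t0..t1} \<times> U"
    \<comment> \<open>Large enough for the reference control and for all control values in the
      finite set \<open>A\<close>.\<close>
    define B where "B = Max (insert B0 ((\<lambda>a. norm (snd a)) ` A))"
    have B: "B \<ge> B0" "\<And>a. a \<in> A \<Longrightarrow> norm (snd a) \<le> B" using A(1) by (auto simp: B_def)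
    obtain Mb where "reference f ft fx t0 t1 x u (R + 1) B Mb" using ref[OF B(1)] by blast
    then interpret r: reference f ft fx t0 t1 x u "R + 1" B Mb .
    have "A \<subseteq> {t0..t1} \<times> (U \<inter> cball 0 B)" using A(2) B(2) by fastforce
    then obtain l where l: "r0.multipliers m M G g1 g2 \<psi> \<psi>t l" "\<And>\<theta> w. (\<theta>, w) \<in> A \<Longrightarrow> (\<Sum>k<M. l k * r0.ham (\<psi> k) (\<psi>t k) \<theta> w) \<le> 0"
      using r.finite_multipliers[OF mM uU deriv cont G' adj feas opt A(1)] by blast
    have "\<bar>l k\<bar> \<le> 1" for k
    proof (cases "k < M")
      case True
      then have "\<bar>l k\<bar> \<le> (\<Sum>k<M. \<bar>l k\<bar>)" by (intro member_le_sum) auto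
      then show ?thesis using l(1) by (simp add: r0.multipliers_def)
    next
      case False
      then show ?thesis using l(1) by (simp add: r0.multipliers_def)
    qed
    then have "l \<in> K" by (auto simp: K_def abs_le_iff minus_le_iff)
    moreover have "l \<in> \<Inter> (S ` A)" using l by (auto simp: S_def)
    ultimately show "K \<inter> \<Inter> (S ` A) \<noteq> {}" by blast
  qed
  then obtain l where l: "\<And>t w. t \<in> {t0..t1} \<Longrightarrow> w \<in> U \<Longrightarrow> l \<in> S (t, w)" by blast
  \<comment> \<open>Some pair is required in order to read off the conditions common to all of
    them.\<close>
  have "u t0 \<in> U" using uU by blast
  then have "r0.multipliers m M G g1 g2 \<psi> \<psi>t l" using l[of t0 "u t0"] t01 by (simp add: S_def)
  moreover have "\<forall>t\<in>{t0..t1}. \<forall>w\<in>U. (\<Sum>k<M. l k * r0.ham (\<psi> k) (\<psi>t k) t w) \<le> 0"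
    using l by (auto simp: S_def)
  ultimately show ?thesis using ref0 adj by blast
qed

section \<open>The maximum principle\<close>

context reference begin

text \<open>The adjoint system is linear, so multipliers can be applied to adjoint functions chosen
  earlier; finitely many null sets unite to one.\<close>

lemma adjoint_pair_sum:
  fixes M :: nat
  assumes adj: "\<And>k. k < M \<Longrightarrow> adjoint_pair (\<psi> k) (\<psi>t k)"
  shows "adjoint_pair (\<lambda>t. \<Sum>k<M. l k *\<^sub>R \<psi> k t) (\<lambda>t. \<Sum>k<M. l k * \<psi>t k t)"
proof -
  have "\<forall>k. \<exists>E. k < M \<longrightarrow> negligible E \<and> (\<forall>t\<in>{t0..t1} - E.
        (\<psi> k has_vector_derivative - blinfun_adjoint (fx (t, x t, u t)) (\<psi> k t)) (at t within {t0..t1}) \<and>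
        (\<psi>t k has_vector_derivative - (\<psi> k t \<bullet> ft (t, x t, u t))) (at t within {t0..t1}))"
    using adj unfolding adjoint_pair_def by blast
  then obtain E where E: "\<And>k. k < M \<Longrightarrow> negligible (E k)"
    "\<And>k t. k < M \<Longrightarrow> t \<in> {t0..t1} - E k \<Longrightarrow> (\<psi> k has_vector_derivative - blinfun_adjoint (fx (t, x t, u t)) (\<psi> k t)) (at t within {t0..t1})"
    "\<And>k t. k < M \<Longrightarrow> t \<in> {t0..t1} - E k \<Longrightarrow> (\<psi>t k has_vector_derivative - (\<psi> k t \<bullet> ft (t, x t, u t))) (at t within {t0..t1})"
    by metis
  have lip: "lipschitz_some {t0..t1} (\<lambda>t. \<Sum>k<M. l k *\<^sub>R \<psi> k t)"
  proof (rule lipschitz_some_sum)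
    fix k assume "k \<in> {..<M}"
    then obtain L where L: "L-lipschitz_on {t0..t1} (\<psi> k)" using adj unfolding adjoint_pair_def by blast
    show "lipschitz_some {t0..t1} (\<lambda>t. l k *\<^sub>R \<psi> k t)" using lipschitz_on_cmult[OF L] by blast
  qed
  have lipt: "lipschitz_some {t0..t1} (\<lambda>t. \<Sum>k<M. l k * \<psi>t k t)"
    using adj unfolding adjoint_pair_def by (intro lipschitz_some_sum lipschitz_some_mult lipschitz_some_const) blast
  have adj_sum: "blinfun_adjoint A (\<Sum>k<M. l k *\<^sub>R \<psi> k t) = (\<Sum>k<M. l k *\<^sub>R blinfun_adjoint A (\<psi> k t))" for A t
  proof -
    have "blinfun_adjoint A (\<Sum>k<M. l k *\<^sub>R \<psi> k t) \<bullet> z = (\<Sum>k<M. l k *\<^sub>R blinfun_adjoint A (\<psi> k t)) \<bullet> z" for z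
      by (simp add: inner_blinfun_adjoint inner_sum_left)
    then show ?thesis by (metis vector_eq_rdot)
  qed
  have "negligible (\<Union>k\<in>{..<M}. E k)"  using E(1) by (intro negligible_Union) auto
  moreover have "((\<lambda>t. \<Sum>k<M. l k *\<^sub>R \<psi> k t) has_vector_derivative - blinfun_adjoint (fx (t, x t, u t)) (\<Sum>k<M. l k *\<^sub>R \<psi> k t)) (at t within {t0..t1})"
    "((\<lambda>t. \<Sum>k<M. l k * \<psi>t k t) has_vector_derivative - ((\<Sum>k<M. l k *\<^sub>R \<psi> k t) \<bullet> ft (t, x t, u t))) (at t within {t0..t1})"
    if t: "t \<in> {t0..t1} - (\<Union>k\<in>{..<M}. E k)" for t
  proof -
    have "((\<lambda>t. \<Sum>k<M. l k *\<^sub>R \<psi> k t) has_vector_derivative (\<Sum>k<M. l k *\<^sub>R - blinfun_adjoint (fx (t, x t, u t)) (\<psi> k t))) (at t within {t0..t1})"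
      using t by (intro has_vector_derivative_sum bounded_linear.has_vector_derivative[OF bounded_linear_scaleR_right] E(2)) auto
    then show "((\<lambda>t. \<Sum>k<M. l k *\<^sub>R \<psi> k t) has_vector_derivative - blinfun_adjoint (fx (t, x t, u t)) (\<Sum>k<M. l k *\<^sub>R \<psi> k t)) (at t within {t0..t1})"
      by (simp add: adj_sum sum_negf)
    have "((\<lambda>t. \<Sum>k<M. l k * \<psi>t k t) has_vector_derivative (\<Sum>k<M. l k * - (\<psi> k t \<bullet> ft (t, x t, u t)))) (at t within {t0..t1})"
      using t by (intro has_vector_derivative_sum has_vector_derivative_mult_right E(3)) auto
    then show "((\<lambda>t. \<Sum>k<M. l k * \<psi>t k t) has_vector_derivative - ((\<Sum>k<M. l k *\<^sub>R \<psi> k t) \<bullet> ft (t, x t, u t))) (at t within {t0..t1})"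
      by (simp add: inner_sum_left sum_negf)
  qed
  ultimately show ?thesis unfolding adjoint_pair_def using lip lipt by blast
qed

lemma ham_sum:
  fixes M :: nat
  shows "ham (\<lambda>t. \<Sum>k<M. l k *\<^sub>R \<psi> k t) (\<lambda>t. \<Sum>k<M. l k * \<psi>t k t) t w = (\<Sum>k<M. l k * ham (\<psi> k) (\<psi>t k) t w)"
  by (simp add: ham_def inner_sum_left sum.distrib distrib_left)

lemma ham_zero_ae:
  assumes adj: "adjoint_pair \<psi> \<psi>t" and le: "\<And>t. t \<in> {t0..t1} \<Longrightarrow> ham \<psi> \<psi>t t (u t) \<le> 0"
    and int: "integral {t0..t1} (\<lambda>s. ham \<psi> \<psi>t s (u s)) = 0"
  shows "\<exists>N. negligible N \<and> (\<forall>t\<in>{t0..t1} - N. ham \<psi> \<psi>t t (u t) = 0)"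
proof -
  let ?h = "\<lambda>s. ham \<psi> \<psi>t s (u s)"
  have i: "?h integrable_on {t0..t1}" by (rule ham_integral(1)[OF adj])
  \<comment> \<open>The integrals over both pieces are nonpositive and sum to zero. Differentiating
    the resulting zero function almost everywhere recovers the integrand.\<close>
  have zero: "integral {t0..t} ?h = 0" if t: "t \<in> {t0..t1}" for t
  proof -
    have it: "?h integrable_on {t0..t}" "?h integrable_on {t..t1}" using t by (auto intro: integrable_on_subinterval[OF i])
    have "integral {t0..t} ?h + integral {t..t1} ?h = 0"
      using t int by (subst Henstock_Kurzweil_Integration.integral_combine) (auto intro: i)
    moreover have "integral {t0..t} ?h \<le> integral {t0..t} (\<lambda>_. 0)" "integral {t..t1} ?h \<le> integral {t..t1} (\<lambda>_. 0)"
      by (rule integral_le[OF it(1)]; use t le in auto) (rule integral_le[OF it(2)]; use t le in auto)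
    ultimately show ?thesis by simp
  qed
  obtain N where N: "negligible N" "\<And>t. t \<in> {t0..t1} - N \<Longrightarrow> ((\<lambda>s. integral {t0..s} ?h) has_vector_derivative ?h t) (at t within {t0..t1})"
    using has_vector_derivative_indefinite_integral[OF i] by blast
  have "?h t = 0" if t: "t \<in> {t0..t1} - N" for t
  proof -
    have "((\<lambda>_. 0) has_vector_derivative ?h t) (at t within {t0..t1})"
      by (rule has_vector_derivative_transform[OF _ _ N(2)[OF t]]) (use t zero in auto)
    moreover have "((\<lambda>_. 0::real) has_vector_derivative 0) (at t within {t0..t1})" by (rule has_vector_derivative_const)
    ultimately show ?thesis
      using vector_derivative_unique_within[of t "{t0..t1}"] t t0_less_t1 by (metis DiffD1 box_real(2) islimpt_Icc trivial_limit_within)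
  qed
  then show ?thesis using N(1) by blast
qed

end

section \<open>From the given process to a continuous state and a Borel control\<close>

lemma AE_lebesgue_on_Icc_iff:
  "(AE t in lebesgue_on {a..b::real}. P t) \<longleftrightarrow> negligible {t \<in> {a..b}. \<not> P t}"
proof -
  have "(AE t in lebesgue_on {a..b}. P t) \<longleftrightarrow> (AE t in lebesgue. t \<in> {a..b} \<longrightarrow> P t)"
    by (rule AE_restrict_space_iff) auto
  also have "\<dots> \<longleftrightarrow> negligible {t \<in> {a..b}. \<not> P t}"
  proof
    assume "AE t in lebesgue. t \<in> {a..b} \<longrightarrow> P t"
    then obtain N where "N \<in> null_sets lebesgue" "{t \<in> space lebesgue. \<not> (t \<in> {a..b} \<longrightarrow> P t)} \<subseteq> N"
      unfolding eventually_ae_filter by blast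
    then show "negligible {t \<in> {a..b}. \<not> P t}"
      using negligible_iff_null_sets negligible_subset[of N] by auto
  next
    assume "negligible {t \<in> {a..b}. \<not> P t}"
    then show "AE t in lebesgue. t \<in> {a..b} \<longrightarrow> P t"
      unfolding eventually_ae_filter negligible_iff_null_sets by (intro bexI[of _ "{t \<in> {a..b}. \<not> P t}"]) auto
  qed
  finally show ?thesis .
qed

lemma absolutely_continuous_fun_imp_continuous_on:
  assumes "absolutely_continuous_fun a b g"
  shows "continuous_on {a..b} g"
  unfolding continuous_on_iff
proof (intro ballI allI impI)
  fix t e :: real assume t: "t \<in> {a..b}" and "e > 0"
  then obtain d where "d > 0" and d: "\<And>(m::nat) l r. (\<forall>i<m. a \<le> l i \<and> l i \<le> r i \<and> r i \<le> b) \<Longrightarrow>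
        disjoint_family_on (\<lambda>i. {l i<..<r i}) {..<m} \<Longrightarrow>
        (\<Sum>i<m. r i - l i) < d \<Longrightarrow> (\<Sum>i<m. norm (g (r i) - g (l i))) < e"
    using assms unfolding absolutely_continuous_fun_def by meson
  show "\<exists>d>0. \<forall>s\<in>{a..b}. dist s t < d \<longrightarrow> dist (g s) (g t) < e"
  proof (intro exI conjI ballI impI)
    fix s assume s: "s \<in> {a..b}" "dist s t < d"
    have "norm (g (max s t) - g (min s t)) < e"
      using d[of 1 "\<lambda>_. min s t" "\<lambda>_. max s t"] s t by (auto simp: disjoint_family_on_def dist_real_def)
    then show "dist (g s) (g t) < e" by (cases "s \<le> t") (auto simp: dist_norm norm_minus_commute)
  qed fact
qed

text \<open>\<open>U\<close> may fail to be measurable, so the exceptional sets are first enclosed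
  in Borel null sets; there the control is replaced by one of its own good values. This preserves
  boundedness and gives membership in \<open>U\<close> at every time.\<close>

lemma borel_control_modification:
  fixes u :: "real \<Rightarrow> 'b::euclidean_space"
  assumes "a < b" and meas: "u \<in> borel_measurable (lebesgue_on {a..b})" and bd: "bounded (u ` {a..b})"
    and U: "AE t in lebesgue_on {a..b}. u t \<in> U"
  shows "\<exists>u' Z. u' \<in> borel_measurable borel \<and> bounded (range u') \<and> range u' \<subseteq> U \<and> negligible Z \<and> (\<forall>t\<in>{a..b} - Z. u' t = u t)"
proof -
  define g where "g = (\<lambda>t. if t \<in> {a..b} then u t else 0)"
  have g: "g \<in> borel_measurable lebesgue"
    unfolding g_def using meas by (subst borel_measurable_if) auto
  have "\<exists>h\<in>borel_measurable lborel. AE t in lborel. g t \<bullet> c = h t" for c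
    by (rule completion_ex_borel_measurable_real) (use g in measurable)
  then obtain h where h: "\<And>c. h c \<in> borel_measurable lborel" "\<And>c. AE t in lborel. g t \<bullet> c = h c t" by metis
  define u1 where "u1 = (\<lambda>t. \<Sum>c\<in>Basis. h c t *\<^sub>R c)"
  have u1: "u1 \<in> borel_measurable borel" unfolding u1_def using h(1) by (intro borel_measurable_sum borel_measurable_scaleR) auto
  have "AE t in lborel. \<forall>c\<in>Basis. g t \<bullet> c = h c t" using h(2) by (intro AE_finite_allI) auto
  then have "AE t in lborel. g t = u1 t"
  proof eventually_elim
    case (elim t)
    have "g t = (\<Sum>c\<in>Basis. (g t \<bullet> c) *\<^sub>R c)" by (simp add: euclidean_representation)
    then show ?case using elim by (simp add: u1_def)
  qed
  then obtain N1 where N1: "N1 \<in> null_sets lborel" "{t. g t \<noteq> u1 t} \<subseteq> N1"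
    unfolding eventually_ae_filter by auto
  have "negligible {t \<in> {a..b}. u t \<notin> U}" using U by (simp add: AE_lebesgue_on_Icc_iff)
  then obtain N2 where N2: "N2 \<in> null_sets lborel" "{t \<in> {a..b}. u t \<notin> U} \<subseteq> N2"
    unfolding negligible_iff_null_sets null_sets_completion_iff2 by blast
  define Z where "Z = N1 \<union> N2"
  have Z: "Z \<in> null_sets lborel" unfolding Z_def using N1(1) N2(1) by (rule null_sets.Un)
  then have negZ: "negligible Z" unfolding negligible_iff_null_sets by (rule null_sets_completionI)
  \<comment> \<open>A nondegenerate interval is not null, so a good time exists; the control value
    there serves as the replacement.\<close>
  have "\<not> {a..b} \<subseteq> Z"
  proof
    assume "{a..b} \<subseteq> Z"
    then have "negligible (cbox a b)" using negZ negligible_subset by auto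
    then have "box a b = {}" unfolding negligible_interval .
    then show False using \<open>a < b\<close> by (simp add: box_real)
  qed
  then obtain t0 where t0: "t0 \<in> {a..b} - Z" by blast
  have good: "u1 t = u t" "u t \<in> U" if "t \<in> {a..b} - Z" for t
  proof -
    have "g t = u1 t" using that N1(2) by (auto simp: Z_def)
    then show "u1 t = u t" using that by (simp add: g_def)
    show "u t \<in> U" using that N2(2) by (auto simp: Z_def)
  qed
  define u' where "u' = (\<lambda>t. if t \<in> {a..b} - Z then u1 t else u t0)"
  have "{a..b} - Z \<in> sets borel" using Z by auto
  then have "u' \<in> borel_measurable borel"
    unfolding u'_def by (intro measurable_If_set u1) auto
  moreover have "range u' \<subseteq> u ` {a..b}" using good t0 by (auto simp: u'_def)
  then have "bounded (range u')" using bd bounded_subset by blast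
  moreover have "range u' \<subseteq> U" using good t0 by (auto simp: u'_def)
  moreover have "\<forall>t\<in>{a..b} - Z. u' t = u t" using good by (simp add: u'_def)
  ultimately show ?thesis using negZ by blast
qed

lemma sum_lessThan_add:
  fixes h :: "nat \<Rightarrow> 'a::comm_monoid_add"
  shows "(\<Sum>k<a + b. h k) = (\<Sum>k<a. h k) + (\<Sum>j<b. h (a + j))"
  by (induction b) (simp_all add: add.assoc)

theorem theorem1:
  fixes f :: "real \<Rightarrow> real ^ 'n \<Rightarrow> real ^ 'r \<Rightarrow> real ^ 'n"
    and U :: "(real ^ 'r) set"
    and F\<^sub>0 :: "'n endpt \<Rightarrow> real"
    and dF dK :: nat
    and F K :: "nat \<Rightarrow> 'n endpt \<Rightarrow> real"
    and t\<^sub>0 t\<^sub>1 :: real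
    and x :: "real \<Rightarrow> real ^ 'n"
    and u :: "real \<Rightarrow> real ^ 'r"
  assumes "regular_rhs f"
    and "C1_function F\<^sub>0"
    and "\<And>i. i < dF \<Longrightarrow> C1_function (F i)"
    and "\<And>j. j < dK \<Longrightarrow> C1_function (K j)"
    and "strong_minimum F\<^sub>0 f U dF F dK K t\<^sub>0 t\<^sub>1 x u"
  shows "\<exists>(\<alpha>\<^sub>0::real) (\<alpha>::nat \<Rightarrow> real) (\<beta>::nat \<Rightarrow> real) (\<psi>\<^sub>x::real \<Rightarrow> real ^ 'n) (\<psi>\<^sub>t::real \<Rightarrow> real).
     absolutely_continuous_fun t\<^sub>0 t\<^sub>1 \<psi>\<^sub>x \<and> absolutely_continuous_fun t\<^sub>0 t\<^sub>1 \<psi>\<^sub>t \<and>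
     \<alpha>\<^sub>0 \<ge> 0 \<and> (\<forall>i<dF. \<alpha> i \<ge> 0) \<and>
     \<alpha>\<^sub>0 + L2_set \<alpha> {..<dF} + L2_set \<beta> {..<dK} > 0 \<and>
     (\<Sum>i<dF. \<alpha> i * F i (t\<^sub>0, x t\<^sub>0, t\<^sub>1, x t\<^sub>1)) = 0 \<and>
     (AE t in lebesgue_on {t\<^sub>0..t\<^sub>1}.
        (\<psi>\<^sub>x has_vector_derivative
           - gradient (\<lambda>y. pontryagin_fun f (\<psi>\<^sub>x t) t y (u t)) (x t)) (at t within {t\<^sub>0..t\<^sub>1}) \<and>
        (\<psi>\<^sub>t has_vector_derivative
           - deriv (\<lambda>s. pontryagin_fun f (\<psi>\<^sub>x t) s (x t) (u t)) t) (at t within {t\<^sub>0..t\<^sub>1})) \<and>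
     (let l = endpoint_lagrange \<alpha>\<^sub>0 F\<^sub>0 dF \<alpha> F dK \<beta> K in
        \<psi>\<^sub>x t\<^sub>0 = gradient (\<lambda>y. l (t\<^sub>0, y, t\<^sub>1, x t\<^sub>1)) (x t\<^sub>0) \<and>
        \<psi>\<^sub>x t\<^sub>1 = - gradient (\<lambda>y. l (t\<^sub>0, x t\<^sub>0, t\<^sub>1, y)) (x t\<^sub>1) \<and>
        \<psi>\<^sub>t t\<^sub>0 = deriv (\<lambda>s. l (s, x t\<^sub>0, t\<^sub>1, x t\<^sub>1)) t\<^sub>0 \<and>
        \<psi>\<^sub>t t\<^sub>1 = - deriv (\<lambda>s. l (t\<^sub>0, x t\<^sub>0, s, x t\<^sub>1)) t\<^sub>1) \<and>
     (AE t in lebesgue_on {t\<^sub>0..t\<^sub>1}. pontryagin_fun f (\<psi>\<^sub>x t) t (x t) (u t) + \<psi>\<^sub>t t = 0) \<and>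
     (\<forall>t\<in>{t\<^sub>0..t\<^sub>1}. \<forall>v\<in>U. pontryagin_fun f (\<psi>\<^sub>x t) t (x t) v + \<psi>\<^sub>t t \<le> 0)"
proof -
  let ?x0 = "x t\<^sub>0" and ?x1 = "x t\<^sub>1"
  let ?z = "(t\<^sub>0, x t\<^sub>0, t\<^sub>1, x t\<^sub>1)"
  obtain ft fx where "continuous_on UNIV (\<lambda>(t, x, u). f t x u)" "continuous_on UNIV ft" "continuous_on UNIV fx"
    "\<And>t x u. ((\<lambda>s. f s x u) has_vector_derivative ft (t, x, u)) (at t)"
    "\<And>t x u. ((\<lambda>y. f t y u) has_derivative blinfun_apply (fx (t, x, u))) (at x)"
    using assms(1) unfolding regular_rhs_def by blast
  then interpret cs: control_system f ft fx by unfold_locales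
  have adm: "admissible f U dF F dK K t\<^sub>0 t\<^sub>1 x u"
    using assms(5) by (simp add: strong_minimum_def)
  then have t01: "t\<^sub>0 < t\<^sub>1" and ac: "absolutely_continuous_fun t\<^sub>0 t\<^sub>1 x"
    and um: "u \<in> borel_measurable (lebesgue_on {t\<^sub>0..t\<^sub>1})" and ub: "bounded (u ` {t\<^sub>0..t\<^sub>1})"
    and ode: "AE t in lebesgue_on {t\<^sub>0..t\<^sub>1}. (x has_vector_derivative f t (x t) (u t)) (at t within {t\<^sub>0..t\<^sub>1})"
    and uU: "AE t in lebesgue_on {t\<^sub>0..t\<^sub>1}. u t \<in> U"
    and K0: "\<And>j. j < dK \<Longrightarrow> K j ?z = 0" and F0: "\<And>i. i < dF \<Longrightarrow> F i ?z \<le> 0"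
    by (auto simp: admissible_def is_process_def)
  obtain u' Z where u': "u' \<in> borel_measurable borel" "bounded (range u')" "range u' \<subseteq> U"
    and Z: "negligible Z" "\<And>t. t \<in> {t\<^sub>0..t\<^sub>1} - Z \<Longrightarrow> u' t = u t"
    using borel_control_modification[OF t01 um ub uU] by blast
  \<comment> \<open>Constant extension beyond the interval gives a state that is continuous on the
    line.\<close>
  define y where "y = (\<lambda>t. x (max t\<^sub>0 (min t\<^sub>1 t)))"
  have yx: "y t = x t" if "t \<in> {t\<^sub>0..t\<^sub>1}" for t using that by (simp add: y_def)
  have y01: "y t\<^sub>0 = ?x0" "y t\<^sub>1 = ?x1" using t01 by (simp_all add: yx)
  have cont_y: "continuous_on UNIV y"
    unfolding y_def using t01
    by (intro continuous_on_compose2[OF absolutely_continuous_fun_imp_continuous_on[OF ac]] continuous_intros) auto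
  define E0 where "E0 = {t \<in> {t\<^sub>0..t\<^sub>1}. \<not> (x has_vector_derivative f t (x t) (u t)) (at t within {t\<^sub>0..t\<^sub>1})}"
  have E0: "negligible E0" using ode by (simp add: AE_lebesgue_on_Icc_iff E0_def)
  \<comment> \<open>Absolute continuity of the given state turns the differential equation, valid
    almost everywhere, into the integral equation.\<close>
  have y_eq: "y t = y t\<^sub>0 + integral {t\<^sub>0..t} (\<lambda>s. f s (y s) (u' s))" if t: "t \<in> {t\<^sub>0..t\<^sub>1}" for t
  proof -
    have "((\<lambda>s. f s (y s) (u' s)) has_integral x t - x t\<^sub>0) {t\<^sub>0..t}"
    proof (rule fundamental_theorem_of_calculus_absolutely_continuous)
      show "absolutely_continuous_fun t\<^sub>0 t x" using absolutely_continuous_fun_subset[OF ac] t by auto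
      show "negligible (E0 \<union> Z)" using E0 Z(1) by (rule negligible_Un)
      fix s assume s: "s \<in> {t\<^sub>0..t} - (E0 \<union> Z)"
      then have s': "s \<in> {t\<^sub>0..t\<^sub>1} - Z" using t by auto
      then have "(x has_vector_derivative f s (x s) (u s)) (at s within {t\<^sub>0..t\<^sub>1})"
        using s by (auto simp: E0_def)
      then have "(x has_vector_derivative f s (x s) (u s)) (at s within {t\<^sub>0..t})"
        by (rule has_vector_derivative_within_subset) (use t in auto)
      then show "(x has_vector_derivative f s (y s) (u' s)) (at s within {t\<^sub>0..t})"
        using s' yx[of s] Z(2)[OF s'] by simp
    qed (use t in auto)
    then show ?thesis using yx[OF t] y01 by (simp add: integral_unique)
  qed
  \<comment> \<open>The cost occupies index \<open>0\<close>, so the inequalities begin at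
    \<open>1\<close> and the equalities at \<open>m\<close>.\<close>
  define m where "m = 1 + dF"
  define M where "M = m + dK"
  define G where "G = (\<lambda>k z. if k = 0 then F\<^sub>0 z else if k < m then F (k - 1) z else K (k - m) z)"
  have mM: "1 \<le> m" "m \<le> M" by (simp_all add: m_def M_def)
  have G_simps: "G 0 = F\<^sub>0" "\<And>i. i < dF \<Longrightarrow> G (Suc i) = F i" "\<And>j. G (m + j) = K j"
    by (auto simp: G_def m_def fun_eq_iff)
  have "C1_function (G k)" if "k < M" for k
  proof -
    consider "k = 0" | i where "i < dF" "k = Suc i" | j where "j < dK" "k = m + j"
    proof -
      have "k = 0 \<or> (k \<noteq> 0 \<and> k < m) \<or> m \<le> k" by auto
      then show ?thesis
        using that by (metis Suc_pred' add_less_cancel_left le_Suc_ex m_def M_def neq0_conv \<open>k < M\<close> plus_1_eq_Suc)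
    qed
    then show ?thesis using assms(2-4) by cases (simp_all add: G_simps)
  qed
  then obtain G' where deriv: "\<And>k z. k < M \<Longrightarrow> (G k has_derivative blinfun_apply (G' k z)) (at z)"
    and cont: "\<And>k. k < M \<Longrightarrow> continuous_on UNIV (G' k)"
    unfolding C1_function_def by metis
  \<comment> \<open>The gradient of \<open>G k\<close> at the reference end point, split below into
    its four blocks.\<close>
  define g where "g = (\<lambda>k. adjoint (blinfun_apply (G' k ?z)) 1)"
  define g1 where "g1 = (\<lambda>k. fst (g k))"
  define g2 where "g2 = (\<lambda>k. fst (snd (g k)))"
  define g3 where "g3 = (\<lambda>k. fst (snd (snd (g k))))"
  define g4 where "g4 = (\<lambda>k. snd (snd (snd (g k))))"
  have G': "blinfun_apply (G' k ?z) (a, b, c, d) = g1 k * a + g2 k \<bullet> b + g3 k * c + g4 k \<bullet> d" for k a b c d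
  proof -
    have "blinfun_apply (G' k ?z) (a, b, c, d) = (a, b, c, d) \<bullet> g k"
      unfolding g_def using adjoint_works[of "blinfun_apply (G' k ?z)" "(a, b, c, d)" 1]
      by (simp add: bounded_linear.linear[OF blinfun.bounded_linear_right])
    then show ?thesis by (simp add: inner_prod_def g1_def g2_def g3_def g4_def inner_commute mult.commute)
  qed
  have feas: "\<And>k. 1 \<le> k \<Longrightarrow> k < m \<Longrightarrow> G k ?z \<le> 0" "\<And>k. m \<le> k \<Longrightarrow> k < M \<Longrightarrow> G k ?z = 0"
    using F0 K0 by (auto simp: G_def m_def M_def)
  obtain R B0 Mb where "reference f ft fx t\<^sub>0 t\<^sub>1 y u' (R + 1) B0 Mb"
    using cs.reference_exists[OF t01 cont_y y_eq u'(1,2)] by blast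
  then interpret r0: reference f ft fx t\<^sub>0 t\<^sub>1 y u' "R + 1" B0 Mb .
  \<comment> \<open>Lipschitz trajectories with Borel controls form admissible processes, so the
    strong minimum covers all these competitors.\<close>
  have opt: "r0.optimal_trajectory U m M G"
  proof -
    obtain \<epsilon> where "\<epsilon> > 0" and \<epsilon>: "\<And>s\<^sub>0 s\<^sub>1 y v. admissible f U dF F dK K s\<^sub>0 s\<^sub>1 y v \<Longrightarrow> \<bar>s\<^sub>0 - t\<^sub>0\<bar> < \<epsilon> \<Longrightarrow> \<bar>s\<^sub>1 - t\<^sub>1\<bar> < \<epsilon> \<Longrightarrow>
        (\<forall>t\<in>{s\<^sub>0..s\<^sub>1} \<inter> {t\<^sub>0..t\<^sub>1}. norm (y t - x t) < \<epsilon>) \<Longrightarrow> F\<^sub>0 (s\<^sub>0, y s\<^sub>0, s\<^sub>1, y s\<^sub>1) \<ge> F\<^sub>0 ?z"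
      using assms(5) unfolding strong_minimum_def by blast
    show ?thesis unfolding r0.optimal_trajectory_def
    proof (intro exI[of _ \<epsilon>] conjI allI impI)
      fix s0 s1 X W E
      assume s: "s0 < s1" and lip: "\<exists>L. L-lipschitz_on {s0..s1} X" and W: "W \<in> borel_measurable borel" "bounded (range W)" "range W \<subseteq> U"
        and E: "negligible E" "\<forall>t\<in>{s0..s1} - E. (X has_vector_derivative f t (X t) (W t)) (at t within {s0..s1})"
        and near: "\<bar>s0 - t\<^sub>0\<bar> < \<epsilon>" "\<bar>s1 - t\<^sub>1\<bar> < \<epsilon>" "\<forall>t\<in>{s0..s1} \<inter> {t\<^sub>0..t\<^sub>1}. norm (X t - y t) < \<epsilon>"
        and GX: "\<forall>k. 1 \<le> k \<longrightarrow> k < m \<longrightarrow> G k (s0, X s0, s1, X s1) \<le> 0" "\<forall>k. m \<le> k \<longrightarrow> k < M \<longrightarrow> G k (s0, X s0, s1, X s1) = 0"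
      have "F i (s0, X s0, s1, X s1) \<le> 0" if "i < dF" for i
        using GX(1)[rule_format, of "Suc i"] that by (simp add: G_simps m_def)
      moreover have "K j (s0, X s0, s1, X s1) = 0" if "j < dK" for j
        using GX(2)[rule_format, of "m + j"] that by (simp add: G_simps M_def)
      moreover have "W \<in> borel_measurable (lebesgue_on {s0..s1})"
      proof (rule measurable_restrict_space1)
        show "W \<in> borel_measurable lebesgue" using W(1) by (simp add: measurable_completion)
      qed
      moreover have "bounded (W ` {s0..s1})" using W(2) by (rule bounded_subset) auto
      moreover have "AE t in lebesgue_on {s0..s1}. (X has_vector_derivative f t (X t) (W t)) (at t within {s0..s1})"
        unfolding AE_lebesgue_on_Icc_iff by (rule negligible_subset[OF E(1)]) (use E(2) in auto)
      moreover have "AE t in lebesgue_on {s0..s1}. W t \<in> U" using W(3) by (intro AE_I2) auto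
      moreover have "absolutely_continuous_fun s0 s1 X" using lip lipschitz_on_imp_absolutely_continuous_fun by blast
      ultimately have "admissible f U dF F dK K s0 s1 X W"
        using s by (simp add: admissible_def is_process_def)
      then have "F\<^sub>0 (s0, X s0, s1, X s1) \<ge> F\<^sub>0 ?z"
        by (rule \<epsilon>) (use near yx in auto)
      then show "G 0 (t\<^sub>0, y t\<^sub>0, t\<^sub>1, y t\<^sub>1) \<le> G 0 (s0, X s0, s1, X s1)" by (simp add: G_simps y01)
    qed fact
  qed
  have "\<exists>l \<psi> \<psi>t Rad Bu Mb. reference f ft fx t\<^sub>0 t\<^sub>1 y u' Rad Bu Mb \<and>
    (\<forall>k<M. r0.adjoint_pair (\<psi> k) (\<psi>t k) \<and> \<psi> k t\<^sub>1 = - g4 k \<and> \<psi>t k t\<^sub>1 = - g3 k) \<and>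
    r0.multipliers m M G g1 g2 \<psi> \<psi>t l \<and> (\<forall>t\<in>{t\<^sub>0..t\<^sub>1}. \<forall>w\<in>U. (\<Sum>k<M. l k * r0.ham (\<psi> k) (\<psi>t k) t w) \<le> 0)"
  proof (rule cs.multipliers_exist[where G = G and G' = G', OF t01 cont_y y_eq u'(1-3) mM])
    show "blinfun_apply (G' k (t\<^sub>0, y t\<^sub>0, t\<^sub>1, y t\<^sub>1)) (a, b, c, d) = g1 k * a + g2 k \<bullet> b + g3 k * c + g4 k \<bullet> d" for k a b c d
      unfolding y01 by (rule G')
    show "G k (t\<^sub>0, y t\<^sub>0, t\<^sub>1, y t\<^sub>1) \<le> 0" if "1 \<le> k" "k < m" for k
      unfolding y01 by (rule feas(1)[OF that])
    show "G k (t\<^sub>0, y t\<^sub>0, t\<^sub>1, y t\<^sub>1) = 0" if "m \<le> k" "k < M" for k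
      unfolding y01 by (rule feas(2)[OF that])
  qed (fact deriv cont opt | assumption)+
  then obtain l \<psi> \<psi>t where adj: "\<And>k. k < M \<Longrightarrow> r0.adjoint_pair (\<psi> k) (\<psi>t k)"
    "\<And>k. k < M \<Longrightarrow> \<psi> k t\<^sub>1 = - g4 k" "\<And>k. k < M \<Longrightarrow> \<psi>t k t\<^sub>1 = - g3 k"
    and mult: "r0.multipliers m M G g1 g2 \<psi> \<psi>t l"
    and max: "\<And>t w. t \<in> {t\<^sub>0..t\<^sub>1} \<Longrightarrow> w \<in> U \<Longrightarrow> (\<Sum>k<M. l k * r0.ham (\<psi> k) (\<psi>t k) t w) \<le> 0"
    by blast
  note mult = mult[unfolded r0.multipliers_def y01]
  \<comment> \<open>The multipliers combine the adjoint functions of the single endpoint functions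
    into those of the Lagrange function.\<close>
  define \<psi>\<^sub>x where "\<psi>\<^sub>x = (\<lambda>t. \<Sum>k<M. l k *\<^sub>R \<psi> k t)"
  define \<psi>\<^sub>t where "\<psi>\<^sub>t = (\<lambda>t. \<Sum>k<M. l k * \<psi>t k t)"
  define \<alpha> where "\<alpha> = (\<lambda>i. l (Suc i))"
  define \<beta> where "\<beta> = (\<lambda>j. l (m + j))"
  have pair: "r0.adjoint_pair \<psi>\<^sub>x \<psi>\<^sub>t"
    unfolding \<psi>\<^sub>x_def \<psi>\<^sub>t_def using adj(1) by (rule r0.adjoint_pair_sum)
  have ham: "r0.ham \<psi>\<^sub>x \<psi>\<^sub>t t w = (\<Sum>k<M. l k * r0.ham (\<psi> k) (\<psi>t k) t w)" for t w
    unfolding \<psi>\<^sub>x_def \<psi>\<^sub>t_def by (rule r0.ham_sum)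
  have ham_le: "r0.ham \<psi>\<^sub>x \<psi>\<^sub>t t w \<le> 0" if "t \<in> {t\<^sub>0..t\<^sub>1}" "w \<in> U" for t w
    using max[OF that] by (simp add: ham)
  have ham_int: "integral {t\<^sub>0..t\<^sub>1} (\<lambda>s. r0.ham \<psi>\<^sub>x \<psi>\<^sub>t s (u' s)) = 0"
    unfolding ham using mult
    by (subst Henstock_Kurzweil_Integration.integral_sum) (auto intro: integrable_on_mult_right r0.ham_integral(1)[OF adj(1)])
  \<comment> \<open>The inequality may be applied along the process at every time, as
    \<open>u'\<close> takes its values in \<open>U\<close> everywhere.\<close>
  obtain E1 where E1: "negligible E1" "\<And>t. t \<in> {t\<^sub>0..t\<^sub>1} - E1 \<Longrightarrow> r0.ham \<psi>\<^sub>x \<psi>\<^sub>t t (u' t) = 0"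
    using r0.ham_zero_ae[OF pair ham_le ham_int] u'(3) by blast
  obtain E2 where E2: "negligible E2"
    "\<And>t. t \<in> {t\<^sub>0..t\<^sub>1} - E2 \<Longrightarrow> (\<psi>\<^sub>x has_vector_derivative - blinfun_adjoint (fx (t, y t, u' t)) (\<psi>\<^sub>x t)) (at t within {t\<^sub>0..t\<^sub>1})"
    "\<And>t. t \<in> {t\<^sub>0..t\<^sub>1} - E2 \<Longrightarrow> (\<psi>\<^sub>t has_vector_derivative - (\<psi>\<^sub>x t \<bullet> ft (t, y t, u' t))) (at t within {t\<^sub>0..t\<^sub>1})"
    using pair unfolding r0.adjoint_pair_def by blast
  have grad_H: "gradient (\<lambda>y. pontryagin_fun f p t y w) z = blinfun_adjoint (fx (t, z, w)) p" for p t z w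
  proof (rule gradient_eq)
    have "((\<lambda>y. p \<bullet> f t y w) has_derivative (\<lambda>h. p \<bullet> fx (t, z, w) h)) (at z)"
      by (intro derivative_intros cs.deriv_x)
    then show "GDERIV (\<lambda>y. pontryagin_fun f p t y w) z :> blinfun_adjoint (fx (t, z, w)) p"
      by (simp add: gderiv_def pontryagin_fun_def inner_commute[of _ "blinfun_adjoint _ _"] inner_blinfun_adjoint)
  qed
  have deriv_H: "deriv (\<lambda>s. pontryagin_fun f p s z w) t = p \<bullet> ft (t, z, w)" for p t z w
  proof (rule DERIV_imp_deriv)
    have "((\<lambda>s. p \<bullet> f s z w) has_vector_derivative p \<bullet> ft (t, z, w)) (at t)"
      by (rule bounded_linear.has_vector_derivative[OF bounded_linear_inner_right cs.deriv_t])
    then show "((\<lambda>s. pontryagin_fun f p s z w) has_real_derivative p \<bullet> ft (t, z, w)) (at t)"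
      by (simp add: pontryagin_fun_def has_real_derivative_iff_has_vector_derivative)
  qed
  have sumM: "(\<Sum>k<M. h k) = h 0 + (\<Sum>i<dF. h (Suc i)) + (\<Sum>j<dK. h (m + j))" for h :: "nat \<Rightarrow> real"
    unfolding M_def sum_lessThan_add m_def plus_1_eq_Suc sum.lessThan_Suc_shift by simp
  have lagr: "endpoint_lagrange (l 0) F\<^sub>0 dF \<alpha> F dK \<beta> K = (\<lambda>z. \<Sum>k<M. l k * G k z)"
    by (simp add: fun_eq_iff endpoint_lagrange_def sumM \<alpha>_def \<beta>_def G_simps)
  let ?l = "endpoint_lagrange (l 0) F\<^sub>0 dF \<alpha> F dK \<beta> K"
  have dl: "(?l has_derivative (\<lambda>h. \<Sum>k<M. l k * G' k ?z h)) (at ?z)"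
    unfolding lagr by (intro derivative_intros deriv) auto
  \<comment> \<open>The partial derivatives of \<open>?l\<close> are derivatives along maps
    \<open>\<gamma>\<close> that vary one block of the end point.\<close>
  have dl_comp: "((\<lambda>s. ?l (\<gamma> s)) has_derivative (\<lambda>h. \<Sum>k<M. l k * G' k ?z (\<gamma>' h))) (at s)"
    if "(\<gamma> has_derivative \<gamma>') (at s)" "\<gamma> s = ?z" for \<gamma> \<gamma>' and s :: "'s::real_normed_vector"
    using has_derivative_compose[OF that(1), of ?l] dl that(2) by simp
  \<comment> \<open>Initial transversality is the vanishing of the derivative in the initial data;
    terminal transversality holds by the choice of the terminal values.\<close>
  have \<psi>x0: "\<psi>\<^sub>x t\<^sub>0 = (\<Sum>k<M. l k *\<^sub>R g2 k)"
    using mult by (simp add: \<psi>\<^sub>x_def scaleR_diff_right sum_subtractf)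
  have \<psi>t0: "\<psi>\<^sub>t t\<^sub>0 = (\<Sum>k<M. l k * g1 k)"
    using mult by (simp add: \<psi>\<^sub>t_def right_diff_distrib sum_subtractf)
  have \<psi>x1: "\<psi>\<^sub>x t\<^sub>1 = - (\<Sum>k<M. l k *\<^sub>R g4 k)" by (simp add: \<psi>\<^sub>x_def adj sum_negf)
  have \<psi>t1: "\<psi>\<^sub>t t\<^sub>1 = - (\<Sum>k<M. l k * g3 k)" by (simp add: \<psi>\<^sub>t_def adj sum_negf)
  have trans: "\<psi>\<^sub>x t\<^sub>0 = gradient (\<lambda>y. ?l (t\<^sub>0, y, t\<^sub>1, x t\<^sub>1)) (x t\<^sub>0)"
    "\<psi>\<^sub>x t\<^sub>1 = - gradient (\<lambda>y. ?l (t\<^sub>0, x t\<^sub>0, t\<^sub>1, y)) (x t\<^sub>1)"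
    "\<psi>\<^sub>t t\<^sub>0 = deriv (\<lambda>s. ?l (s, x t\<^sub>0, t\<^sub>1, x t\<^sub>1)) t\<^sub>0"
    "\<psi>\<^sub>t t\<^sub>1 = - deriv (\<lambda>s. ?l (t\<^sub>0, x t\<^sub>0, s, x t\<^sub>1)) t\<^sub>1"
  proof -
    have mult_sum: "(*) (\<Sum>k<M. l k * c k) = (\<lambda>h. \<Sum>k<M. l k * (c k * h))" for c :: "nat \<Rightarrow> real"
      by (simp add: fun_eq_iff sum_distrib_right mult.assoc)
    have "((\<lambda>y. ?l (t\<^sub>0, y, t\<^sub>1, x t\<^sub>1)) has_derivative (\<lambda>h. \<Sum>k<M. l k * G' k ?z (0, h, 0, 0))) (at (x t\<^sub>0))"
      by (rule dl_comp) (auto intro!: derivative_eq_intros simp: zero_prod_def)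
    then have "GDERIV (\<lambda>y. ?l (t\<^sub>0, y, t\<^sub>1, x t\<^sub>1)) (x t\<^sub>0) :> (\<Sum>k<M. l k *\<^sub>R g2 k)"
      by (simp add: gderiv_def G' inner_sum_right inner_commute)
    then show "\<psi>\<^sub>x t\<^sub>0 = gradient (\<lambda>y. ?l (t\<^sub>0, y, t\<^sub>1, x t\<^sub>1)) (x t\<^sub>0)" by (simp add: gradient_eq \<psi>x0)
    have "((\<lambda>y. ?l (t\<^sub>0, x t\<^sub>0, t\<^sub>1, y)) has_derivative (\<lambda>h. \<Sum>k<M. l k * G' k ?z (0, 0, 0, h))) (at (x t\<^sub>1))"
      by (rule dl_comp) (auto intro!: derivative_eq_intros simp: zero_prod_def)
    then have "GDERIV (\<lambda>y. ?l (t\<^sub>0, x t\<^sub>0, t\<^sub>1, y)) (x t\<^sub>1) :> (\<Sum>k<M. l k *\<^sub>R g4 k)"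
      by (simp add: gderiv_def G' inner_sum_right inner_commute)
    then show "\<psi>\<^sub>x t\<^sub>1 = - gradient (\<lambda>y. ?l (t\<^sub>0, x t\<^sub>0, t\<^sub>1, y)) (x t\<^sub>1)" by (simp add: gradient_eq \<psi>x1)
    have "((\<lambda>s. ?l (s, x t\<^sub>0, t\<^sub>1, x t\<^sub>1)) has_derivative (\<lambda>h. \<Sum>k<M. l k * G' k ?z (h, 0, 0, 0))) (at t\<^sub>0)"
      by (rule dl_comp) (auto intro!: derivative_eq_intros simp: zero_prod_def)
    then have "((\<lambda>s. ?l (s, x t\<^sub>0, t\<^sub>1, x t\<^sub>1)) has_real_derivative (\<Sum>k<M. l k * g1 k)) (at t\<^sub>0)"
      unfolding has_field_derivative_def mult_sum by (simp add: G')
    then show "\<psi>\<^sub>t t\<^sub>0 = deriv (\<lambda>s. ?l (s, x t\<^sub>0, t\<^sub>1, x t\<^sub>1)) t\<^sub>0" by (simp add: DERIV_imp_deriv \<psi>t0)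
    have "((\<lambda>s. ?l (t\<^sub>0, x t\<^sub>0, s, x t\<^sub>1)) has_derivative (\<lambda>h. \<Sum>k<M. l k * G' k ?z (0, 0, h, 0))) (at t\<^sub>1)"
      by (rule dl_comp) (auto intro!: derivative_eq_intros simp: zero_prod_def)
    then have "((\<lambda>s. ?l (t\<^sub>0, x t\<^sub>0, s, x t\<^sub>1)) has_real_derivative (\<Sum>k<M. l k * g3 k)) (at t\<^sub>1)"
      unfolding has_field_derivative_def mult_sum by (simp add: G')
    then show "\<psi>\<^sub>t t\<^sub>1 = - deriv (\<lambda>s. ?l (t\<^sub>0, x t\<^sub>0, s, x t\<^sub>1)) t\<^sub>1" by (simp add: DERIV_imp_deriv \<psi>t1)
  qed
  \<comment> \<open>If the three nonnegative quantities summed to zero, every multiplier would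
    vanish, against the normalization to \<open>1\<close>.\<close>
  have pos: "l 0 + L2_set \<alpha> {..<dF} + L2_set \<beta> {..<dK} > 0"
  proof (rule ccontr)
    assume neg: "\<not> ?thesis"
    have "l 0 \<ge> 0" using mult mM by simp
    moreover have "L2_set \<alpha> {..<dF} \<ge> 0" "L2_set \<beta> {..<dK} \<ge> 0" by simp_all
    ultimately have "l 0 = 0" "L2_set \<alpha> {..<dF} = 0" "L2_set \<beta> {..<dK} = 0" using neg by linarith+
    then have "l 0 = 0" "\<forall>i<dF. l (Suc i) = 0" "\<forall>j<dK. l (m + j) = 0"
      by (auto simp: L2_set_eq_0_iff \<alpha>_def \<beta>_def)
    then have "(\<Sum>k<M. \<bar>l k\<bar>) = 0" unfolding sumM by simp
    then show False using mult by simp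
  qed
  have slack: "(\<Sum>i<dF. \<alpha> i * F i ?z) = 0"
  proof (rule sum.neutral, rule ballI)
    fix i assume "i \<in> {..<dF}"
    then have "l (Suc i) * G (Suc i) ?z = 0" using mult by (simp add: m_def)
    then show "\<alpha> i * F i ?z = 0" using \<open>i \<in> {..<dF}\<close> by (simp add: \<alpha>_def G_simps)
  qed
  have ac_\<psi>: "absolutely_continuous_fun t\<^sub>0 t\<^sub>1 \<psi>\<^sub>x" "absolutely_continuous_fun t\<^sub>0 t\<^sub>1 \<psi>\<^sub>t"
    using pair lipschitz_on_imp_absolutely_continuous_fun unfolding r0.adjoint_pair_def by blast+
  have signs: "l 0 \<ge> 0" "\<forall>i<dF. \<alpha> i \<ge> 0" using mult by (auto simp: m_def \<alpha>_def)
  \<comment> \<open>Off the null set \<open>Z\<close> the modified control equals the given one, so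
    the relations carry over almost everywhere.\<close>
  have adjoint_ae: "AE t in lebesgue_on {t\<^sub>0..t\<^sub>1}.
        (\<psi>\<^sub>x has_vector_derivative
           - gradient (\<lambda>y. pontryagin_fun f (\<psi>\<^sub>x t) t y (u t)) (x t)) (at t within {t\<^sub>0..t\<^sub>1}) \<and>
        (\<psi>\<^sub>t has_vector_derivative
           - deriv (\<lambda>s. pontryagin_fun f (\<psi>\<^sub>x t) s (x t) (u t)) t) (at t within {t\<^sub>0..t\<^sub>1})"
    unfolding AE_lebesgue_on_Icc_iff grad_H deriv_H
  proof (rule negligible_subset[OF negligible_Un[OF E2(1) Z(1)]], rule subsetI, rule ccontr)
    fix t
    assume t: "t \<in> {t \<in> {t\<^sub>0..t\<^sub>1}. \<not> ((\<psi>\<^sub>x has_vector_derivative - blinfun_adjoint (fx (t, x t, u t)) (\<psi>\<^sub>x t)) (at t within {t\<^sub>0..t\<^sub>1}) \<and>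
       (\<psi>\<^sub>t has_vector_derivative - (\<psi>\<^sub>x t \<bullet> ft (t, x t, u t))) (at t within {t\<^sub>0..t\<^sub>1}))}" "t \<notin> E2 \<union> Z"
    then have "y t = x t" "u' t = u t" by (auto intro!: yx Z(2))
    then show False using t E2(2)[of t] E2(3)[of t] by auto
  qed
  have ham_ae: "AE t in lebesgue_on {t\<^sub>0..t\<^sub>1}. pontryagin_fun f (\<psi>\<^sub>x t) t (x t) (u t) + \<psi>\<^sub>t t = 0"
    unfolding AE_lebesgue_on_Icc_iff
  proof (rule negligible_subset[OF negligible_Un[OF E1(1) Z(1)]], rule subsetI, rule ccontr)
    fix t
    assume t: "t \<in> {t \<in> {t\<^sub>0..t\<^sub>1}. \<not> (pontryagin_fun f (\<psi>\<^sub>x t) t (x t) (u t) + \<psi>\<^sub>t t = 0)}" "t \<notin> E1 \<union> Z"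
    then have "y t = x t" "u' t = u t" by (auto intro!: yx Z(2))
    then show False using t E1(2)[of t] by (auto simp: r0.ham_def pontryagin_fun_def)
  qed
  have max_all: "\<forall>t\<in>{t\<^sub>0..t\<^sub>1}. \<forall>v\<in>U. pontryagin_fun f (\<psi>\<^sub>x t) t (x t) v + \<psi>\<^sub>t t \<le> 0"
    using ham_le yx by (simp add: r0.ham_def pontryagin_fun_def)
  show ?thesis
    unfolding Let_def
    using ac_\<psi> signs pos slack adjoint_ae trans ham_ae max_all
    by (intro exI[of _ "l 0"] exI[of _ \<alpha>] exI[of _ \<beta>] exI[of _ \<psi>\<^sub>x] exI[of _ \<psi>\<^sub>t] conjI)
qed

end
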